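(* Fix an integer $k\ge 2$ and let $p^k(n)$ denote the number of partitions of $n$ into perfect $k$-th powers. Let $n$ be a sufficiently large natural number, and choose positive numbers $X$ and $Y$ satisfying \[ n = X\left( \frac{1}{k^2}\, \zeta\!\left(\tfrac{k+1}{k}\right)\Gamma\!\left(\tfrac{1}{k}\right)X^{1/k} - \frac{1}{2}-\frac{1}{2}\zeta(-k)X^{-1}\right), \qquad Y = \frac{k+1}{2k^3}\, \zeta\!\left(\tfrac{k+1}{k}\right)\Gamma\!\left(\tfrac{1}{k}\right)X^{1/k} - \frac{1}{4}. \] Then there are real numbers $d_1, d_2, \ldots, d_{k}$ (independent of $n$) such that \[ p^k(n+1) - p^k(n) =\frac{\exp\left(\frac{k+1}{k^2}\zeta(\frac{k+1}{k})\Gamma(\frac{1}{k})X^{\frac{1}{k}} - \frac{1}{2}\right)}{(2\pi)^{\frac{k+2}{2}}X^{\frac{5}{2}}Y^{\frac{1}{2}}} \left( \pi^{\frac{1}{2}} + \sum_{j=1}^{k-1} d_jY^{-j} + O(Y^{-k})\right). \]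
   Context: $p^k(n)$ counts partitions of $n$ (non-increasing sequences of positive integers summing to $n$) all of whose parts are perfect $k$-th powers. $\zeta$ is the Riemann zeta function and $\Gamma$ the Gamma function. The implied constant in the $O$-term may depend on $k$. *)

theory Defs
  imports
    "HOL-Complex_Analysis.Complex_Analysis"
    "HOL-Computational_Algebra.Nth_Powers"
begin

definition power_partitions :: "nat \<Rightarrow> nat \<Rightarrow> nat list set" where
  "power_partitions k n =
     {xs. sorted_wrt (\<ge>) xs \<and> sum_list xs = n \<and> (\<forall>x\<in>set xs. x > 0 \<and> is_nth_power k x)}"

definition num_power_partitions :: "nat \<Rightarrow> nat \<Rightarrow> nat" where
  "num_power_partitions k n = card (power_partitions k n)"

(* The Dirichlet series, together with its analytic continuation to the complex plane
   minus the point 1, which is unique by the identity theorem.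
   The value at the pole 1 is left unspecified. *)
definition zeta :: "complex \<Rightarrow> complex" where
  "zeta = (SOME f. f holomorphic_on (- {1}) \<and>
             (\<forall>s. Re s > 1 \<longrightarrow> f s = (\<Sum>n. 1 / of_nat (Suc n) powr s)))"

(* zeta is real on the real axis away from 1, so taking the real part loses nothing there. *)
definition zeta_real :: "real \<Rightarrow> real" where
  "zeta_real x = Re (zeta (complex_of_real x))"

(* X and Y are positive and solve the two equations attached to n; the first one is the
   saddle point equation, with 1 / X the distance of the saddle point from 0. *)
definition saddle_parameters :: "nat \<Rightarrow> nat \<Rightarrow> real \<Rightarrow> real \<Rightarrow> bool" where
  "saddle_parameters k n X Y \<longleftrightarrow> X > 0 \<and> Y > 0 \<and>
     real n = X * (1 / real k ^ 2 * zeta_real ((real k + 1) / real k) * Gamma (1 / real k)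
                     * X powr (1 / real k)
                   - 1 / 2 - 1 / 2 * zeta_real (- real k) * inverse X) \<and>
     Y = (real k + 1) / (2 * real k ^ 3) * zeta_real ((real k + 1) / real k) * Gamma (1 / real k)
           * X powr (1 / real k) - 1 / 4"

end

theory Submission
  imports Defs "HOL-Real_Asymp.Real_Asymp" "HOL-Number_Theory.Cong"
begin

text \<open>Let $\Psi(w) = \prod_m (1 - e^{-m^k w})^{-1}$ be the generating function, so that
  $2\pi (p^k(n+1) - p^k(n)) = \int_{-\pi}^{\pi} e^{nw} (e^w - 1) \Psi(w)\,dt$ with $w = 1/X - it$. Applying
  Euler--Maclaurin summation to $m \mapsto -\log(1 - e^{-(am)^k})$, where $a^k = w$ is close to the
  positive real axis, gives $\log\Psi(w) = c_k w^{-1/k} + \frac12\log w - \frac k2\log 2\pi + O(w)$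
  with $c_k = \frac1k\Gamma(\frac1k)\zeta(1 + \frac1k)$; the logarithmic singularity of the summand at
  $0$ is split off and handled by Stirling's formula. For the
  remaining $t$ a positive proportion of the $m \le X^{1/k}$ have $m^k t$ far from multiples of $2\pi$,
  because the $k$-th difference of $m^k$ is constant; hence $|\Psi(w)|$ is exponentially smaller than
  $\Psi(1/X)$ there. The substitution $t = u/X$ turns the main part into a Laplace integral
  $\int e^{YG(u)} H(u)\,du$ with $G(u) = -u^2 + O(u^3)$, whose expansion in powers of $1/Y$ gives the $d_j$.
  Errors of relative size $1/X$ are absorbed since $Y$ is of order $X^{1/k}$.\<close>

section \<open>Analytic continuation of the zeta function\<close>

text \<open>The exponent k in the error term sets every precision. Since \<open>Y\<close> is of
  order X^(1/k), a relative error 1/X is exactly of order Y^(-k), so the logarithm of the generating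
  function is needed only up to O(w). Writing w = a^k turns the sum over m into values of one fixed
  function at the points a m of a ray. Once k Ln y is added to it, this function has a zero of order
  k at 0, so Euler--Maclaurin summation of order k leaves only terms of size |a|^k = |w|. The term
  with \<open>zeta_real (- real k)\<close> shifts the exponent by O(1/X) and joins this error. As
  \<open>zeta\<close> is a choice, its values above 1 are accessible only after a continuation has
  been constructed. The minor arcs begin at |t| = u/X, with the small u for which the local
  expansion holds, so their bound is proved for an arbitrary constant U in place of u. Differences
  of m^k t with step 1 give nothing for t near 2 pi a / k!, which is why such t receive longer steps
  or a residue class. The shift -1/4 in \<open>Y\<close> is paid back by a factor of the amplitude;
  the Laplace integral thus depends on X only through \<open>Y\<close>.\<close>

definition falling_product :: "complex \<Rightarrow> nat \<Rightarrow> complex" where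
  "falling_product a j = (\<Prod>i<j. a - of_nat i)"

lemma falling_product_0 [simp]: "falling_product a 0 = 1"
  by (simp add: falling_product_def)

lemma falling_product_Suc: "falling_product a (Suc j) = falling_product a j * (a - of_nat j)"
  by (simp add: falling_product_def)

lemma holomorphic_falling_product [holomorphic_intros]:
  "f holomorphic_on S \<Longrightarrow> (\<lambda>s. falling_product (f s) j) holomorphic_on S"
  unfolding falling_product_def by (intro holomorphic_intros)

lemma norm_falling_product_le:
  assumes "norm a \<le> r" shows "norm (falling_product a j) \<le> (r + j) ^ j"
proof -
  have "norm (falling_product a j) \<le> (\<Prod>i<j. r + j)"
    unfolding falling_product_def prod_norm[symmetric]
  proof (rule prod_mono, safe)
    fix i assume "i < j"
    have "norm (a - of_nat i) \<le> norm a + real i" by (metis norm_of_nat norm_triangle_ineq4)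
    then show "norm (a - of_nat i) \<le> r + j" using assms \<open>i < j\<close> by simp
  qed auto
  then show ?thesis by simp
qed

text \<open>Taylor's formula on the segment from 0 to 1, where the j-th derivative of (1 + z)^a is
  \<open>falling_product a j\<close> times (1 + z)^(a - j). The constant depends on a only through
  r, which later makes the estimates locally uniform in s; the power of 2 bounds (1 + t)^(Re a - M -
  1) for t at most 1.\<close>

lemma binomial_Taylor_bound:
  assumes "norm a \<le> r" "0 \<le> x" "x \<le> 1"
  shows "norm ((1 + complex_of_real x) powr a
            - (\<Sum>j\<le>M. falling_product a j / fact j * of_real x ^ j))
         \<le> (r + Suc M) ^ Suc M * 2 powr (r + Suc M) * x ^ Suc M"
proof -
  define f where "f = (\<lambda>j z. falling_product a j * (1 + z) powr (a - of_nat j))"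
  let ?S = "closed_segment 0 (1::complex)"
  have S: "\<exists>t. 0 \<le> t \<and> t \<le> 1 \<and> z = complex_of_real t" if "z \<in> ?S" for z
    using that by (auto simp: closed_segment_def scaleR_conv_of_real)
  have r: "0 \<le> r" using assms(1) norm_ge_zero order_trans by blast
  have "norm (f 0 (of_real x) - (\<Sum>j\<le>M. f j 0 * (of_real x - 0) ^ j / fact j))
     \<le> ((r + Suc M) ^ Suc M * 2 powr (r + Suc M)) * norm (of_real x - 0 :: complex) ^ Suc M / fact M"
  proof (rule complex_Taylor[where S = ?S])
    show "(f i has_field_derivative f (Suc i) z) (at z within ?S)" if "z \<in> ?S" "i \<le> M" for i z
    proof -
      from S[OF that(1)] obtain t where t: "0 \<le> t" "t \<le> 1" "z = complex_of_real t" by blast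
      have nz: "1 + z \<notin> \<real>\<^sub>\<le>\<^sub>0" using t
        by (auto simp: complex_nonpos_Reals_iff)
      have "(f i has_field_derivative falling_product a i * ((a - of_nat i) * (1 + z) powr (a - of_nat i - 1))) (at z within ?S)"
        unfolding f_def by (rule derivative_eq_intros refl nz | simp)+
      then show ?thesis by (simp add: f_def falling_product_Suc mult.assoc diff_diff_eq add.commute)
    qed
    show "norm (f (Suc M) z) \<le> (r + Suc M) ^ Suc M * 2 powr (r + Suc M)" if "z \<in> ?S" for z
    proof -
      from S[OF that(1)] obtain t where t: "0 \<le> t" "t \<le> 1" "z = complex_of_real t" by blast
      have "norm ((1 + z) powr (a - of_nat (Suc M))) = norm (complex_of_real (1 + t) powr (a - of_nat (Suc M)))"
        using t by simp
      also have "\<dots> = (1 + t) powr (Re a - Suc M)"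
        using t by (subst norm_powr_real_powr) auto
      also have "\<dots> \<le> (1 + t) powr (r + Suc M)"
        using assms(1) complex_Re_le_cmod[of a] t by (intro powr_mono) auto
      also have "\<dots> \<le> 2 powr (r + Suc M)" using t r by (intro powr_mono2) auto
      finally show ?thesis unfolding f_def norm_mult
        using assms(1) r by (intro mult_mono norm_falling_product_le) auto
    qed
  next
    show "convex ?S" by (rule convex_closed_segment)
  qed (use assms in \<open>auto simp: closed_segment_def scaleR_conv_of_real intro!: exI[of _ x]\<close>)
  also have "\<dots> \<le> ((r + Suc M) ^ Suc M * 2 powr (r + Suc M)) * x ^ Suc M / 1"
    using assms r by (intro frac_le mult_nonneg_nonneg) (auto simp: fact_ge_1)
  finally show ?thesis by (simp add: f_def algebra_simps)
qed

text \<open>With N = n + 1, this is what is left of N^(1-s) - (N+1)^(1-s) after the first M terms of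
  its expansion in powers of 1/N are removed. It is -N^(1-s) times a binomial Taylor remainder,
  hence O(N^(-Re s - M)).\<close>

definition zeta_remainder :: "nat \<Rightarrow> nat \<Rightarrow> complex \<Rightarrow> complex" where
  "zeta_remainder M n s = of_nat (Suc n) powr (1 - s) - of_nat (Suc (Suc n)) powr (1 - s)
     + (\<Sum>j=1..M. falling_product (1 - s) j / fact j * of_nat (Suc n) powr (1 - s - of_nat j))"

lemma norm_zeta_remainder_le:
  assumes "norm (1 - s) \<le> r"
  shows "norm (zeta_remainder M n s)
           \<le> (r + Suc M) ^ Suc M * 2 powr (r + Suc M) * real (Suc n) powr (- Re s - M)"
proof -
  define N where "N = real (Suc n)"
  have N: "N > 0" "N \<ge> 1" by (auto simp: N_def)
  let ?x = "1 / N"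
  have e1: "complex_of_nat (Suc n) = complex_of_real N" unfolding N_def by simp
  have "complex_of_nat (Suc (Suc n)) = complex_of_real (N * (1 + ?x))"
  proof -
    have "N * (1 + ?x) = real (Suc (Suc n))" using N by (simp add: N_def distrib_left)
    then show ?thesis by simp
  qed
  then have e2: "complex_of_nat (Suc (Suc n)) powr (1 - s) = of_real N powr (1 - s) * (1 + of_real ?x) powr (1 - s)"
    using N by (simp only:) (subst of_real_mult, subst powr_times_real, auto simp: add_nonneg_nonneg)
  have e3: "complex_of_real N powr (1 - s - of_nat j) = of_real N powr (1 - s) * of_real ?x ^ j" for j
    using N by (simp add: powr_diff powr_nat power_divide)
  have "zeta_remainder M n s = - (of_real N powr (1 - s)) * ((1 + of_real ?x) powr (1 - s)
            - (\<Sum>j\<le>M. falling_product (1 - s) j / fact j * of_real ?x ^ j))"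
  proof -
    have "(\<Sum>j\<le>M. falling_product (1 - s) j / fact j * complex_of_real ?x ^ j)
        = 1 + (\<Sum>j=1..M. falling_product (1 - s) j / fact j * complex_of_real ?x ^ j)"
      unfolding atMost_atLeast0 by (subst sum.atLeast_Suc_atMost) auto
    then show ?thesis
      unfolding zeta_remainder_def e2 e1 e3 by (simp add: algebra_simps sum_distrib_left sum_negf)
  qed
  also have "norm \<dots> \<le> N powr (1 - Re s) * ((r + Suc M) ^ Suc M * 2 powr (r + Suc M) * ?x ^ Suc M)"
    unfolding norm_mult norm_minus_cancel
    using N by (intro mult_mono binomial_Taylor_bound[OF assms]) (auto simp: norm_powr_real_powr)
  also have "\<dots> = (r + Suc M) ^ Suc M * 2 powr (r + Suc M) * (N powr (1 - Re s) * ?x ^ Suc M)"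
    by (simp add: algebra_simps)
  also have "N powr (1 - Re s) * ?x ^ Suc M = N powr (- Re s - M)"
  proof -
    have "?x ^ Suc M = N powr (- real (Suc M))"
      using N by (subst powr_minus, subst powr_realpow) (auto simp: power_one_over inverse_eq_divide)
    then show ?thesis by (simp add: powr_add[symmetric])
  qed
  finally show ?thesis by (simp add: N_def)
qed

lemma holomorphic_zeta_remainder: "zeta_remainder M n holomorphic_on S"
  unfolding zeta_remainder_def by (intro holomorphic_intros) auto

text \<open>Locally uniform comparison with the series of n^(-a-c): a small disc around a point of
  the half-plane has real parts above some a > 1 - c. The case c = 0 is the Dirichlet series, the
  case c = M the series of \<open>zeta_remainder M\<close>.\<close>

lemma holomorphic_suminf_powr_bound:
  fixes f :: "nat \<Rightarrow> complex \<Rightarrow> complex"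
  assumes hol: "\<And>n. f n holomorphic_on UNIV"
      and bound: "\<And>r. \<exists>C. \<forall>n s. norm s \<le> r \<longrightarrow> norm (f n s) \<le> C * real (Suc n) powr (- Re s - c)"
  shows "(\<lambda>s. \<Sum>n. f n s) holomorphic_on {s. Re s > 1 - c}"
    and "\<And>s. Re s > 1 - c \<Longrightarrow> summable (\<lambda>n. norm (f n s))"
proof -
  let ?S = "{s. Re s > 1 - c}"
  have S: "open ?S" by (rule open_halfspace_Re_gt)
  have sm: "summable (\<lambda>n. real (Suc n) powr (- a - c))" if "a > 1 - c" for a
  proof -
    have "summable (\<lambda>n. real n powr (- a - c))" using that by (subst summable_real_powr_iff) auto
    then show ?thesis by (subst summable_Suc_iff)
  qed
  obtain g where g: "\<forall>x\<in>?S. ((\<lambda>n. f n x) sums g x) \<and> g field_differentiable (at x)"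
  proof (rule series_differentiable_comparison_complex[OF S])
    show "f n field_differentiable at x" for n x
      using hol[of n] by (auto simp: holomorphic_on_def)
    show "\<exists>d h. 0 < d \<and> summable h \<and> range h \<subseteq> \<real>\<^sub>\<ge>\<^sub>0 \<and>
       (\<forall>\<^sub>F n in sequentially. \<forall>y\<in>ball x d \<inter> ?S. cmod (f n y) \<le> cmod (h n))" if "x \<in> ?S" for x
    proof -
      define d where "d = (Re x - (1 - c)) / 2"
      have d: "d > 0" using that by (simp add: d_def)
      define a where "a = Re x - d"
      have a: "a > 1 - c" using that by (simp add: a_def d_def field_simps)
      from bound[of "norm x + d"] obtain C where
        C: "\<And>n s. norm s \<le> norm x + d \<Longrightarrow> norm (f n s) \<le> C * real (Suc n) powr (- Re s - c)" by auto
      define h where "h = (\<lambda>n. complex_of_real (\<bar>C\<bar> * real (Suc n) powr (- a - c)))"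
      have "summable h" unfolding h_def
        by (rule summable_of_real[OF summable_mult[OF sm[OF a]]])
      moreover have "range h \<subseteq> \<real>\<^sub>\<ge>\<^sub>0" unfolding h_def by (auto simp: complex_nonneg_Reals_iff)
      moreover have "cmod (f n y) \<le> cmod (h n)" if y: "y \<in> ball x d \<inter> ?S" for n y
      proof -
        have dd: "norm (x - y) < d" using y by (auto simp: dist_norm)
        have "norm y \<le> norm x + d" using dd norm_triangle_ineq2[of y x] by (simp add: norm_minus_commute)
        then have "norm (f n y) \<le> C * real (Suc n) powr (- Re y - c)" by (rule C)
        also have "\<dots> \<le> \<bar>C\<bar> * real (Suc n) powr (- Re y - c)" by (intro mult_right_mono) auto
        also have "\<dots> \<le> \<bar>C\<bar> * real (Suc n) powr (- a - c)"
          using abs_Re_le_cmod[of "x - y"] dd by (intro mult_left_mono powr_mono) (auto simp: a_def)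
        finally show ?thesis by (simp add: h_def norm_mult)
      qed
      ultimately show ?thesis using d by (intro exI[of _ d] exI[of _ h]) auto
    qed
  qed blast
  have "g holomorphic_on ?S"
    using g by (auto simp: holomorphic_on_def intro: field_differentiable_at_within)
  moreover have "(\<Sum>n. f n s) = g s" if "s \<in> ?S" for s using g that sums_unique by metis
  ultimately show "(\<lambda>s. \<Sum>n. f n s) holomorphic_on ?S" by (metis (no_types, lifting) holomorphic_transform)
  show "summable (\<lambda>n. norm (f n s))" if "Re s > 1 - c" for s
  proof -
    from bound[of "norm s"] obtain C where
      C: "\<And>n. norm (f n s) \<le> C * real (Suc n) powr (- Re s - c)" by auto
    show ?thesis
      by (rule summable_comparison_test'[OF summable_mult[OF sm[OF that]], of 0 _ C]) (use C in auto)
  qed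
qed

definition dirichlet_zeta :: "complex \<Rightarrow> complex" where
  "dirichlet_zeta s = (\<Sum>n. 1 / of_nat (Suc n) powr s)"

lemma holomorphic_dirichlet_zeta: "dirichlet_zeta holomorphic_on {s. Re s > 1}"
  and summable_dirichlet_zeta: "Re s > 1 \<Longrightarrow> summable (\<lambda>n. norm (1 / of_nat (Suc n) powr s :: complex))"
proof -
  have hol: "(\<lambda>s. 1 / of_nat (Suc n) powr s :: complex) holomorphic_on UNIV" for n
    by (intro holomorphic_intros) auto
  have b: "\<exists>C. \<forall>n s. norm s \<le> r \<longrightarrow> norm (1 / of_nat (Suc n) powr s :: complex)
             \<le> C * real (Suc n) powr (- Re s - 0)" for r
  proof (rule exI[of _ 1], intro allI impI)
    fix n s
    have "norm (complex_of_nat (Suc n) powr s) = real (Suc n) powr Re s"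
      by (metis norm_powr_real_powr of_nat_0_le_iff of_real_of_nat_eq Re_complex_of_real Reals_of_nat)
    then show "norm (1 / of_nat (Suc n) powr s :: complex) \<le> 1 * real (Suc n) powr (- Re s - 0)"
      by (simp add: norm_divide powr_minus inverse_eq_divide)
  qed
  show "dirichlet_zeta holomorphic_on {s. Re s > 1}"
    using holomorphic_suminf_powr_bound(1)[OF hol b] by (simp add: dirichlet_zeta_def[abs_def])
  show "Re s > 1 \<Longrightarrow> summable (\<lambda>n. norm (1 / of_nat (Suc n) powr s :: complex))"
    using holomorphic_suminf_powr_bound(2)[OF hol b] by simp
qed

lemma suminf_zeta_remainder:
  shows "(\<lambda>s. \<Sum>n. zeta_remainder M n s) holomorphic_on {s. Re s > 1 - real M}"
    and "\<And>s. Re s > 1 - real M \<Longrightarrow> summable (\<lambda>n. norm (zeta_remainder M n s))"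
proof -
  have b: "\<exists>C. \<forall>n s. norm s \<le> r \<longrightarrow> norm (zeta_remainder M n s) \<le> C * real (Suc n) powr (- Re s - M)" for r
  proof (intro exI allI impI)
    fix n s assume "norm (s :: complex) \<le> r"
    then have "norm (1 - s) \<le> 1 + r" using norm_triangle_ineq4[of 1 s] by simp
    from norm_zeta_remainder_le[OF this]
    show "norm (zeta_remainder M n s) \<le> ((1 + r + Suc M) ^ Suc M * 2 powr (1 + r + Suc M)) * real (Suc n) powr (- Re s - M)" .
  qed
  show "(\<lambda>s. \<Sum>n. zeta_remainder M n s) holomorphic_on {s. Re s > 1 - real M}"
    and "\<And>s. Re s > 1 - real M \<Longrightarrow> summable (\<lambda>n. norm (zeta_remainder M n s))"
    using holomorphic_suminf_powr_bound[OF holomorphic_zeta_remainder b] by auto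
qed

text \<open>Telescoping $\sum_n (n^{1-s} - (n+1)^{1-s}) = 1$ and expanding each term in powers of
  $1/n$ expresses $(s-1)\zeta(s)$ through its values to the right.\<close>

lemma zeta_recurrence:
  assumes s: "Re s > 1"
  shows "(s - 1) * dirichlet_zeta s = 1 - (\<Sum>n. zeta_remainder (Suc M) n s)
     - (\<Sum>j=2..Suc M. falling_product (1 - s) (j - 1) / fact j
           * ((s + of_nat (j - 1) - 1) * dirichlet_zeta (s + of_nat (j - 1))))"
proof -
  let ?c = "\<lambda>j. falling_product (1 - s) j / fact j"
  let ?a = "\<lambda>n. of_nat (Suc n) powr (1 - s) :: complex"
  have "(\<lambda>n. ?a n - ?a (Suc n)) sums (?a 0 - 0)"
  proof (rule telescope_sums')
    have "(\<lambda>n. real (Suc n) powr (1 - Re s)) \<longlonglongrightarrow> 0"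
      using s tendsto_neg_powr[OF _ filterlim_compose[OF filterlim_real_sequentially filterlim_Suc], of "1 - Re s"] by simp
    moreover have "norm (?a n) = real (Suc n) powr (1 - Re s)" for n
      using norm_powr_real_powr[of "of_nat (Suc n)" "1 - s"] by simp
    ultimately show "?a \<longlonglongrightarrow> 0" by (subst tendsto_norm_zero_iff[symmetric]) simp
  qed
  then have t: "(\<lambda>n. ?a n - ?a (Suc n)) sums 1" by simp
  have z: "(\<lambda>n. of_nat (Suc n) powr (1 - s - of_nat j)) sums dirichlet_zeta (s + of_nat (j - 1))" if "j \<ge> 1" for j
  proof -
    have "Re (s + of_nat (j - 1)) > 1" using s by simp
    from summable_sums[OF summable_norm_cancel[OF summable_dirichlet_zeta[OF this]]]
    have "(\<lambda>n. 1 / of_nat (Suc n) powr (s + of_nat (j - 1))) sums dirichlet_zeta (s + of_nat (j - 1))"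
      by (simp add: dirichlet_zeta_def)
    moreover have "1 / of_nat (Suc n) powr (s + of_nat (j - 1)) = of_nat (Suc n) powr (1 - s - of_nat j)" for n
    proof -
      have "1 - s - of_nat j = - (s + of_nat (j - 1))" using that by (simp add: of_nat_diff)
      then show ?thesis by (simp only: powr_minus inverse_eq_divide)
    qed
    ultimately show ?thesis by simp
  qed
  have "(\<lambda>n. (?a n - ?a (Suc n)) + (\<Sum>j=1..Suc M. ?c j * of_nat (Suc n) powr (1 - s - of_nat j)))
     sums (1 + (\<Sum>j=1..Suc M. ?c j * dirichlet_zeta (s + of_nat (j - 1))))"
    by (intro sums_add t sums_sum sums_mult z) auto
  then have "(\<Sum>n. zeta_remainder (Suc M) n s) = 1 + (\<Sum>j=1..Suc M. ?c j * dirichlet_zeta (s + of_nat (j - 1)))"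
    by (simp add: zeta_remainder_def[abs_def] sums_iff)
  also have "\<dots> = 1 + (?c 1 * dirichlet_zeta s + (\<Sum>j=2..Suc M. ?c j * dirichlet_zeta (s + of_nat (j - 1))))"
    by (subst sum.atLeast_Suc_atMost) (auto simp: numeral_2_eq_2)
  also have "(\<Sum>j=2..Suc M. ?c j * dirichlet_zeta (s + of_nat (j - 1)))
     = - (\<Sum>j=2..Suc M. falling_product (1 - s) (j - 1) / fact j
           * ((s + of_nat (j - 1) - 1) * dirichlet_zeta (s + of_nat (j - 1))))"
    unfolding sum_negf[symmetric]
  proof (rule sum.cong[OF refl])
    fix j assume "j \<in> {2..Suc M}"
    then have "j = Suc (j - 1)" by auto
    then have "falling_product (1 - s) j = falling_product (1 - s) (j - 1) * (1 - s - of_nat (j - 1))"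
      by (metis falling_product_Suc)
    then show "?c j * dirichlet_zeta (s + of_nat (j - 1)) = - (falling_product (1 - s) (j - 1) / fact j
           * ((s + of_nat (j - 1) - 1) * dirichlet_zeta (s + of_nat (j - 1))))"
      by (simp only:) (simp add: algebra_simps add_divide_distrib diff_divide_distrib)
  qed
  finally show ?thesis
    by (simp add: falling_product_Suc algebra_simps del: sum.cl_ivl_Suc)
qed

text \<open>Each application of the recurrence gains one unit: its right side uses g only at s + (j
  - 1) with j at least 2, so one unit or more to the right. Continuing (s - 1) zeta(s) instead of
  zeta(s) avoids a puncture at 1 in the half-planes.\<close>

lemma zeta_continuation_halfplane:
  "\<exists>g. g holomorphic_on {s. Re s > 1 - real M} \<and> (\<forall>s. Re s > 1 \<longrightarrow> g s = (s - 1) * dirichlet_zeta s)"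
proof (induction M)
  case 0
  show ?case
    by (rule exI[of _ "\<lambda>s. (s - 1) * dirichlet_zeta s"]) (auto intro!: holomorphic_intros holomorphic_dirichlet_zeta)
next
  case (Suc M)
  then obtain g where g: "g holomorphic_on {s. Re s > 1 - real M}"
    and eq: "\<And>s. Re s > 1 \<Longrightarrow> g s = (s - 1) * dirichlet_zeta s" by blast
  define h where "h = (\<lambda>s. 1 - (\<Sum>n. zeta_remainder (Suc M) n s)
     - (\<Sum>j=2..Suc M. falling_product (1 - s) (j - 1) / fact j * g (s + of_nat (j - 1))))"
  have "(\<lambda>s. g (s + of_nat (j - 1))) holomorphic_on {s. Re s > 1 - real (Suc M)}" if "j \<in> {2..Suc M}" for j
    using holomorphic_on_compose_gen[of "\<lambda>s. s + of_nat (j - 1)" "{s. Re s > 1 - real (Suc M)}" g, OF _ g] that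
    by (fastforce simp: o_def intro!: holomorphic_intros)
  then have "h holomorphic_on {s. Re s > 1 - real (Suc M)}"
    unfolding h_def by (intro holomorphic_intros suminf_zeta_remainder) auto
  moreover have "h s = (s - 1) * dirichlet_zeta s" if "Re s > 1" for s
    unfolding zeta_recurrence[OF that, of M] h_def using that by (simp add: eq)
  ultimately show ?case by blast
qed

text \<open>The continuations to the nested half-planes agree by the identity theorem, since all
  have the same values for Re s > 1. They glue to an entire function, and dividing it by s - 1
  produces the only singularity.\<close>

lemma zeta_continuation_exists:
  "\<exists>f. f holomorphic_on (- {1}) \<and> (\<forall>s. Re s > 1 \<longrightarrow> f s = (\<Sum>n. 1 / of_nat (Suc n) powr s))"
proof -
  from zeta_continuation_halfplane obtain g where
    g: "\<And>M. g M holomorphic_on {s. Re s > 1 - real M}"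
    and geq: "\<And>M s. Re s > 1 \<Longrightarrow> g M s = (s - 1) * dirichlet_zeta s" by metis
  have agree: "g M s = g N s" if "M \<le> N" "Re s > 1 - real M" for M N s
  proof (rule analytic_continuation_open[of "{s. Re s > 1}" "{s. Re s > 1 - real M}" "g M" "g N"])
    show "{s. Re s > 1} \<noteq> {}" by (auto intro!: exI[of _ 2])
    show "connected {s. 1 - real M < Re s}"
      by (intro convex_connected convex_halfspace_Re_gt)
    show "g N holomorphic_on {s. Re s > 1 - real M}"
      by (rule holomorphic_on_subset[OF g]) (use that in auto)
  qed (use that g geq open_halfspace_Re_gt in auto)
  \<comment> \<open>The index is chosen so that s itself lies in the half-plane of that
    index.\<close>
  define G where "G = (\<lambda>s. g (nat \<lceil>2 - Re s\<rceil>) s)"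
  have G: "G s = g M s" if "Re s > 1 - real M" for M s
  proof -
    have "Re s > 1 - real (nat \<lceil>2 - Re s\<rceil>)" by linarith
    then show ?thesis using that agree unfolding G_def by (metis nat_le_linear)
  qed
  have "G holomorphic_on UNIV"
  proof -
    have "G field_differentiable at s" for s
    proof -
      define M where "M = nat \<lceil>2 - Re s\<rceil>"
      have M: "Re s > 1 - real M" unfolding M_def by linarith
      have "G holomorphic_on {s. Re s > 1 - real M}"
        using g[of M] by (rule holomorphic_transform) (simp add: G)
      then show ?thesis using M holomorphic_on_imp_differentiable_at open_halfspace_Re_gt by blast
    qed
    then show ?thesis by (auto simp: holomorphic_on_def)
  qed
  then have "(\<lambda>s. G s / (s - 1)) holomorphic_on (- {1})"
    by (intro holomorphic_intros) (auto intro: holomorphic_on_subset)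
  moreover have "G s / (s - 1) = dirichlet_zeta s" if "Re s > 1" for s
    using that G[of 0 s] geq[of s 0] by auto
  ultimately show ?thesis unfolding dirichlet_zeta_def by blast
qed

text \<open>Existence of a continuation is what turns the choice in \<open>zeta\<close> into a
  usable property, and above 1 that property is the series. Real exponents make each term real, so
  taking the real part commutes with the sum.\<close>

lemma zeta_real_eq_suminf:
  assumes "x > 1"
  shows "summable (\<lambda>n. real (Suc n) powr (- x))"
    and "zeta_real x = (\<Sum>n. real (Suc n) powr (- x))"
proof -
  have "summable (\<lambda>n. real n powr (- x))" using assms by (subst summable_real_powr_iff) auto
  then show sm: "summable (\<lambda>n. real (Suc n) powr (- x))" by (subst summable_Suc_iff)
  have "zeta holomorphic_on (- {1}) \<and> (\<forall>s. Re s > 1 \<longrightarrow> zeta s = (\<Sum>n. 1 / of_nat (Suc n) powr s))"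
    unfolding zeta_def by (rule someI_ex[OF zeta_continuation_exists])
  then have "zeta (of_real x) = (\<Sum>n. 1 / of_nat (Suc n) powr complex_of_real x)"
    using assms by simp
  also have "(\<lambda>n. 1 / of_nat (Suc n) powr complex_of_real x) = (\<lambda>n. of_real (real (Suc n) powr (- x)))"
  proof
    fix n
    have "complex_of_real (real (Suc n) powr (- x)) = of_real (real (Suc n)) powr of_real (- x)"
      by (subst powr_of_real) auto
    then show "1 / of_nat (Suc n) powr complex_of_real x = of_real (real (Suc n) powr (- x))"
      by (simp add: powr_minus inverse_eq_divide)
  qed
  also have "(\<Sum>n. complex_of_real (real (Suc n) powr (- x))) = of_real (\<Sum>n. real (Suc n) powr (- x))"
    by (rule suminf_of_real[OF sm, symmetric])
  finally show "zeta_real x = (\<Sum>n. real (Suc n) powr (- x))" by (simp add: zeta_real_def)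
qed

section \<open>The generating function\<close>

text \<open>Admitting only the bases 1 to M makes the generating function a finite product, which
  can be built by recursion on M; for n at most M no partition is lost.\<close>

definition bounded_power_partitions :: "nat \<Rightarrow> nat \<Rightarrow> nat \<Rightarrow> nat list set" where
  "bounded_power_partitions k M n =
     {xs. sorted_wrt (\<ge>) xs \<and> sum_list xs = n \<and> (\<forall>x\<in>set xs. \<exists>m\<in>{1..M}. x = m ^ k)}"

lemma finite_bounded_power_partitions: "finite (bounded_power_partitions k M n)"
proof (rule finite_subset)
  show "bounded_power_partitions k M n \<subseteq> {xs. set xs \<subseteq> {..n} \<and> length xs \<le> n}"
  proof
    fix xs assume xs: "xs \<in> bounded_power_partitions k M n"
    then have pos: "\<forall>x\<in>set xs. 1 \<le> x" by (auto simp: bounded_power_partitions_def)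
    have "length xs \<le> sum_list xs" using pos by (induction xs) auto
    moreover have "x \<le> sum_list xs" if "x \<in> set xs" for x using that member_le_sum_list by blast
    ultimately show "xs \<in> {xs. set xs \<subseteq> {..n} \<and> length xs \<le> n}"
      using xs by (auto simp: bounded_power_partitions_def)
  qed
  show "finite {xs. set xs \<subseteq> {..n} \<and> length xs \<le> n}" by (rule finite_lists_length_le) simp
qed

lemma bounded_power_partitions_0:
  "card (bounded_power_partitions k 0 n) = (if n = 0 then 1 else 0)"
proof -
  have "bounded_power_partitions k 0 n = (if n = 0 then {[]} else {})"
    by (auto simp: bounded_power_partitions_def)
  then show ?thesis by simp
qed

text \<open>The largest admissible part q = (M + 1)^k either does not occur or, the list being
  non-increasing, stands at its head and can be removed. The rest may contain q again, hence
  \<open>Suc M\<close> in the last term.\<close>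

lemma card_bounded_power_partitions_Suc:
  assumes "k > 0"
  shows "card (bounded_power_partitions k (Suc M) n) = card (bounded_power_partitions k M n)
     + (if Suc M ^ k \<le> n then card (bounded_power_partitions k (Suc M) (n - Suc M ^ k)) else 0)"
proof -
  let ?B = "bounded_power_partitions k" and ?q = "Suc M ^ k"
  let ?C = "if ?q \<le> n then (#) ?q ` ?B (Suc M) (n - ?q) else {}"
  have lt: "m ^ k < ?q" if "m \<le> M" for m using that assms by (intro power_strict_mono) auto
  have "?B (Suc M) n = ?B M n \<union> ?C"
  proof (intro equalityI subsetI)
    fix xs assume xs: "xs \<in> ?B (Suc M) n"
    show "xs \<in> ?B M n \<union> ?C"
    proof (cases "?q \<in> set xs")
      case True
      then obtain y ys where ys: "xs = y # ys" by (cases xs) auto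
      have "y = ?q"
      proof -
        obtain m where "m \<le> Suc M" "y = m ^ k" using xs by (auto simp: bounded_power_partitions_def ys)
        then have "y \<le> ?q" by (auto intro: power_mono)
        moreover have "y \<ge> ?q" using True xs by (auto simp: bounded_power_partitions_def ys)
        ultimately show ?thesis by simp
      qed
      then show ?thesis using xs by (auto simp: bounded_power_partitions_def ys)
    next
      case False
      have "\<exists>m\<in>{1..M}. x = m ^ k" if "x \<in> set xs" for x
      proof -
        from xs that have "\<exists>m\<in>{1..Suc M}. x = m ^ k"
          by (simp add: bounded_power_partitions_def)
        then obtain m where "1 \<le> m" "m \<le> Suc M" "x = m ^ k" by auto
        moreover have "m \<noteq> Suc M" using False that \<open>x = m ^ k\<close> by auto
        ultimately show ?thesis by auto
      qed
      then show ?thesis using xs by (auto simp: bounded_power_partitions_def)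
    qed
  next
    fix xs assume "xs \<in> ?B M n \<union> ?C"
    then show "xs \<in> ?B (Suc M) n"
    proof
      assume "xs \<in> ?B M n"
      then show ?thesis by (auto simp: bounded_power_partitions_def) (metis atLeastAtMost_iff le_SucI)
    next
      assume "xs \<in> ?C"
      then obtain ys where ys: "xs = ?q # ys" "ys \<in> ?B (Suc M) (n - ?q)" "?q \<le> n"
        by (auto split: if_splits)
      have "\<exists>m\<in>{1..Suc M}. ?q = m ^ k" by (rule bexI[of _ "Suc M"]) auto
      moreover have "y \<le> ?q" if y: "y \<in> set ys" for y
      proof -
        have "\<exists>m\<in>{1..Suc M}. y = m ^ k" using ys(2) y by (simp add: bounded_power_partitions_def)
        then obtain m where "m \<le> Suc M" "y = m ^ k" by auto
        then show ?thesis by (auto intro: power_mono)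
      qed
      ultimately show ?thesis using ys(2,3) unfolding ys(1) bounded_power_partitions_def by auto
    qed
  qed
  moreover have "?B M n \<inter> ?C = {}"
  proof -
    have "?q \<notin> set xs" if "xs \<in> ?B M n" for xs
    proof
      assume "?q \<in> set xs"
      then have "\<exists>m\<in>{1..M}. ?q = m ^ k" using that by (simp add: bounded_power_partitions_def del: power_Suc)
      then obtain m where "m \<le> M" "?q = m ^ k" by auto
      then show False using lt[of m] by simp
    qed
    then show ?thesis by (auto split: if_splits) (metis list.set_intros(1))
  qed
  moreover have "finite ?C" by (simp add: finite_bounded_power_partitions)
  ultimately have "card (?B (Suc M) n) = card (?B M n) + card ?C"
    by (simp add: card_Un_disjoint finite_bounded_power_partitions del: power_Suc)
  also have "card ?C = (if ?q \<le> n then card (?B (Suc M) (n - ?q)) else 0)"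
    by (simp add: card_image)
  finally show ?thesis .
qed

lemma sums_shift_right:
  fixes f :: "nat \<Rightarrow> complex"
  assumes "f sums s"
  shows "(\<lambda>n. if q \<le> n then f (n - q) else 0) sums s"
proof -
  have "(\<lambda>n. if q \<le> n + q then f (n + q - q) else 0) sums s" using assms by simp
  then have "(\<lambda>n. if q \<le> n then f (n - q) else 0) sums (s + (\<Sum>i<q. if q \<le> i then f (i - q) else 0))"
    by (subst (asm) sums_iff_shift)
  then show ?thesis by simp
qed

text \<open>Read as power series, the recurrence says S = P + z^q S, where P is the product for M,
  so S = P / (1 - z^q). Solving for S presupposes convergence, so absolute convergence is carried
  through the same induction.\<close>

lemma bounded_power_partitions_gf:
  fixes z :: complex
  assumes k: "k > 0"
  shows "norm z < 1 \<Longrightarrow> summable (\<lambda>n. real (card (bounded_power_partitions k M n)) * norm z ^ n) \<and>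
     (\<lambda>n. of_nat (card (bounded_power_partitions k M n)) * z ^ n) sums (\<Prod>m=1..M. 1 / (1 - z ^ (m ^ k)))"
proof (induction M arbitrary: z)
  case 0
  have "(\<lambda>n. if n = 0 then 1 else 0 :: complex) sums 1" using sums_single[of 0 "\<lambda>_. 1 :: complex"] by simp
  moreover have "summable (\<lambda>n. if n = 0 then 1 else 0 :: real)"
    using sums_summable[OF sums_single[of 0 "\<lambda>_. 1 :: real"]] by simp
  moreover have "(\<lambda>n. of_nat (card (bounded_power_partitions k 0 n)) * z ^ n) = (\<lambda>n. if n = 0 then 1 else 0)"
    and "(\<lambda>n. real (card (bounded_power_partitions k 0 n)) * norm z ^ n) = (\<lambda>n. if n = 0 then 1 else 0)"
    by (auto simp: bounded_power_partitions_0)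
  ultimately show ?case by simp
next
  case (Suc M)
  define a where "a = (\<lambda>M n. card (bounded_power_partitions k M n))"
  define q where "q = Suc M ^ k"
  have q: "q > 0" by (simp add: q_def)
  have rec: "a (Suc M) n = a M n + (if q \<le> n then a (Suc M) (n - q) else 0)" for n
    unfolding a_def q_def by (rule card_bounded_power_partitions_Suc[OF k])
  define r where "r = norm z"
  have r: "0 \<le> r" "r < 1" using Suc.prems by (auto simp: r_def)
  have rq: "r ^ q < 1" using r q by (simp add: power_less_one_iff)
  have sM: "summable (\<lambda>n. real (a M n) * r ^ n)" using Suc.IH[OF Suc.prems] by (simp add: a_def r_def)
  \<comment> \<open>The recurrence bounds a partial sum T by A + r^q T, where A is the full sum for
    M; since r^q < 1, this bounds T.\<close>
  have "(\<Sum>n<N. real (a (Suc M) n) * r ^ n) \<le> (\<Sum>n. real (a M n) * r ^ n) / (1 - r ^ q)" for N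
  proof -
    have "(\<Sum>n<N. real (a (Suc M) n) * r ^ n)
       = (\<Sum>n<N. real (a M n) * r ^ n) + (\<Sum>n<N. if q \<le> n then real (a (Suc M) (n - q)) * r ^ n else 0)"
      by (subst rec) (auto simp: sum.distrib[symmetric] algebra_simps intro!: sum.cong)
    also have "(\<Sum>n<N. if q \<le> n then real (a (Suc M) (n - q)) * r ^ n else 0)
       = (\<Sum>n\<in>{q..<N}. real (a (Suc M) (n - q)) * r ^ n)"
      by (rule sum.mono_neutral_cong_right) auto
    also have "\<dots> = (\<Sum>n\<in>{0..<N - q}. real (a (Suc M) n) * r ^ (n + q))"
      by (rule sum.reindex_bij_witness[of _ "\<lambda>n. n + q" "\<lambda>n. n - q"]) auto
    also have "\<dots> = r ^ q * (\<Sum>n\<in>{0..<N - q}. real (a (Suc M) n) * r ^ n)"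
      by (simp add: sum_distrib_left power_add algebra_simps)
    also have "\<dots> \<le> r ^ q * (\<Sum>n<N. real (a (Suc M) n) * r ^ n)"
      using r by (intro mult_left_mono sum_mono2) auto
    also have "(\<Sum>n<N. real (a M n) * r ^ n) \<le> (\<Sum>n. real (a M n) * r ^ n)"
      using r by (intro sum_le_suminf sM) auto
    finally show ?thesis using rq by (simp add: field_simps)
  qed
  then have sS: "summable (\<lambda>n. real (a (Suc M) n) * r ^ n)"
    using r by (intro bounded_imp_summable[of _ "(\<Sum>n. real (a M n) * r ^ n) / (1 - r ^ q)"])
      (auto simp: lessThan_Suc_atMost[symmetric] simp del: sum.lessThan_Suc)
  have sc: "summable (\<lambda>n. of_nat (a (Suc M) n) * z ^ n)"
    by (rule summable_norm_cancel) (use sS in \<open>simp add: norm_mult norm_power r_def\<close>)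
  define S where "S = (\<Sum>n. of_nat (a (Suc M) n) * z ^ n)"
  have S: "(\<lambda>n. of_nat (a (Suc M) n) * z ^ n) sums S" using sc by (simp add: S_def summable_sums)
  have "(\<lambda>n. of_nat (a M n) * z ^ n + z ^ q * (if q \<le> n then of_nat (a (Suc M) (n - q)) * z ^ (n - q) else 0))
     sums ((\<Prod>m=1..M. 1 / (1 - z ^ (m ^ k))) + z ^ q * S)"
    using Suc.IH[OF Suc.prems] by (intro sums_add sums_mult sums_shift_right S) (auto simp: a_def)
  also have "(\<lambda>n. of_nat (a M n) * z ^ n + z ^ q * (if q \<le> n then of_nat (a (Suc M) (n - q)) * z ^ (n - q) else 0))
     = (\<lambda>n. of_nat (a (Suc M) n) * z ^ n)"
    by (rule ext, subst (2) rec) (auto simp: algebra_simps power_add[symmetric])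
  finally have "S = (\<Prod>m=1..M. 1 / (1 - z ^ (m ^ k))) + z ^ q * S" using S sums_unique2 by blast
  moreover have "z ^ q \<noteq> 1" using rq by (metis less_irrefl norm_one norm_power r_def)
  ultimately have "S = (\<Prod>m=1..Suc M. 1 / (1 - z ^ (m ^ k)))"
    by (simp add: q_def field_simps del: power_Suc)
  then show ?case using S sS by (simp add: a_def r_def del: prod.cl_ivl_Suc)
qed

lemma num_power_partitions_eq_bounded:
  assumes "k > 0" "n \<le> M"
  shows "num_power_partitions k n = card (bounded_power_partitions k M n)"
proof -
  have "power_partitions k n = bounded_power_partitions k M n"
  proof (intro equalityI subsetI)
    fix xs assume xs: "xs \<in> power_partitions k n"
    have "\<exists>m\<in>{1..M}. x = m ^ k" if "x \<in> set xs" for x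
    proof -
      from xs that obtain m where m: "x > 0" "x = m ^ k" by (auto simp: power_partitions_def is_nth_power_def)
      have "m \<le> m ^ k" using assms(1) by (cases "m = 0") (auto simp: self_le_power)
      also have "\<dots> \<le> sum_list xs" using member_le_sum_list[OF that] m by simp
      also have "\<dots> = n" using xs by (auto simp: power_partitions_def)
      finally have "m \<le> M" using assms by simp
      moreover have "m \<ge> 1" using m assms(1) by (cases "m = 0") auto
      ultimately show ?thesis using m by auto
    qed
    then show "xs \<in> bounded_power_partitions k M n"
      using xs by (auto simp: power_partitions_def bounded_power_partitions_def)
  next
    fix xs assume "xs \<in> bounded_power_partitions k M n"
    then show "xs \<in> power_partitions k n"
      by (auto simp: power_partitions_def bounded_power_partitions_def is_nth_power_def)
  qed
  then show ?thesis by (simp add: num_power_partitions_def)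
qed

lemma card_bounded_power_partitions_le:
  assumes "k > 0"
  shows "card (bounded_power_partitions k M n) \<le> num_power_partitions k n"
proof -
  have "bounded_power_partitions k M n \<subseteq> bounded_power_partitions k (max M n) n"
    by (auto simp: bounded_power_partitions_def) (metis atLeastAtMost_iff max.coboundedI1)
  then show ?thesis
    using num_power_partitions_eq_bounded[OF assms, of n "max M n"]
    by (simp add: card_mono finite_bounded_power_partitions)
qed

section \<open>The logarithm of the generating function as a sum over k-th powers\<close>

definition euler_log :: "complex \<Rightarrow> complex" where
  "euler_log z = - Ln (1 - exp (- z))"

lemma Ln_one_minus_sums:
  assumes "norm y < 1"
  shows "(\<lambda>j. y ^ Suc j / of_nat (Suc j)) sums (- Ln (1 - y))"
proof -
  have "(\<lambda>n. (-1)^Suc n / of_nat n * (-y)^n) sums Ln (1 + (- y))" by (rule Ln_series) (use assms in simp)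
  then have "(\<lambda>n. - ((-1)^Suc n / of_nat n * (-y)^n)) sums (- Ln (1 - y))" using sums_minus by fastforce
  moreover have eq: "- ((-1)^Suc n / of_nat n * (-y)^n) = y ^ n / of_nat n" for n
  proof -
    have "(-1) ^ n * (-y) ^ n = y ^ n" by (simp flip: power_mult_distrib)
    then show ?thesis by simp
  qed
  ultimately have "(\<lambda>n. y ^ n / of_nat n) sums (- Ln (1 - y))" by (simp only: eq)
  then show ?thesis by (subst sums_Suc_iff) simp
qed

lemma ln_one_minus_sums:
  assumes "0 \<le> x" "x < (1::real)"
  shows "(\<lambda>j. x ^ Suc j / real (Suc j)) sums (- ln (1 - x))"
proof -
  have "(\<lambda>j. complex_of_real (x ^ Suc j / real (Suc j))) sums (complex_of_real (- ln (1 - x)))"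
    using Ln_one_minus_sums[of "of_real x"] assms Ln_of_real[of "1 - x"] by simp
  then show ?thesis by (simp only: sums_of_real_iff)
qed

lemma exp_euler_log: "Re z > 0 \<Longrightarrow> exp (euler_log z) = 1 / (1 - exp (- z))"
proof -
  assume "Re z > 0"
  then have "norm (exp (- z)) < 1" by simp
  then have "exp (- z) \<noteq> 1" by (metis less_irrefl norm_one)
  then show ?thesis by (simp add: euler_log_def exp_minus exp_Ln inverse_eq_divide)
qed

text \<open>The series of -log(1 - y) has non-negative coefficients, so its modulus at y is at most
  its value at |y| = exp (- Re z).\<close>

lemma norm_euler_log_le:
  assumes "Re z > 0"
  shows "norm (euler_log z) \<le> - ln (1 - exp (- Re z))"
proof -
  have y: "norm (exp (- z)) = exp (- Re z)" by simp
  have lt: "exp (- Re z) < 1" using assms by simp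
  have s1: "(\<lambda>j. exp (- z) ^ Suc j / of_nat (Suc j)) sums euler_log z"
    unfolding euler_log_def using lt by (intro Ln_one_minus_sums) simp
  have s2: "(\<lambda>j. exp (- Re z) ^ Suc j / real (Suc j)) sums (- ln (1 - exp (- Re z)))"
    using lt by (intro ln_one_minus_sums) auto
  have "norm (\<Sum>j. exp (- z) ^ Suc j / of_nat (Suc j)) \<le> (\<Sum>j. exp (- Re z) ^ Suc j / real (Suc j))"
  proof (rule norm_suminf_le)
    show "norm (exp (- z) ^ Suc j / of_nat (Suc j)) \<le> exp (- Re z) ^ Suc j / real (Suc j)" for j
      by (simp only: norm_divide norm_power y norm_of_nat order_refl)
  qed (use s2 in \<open>simp add: sums_iff\<close>)
  then show ?thesis using s1 s2 by (simp add: sums_iff)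
qed

lemma minus_ln_one_minus_exp_le:
  assumes "x > (0::real)"
  shows "- ln (1 - exp (- x)) \<le> exp (- x) / (1 - exp (- x))"
proof -
  have p: "1 - exp (- x) > 0" using assms by simp
  have "ln (1 / (1 - exp (- x))) \<le> 1 / (1 - exp (- x)) - 1"
    using p by (intro ln_le_minus_one) simp
  also have "\<dots> = exp (- x) / (1 - exp (- x))" using p by (simp add: field_simps)
  finally show ?thesis using p by (simp add: ln_div)
qed

lemma Re_of_nat_power_times: "Re (of_nat m ^ k * w) = real m ^ k * Re w"
proof -
  have "of_nat m ^ k = complex_of_real (real m ^ k)" by simp
  then show ?thesis by simp
qed

lemma summable_euler_log_powers:
  assumes k: "k > 0" and w: "Re w > 0"
  shows "summable (\<lambda>m. norm (euler_log (of_nat (Suc m) ^ k * w)))"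
proof -
  define r where "r = exp (- Re w)"
  have r: "0 < r" "r < 1" using w by (auto simp: r_def)
  have "norm (euler_log (of_nat (Suc m) ^ k * w)) \<le> r * r ^ m / (1 - r)" for m
  proof -
    define t where "t = Re (of_nat (Suc m) ^ k * w)"
    have t: "t = real (Suc m) ^ k * Re w" unfolding t_def by (rule Re_of_nat_power_times)
    \<comment> \<open>Linear growth is enough: replacing (m + 1)^k by m + 1 gives a geometric
      majorant, and every exp (- t) is at most r, so the denominators stay above 1 - r.\<close>
    have "real (Suc m) \<le> real (Suc m) ^ k" using k by (intro self_le_power) auto
    then have t1: "real (Suc m) * Re w \<le> t" using w by (simp add: t)
    have t2: "Re w \<le> real (Suc m) * Re w" using w by (simp add: distrib_right)
    have e1: "exp (- t) \<le> r * r ^ m"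
    proof -
      have "exp (- t) \<le> exp (- (real (Suc m) * Re w))" using t1 by simp
      also have "\<dots> = r ^ Suc m" unfolding r_def exp_of_nat_mult[symmetric] by simp
      finally show ?thesis by simp
    qed
    have e2: "exp (- t) \<le> r" using t1 t2 by (simp add: r_def)
    have t0: "t > 0" using t1 t2 w by linarith
    have "norm (euler_log (of_nat (Suc m) ^ k * w)) \<le> exp (- t) / (1 - exp (- t))"
      using norm_euler_log_le[of "of_nat (Suc m) ^ k * w"] minus_ln_one_minus_exp_le[OF t0] t0
      unfolding t_def[symmetric] by linarith
    also have "\<dots> \<le> (r * r ^ m) / (1 - r)"
      using e1 e2 r by (intro frac_le) auto
    finally show ?thesis .
  qed
  then have "norm (norm (euler_log (of_nat (Suc m) ^ k * w))) \<le> r * r ^ m / (1 - r)" for m by simp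
  moreover have "summable (\<lambda>m. r * r ^ m / (1 - r))"
    using r by (intro summable_divide summable_mult summable_geometric) auto
  ultimately show ?thesis by (rule summable_comparison_test'[where N = 0, rotated])
qed

definition log_gf :: "nat \<Rightarrow> complex \<Rightarrow> complex" where
  "log_gf k w = (\<Sum>m. euler_log (of_nat (Suc m) ^ k * w))"

lemma log_gf_sums:
  assumes "k > 0" "Re w > 0"
  shows "(\<lambda>m. euler_log (of_nat (Suc m) ^ k * w)) sums log_gf k w"
  unfolding log_gf_def by (rule summable_sums[OF summable_norm_cancel[OF summable_euler_log_powers[OF assms]]])

lemma prod_power_gf_tendsto:
  assumes k: "k > 0" and w: "Re w > 0"
  shows "(\<lambda>M. \<Prod>m=1..M. 1 / (1 - exp (- w) ^ (m ^ k))) \<longlonglongrightarrow> exp (log_gf k w)"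
proof -
  have "(\<lambda>M. exp (\<Sum>m<M. euler_log (of_nat (Suc m) ^ k * w))) \<longlonglongrightarrow> exp (log_gf k w)"
    using log_gf_sums[OF k w] by (intro tendsto_exp) (simp add: sums_def)
  also have "(\<lambda>M. exp (\<Sum>m<M. euler_log (of_nat (Suc m) ^ k * w))) = (\<lambda>M. \<Prod>m=1..M. 1 / (1 - exp (- w) ^ (m ^ k)))"
  proof
    fix M
    have "exp (\<Sum>m<M. euler_log (of_nat (Suc m) ^ k * w)) = (\<Prod>m<M. 1 / (1 - exp (- w) ^ (Suc m ^ k)))"
      unfolding exp_sum[OF finite_lessThan]
    proof (rule prod.cong[OF refl])
      fix m
      have "Re (of_nat (Suc m) ^ k * w) > 0"
        unfolding Re_of_nat_power_times using w by (intro mult_pos_pos) auto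
      moreover have "exp (- (of_nat (Suc m) ^ k * w)) = exp (- w) ^ (Suc m ^ k)"
        by (subst exp_of_nat_mult[symmetric]) (simp add: algebra_simps)
      ultimately show "exp (euler_log (of_nat (Suc m) ^ k * w)) = 1 / (1 - exp (- w) ^ (Suc m ^ k))"
        by (simp only: exp_euler_log)
    qed
    also have "\<dots> = (\<Prod>m=1..M. 1 / (1 - exp (- w) ^ (m ^ k)))"
      by (rule prod.reindex_bij_witness[of _ "\<lambda>m. m - 1" Suc]) auto
    finally show "exp (\<Sum>m<M. euler_log (of_nat (Suc m) ^ k * w)) = (\<Prod>m=1..M. 1 / (1 - exp (- w) ^ (m ^ k)))" .
  qed
  finally show ?thesis .
qed

text \<open>For n < N the coefficients agree with those of the bounded problem, so the partial sums
  at radius r = exp (- Re w) are at most a finite product at the real point Re w. These products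
  converge and hence are bounded, which gives summability. The series and the M-th product then
  differ only in coefficients with n >= M, by at most a tail of a convergent series.\<close>

lemma num_power_partitions_gf:
  assumes k: "k > 0" and w: "Re w > 0"
  shows "summable (\<lambda>n. real (num_power_partitions k n) * exp (- Re w) ^ n)"
    and "(\<lambda>n. of_nat (num_power_partitions k n) * exp (- w) ^ n) sums exp (log_gf k w)"
proof -
  let ?p = "num_power_partitions k" and ?a = "\<lambda>M n. card (bounded_power_partitions k M n)"
  define r where "r = exp (- Re w)"
  have r: "0 < r" "r < 1" using w by (auto simp: r_def)
  have rw: "norm (exp (- w)) = r" by (simp add: r_def)
  have lim: "(\<lambda>M. \<Prod>m=1..M. 1 / (1 - exp (- of_real (Re w)) ^ (m ^ k))) \<longlonglongrightarrow> exp (log_gf k (of_real (Re w)))"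
    using prod_power_gf_tendsto[OF k, of "of_real (Re w)"] w by simp
  then have "Bseq (\<lambda>M. \<Prod>m=1..M. 1 / (1 - exp (- complex_of_real (Re w)) ^ (m ^ k)))"
    by (intro convergent_imp_Bseq) (auto simp: convergent_def)
  then obtain B where B: "\<And>M. norm (\<Prod>m=1..M. 1 / (1 - exp (- complex_of_real (Re w)) ^ (m ^ k))) \<le> B"
    by (auto simp: Bseq_def)
  have "(\<Sum>n<N. real (?p n) * r ^ n) \<le> B" for N
  proof -
    have nr: "norm (exp (- complex_of_real (Re w))) = r" by (simp add: r_def)
    note gf = bounded_power_partitions_gf[OF k, of "exp (- complex_of_real (Re w))" N, unfolded nr]
    have s: "summable (\<lambda>n. real (?a N n) * r ^ n)" using gf r by auto
    have "(\<Sum>n<N. real (?p n) * r ^ n) = (\<Sum>n<N. real (?a N n) * r ^ n)"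
      using num_power_partitions_eq_bounded[OF k] by (intro sum.cong) auto
    also have "\<dots> \<le> (\<Sum>n. real (?a N n) * r ^ n)" using r by (intro sum_le_suminf s) auto
    also have "\<dots> = norm (complex_of_real (\<Sum>n. real (?a N n) * r ^ n))"
      using r by (subst norm_of_real) (intro abs_of_nonneg[symmetric] suminf_nonneg s, auto)
    also have "complex_of_real (\<Sum>n. real (?a N n) * r ^ n) = (\<Sum>n. of_nat (?a N n) * exp (- complex_of_real (Re w)) ^ n)"
      using suminf_of_real[OF s, where 'a = complex] by (simp add: r_def exp_of_real[symmetric])
    also have "\<dots> = (\<Prod>m=1..N. 1 / (1 - exp (- complex_of_real (Re w)) ^ (m ^ k)))"
      using gf r by (auto simp: sums_iff)
    finally show ?thesis using B[of N] by linarith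
  qed
  then have s: "summable (\<lambda>n. real (?p n) * r ^ n)"
    using r by (intro bounded_imp_summable[of _ B])
      (auto simp: lessThan_Suc_atMost[symmetric] simp del: sum.lessThan_Suc)
  then show "summable (\<lambda>n. real (?p n) * exp (- Re w) ^ n)" by (simp add: r_def)
  have sc: "summable (\<lambda>n. norm (of_nat (?p n) * exp (- w) ^ n))"
    using s by (simp only: norm_mult norm_power rw norm_of_nat)
  have bd: "norm ((\<Sum>n. of_nat (?p n) * exp (- w) ^ n) - (\<Prod>m=1..M. 1 / (1 - exp (- w) ^ (m ^ k))))
         \<le> (\<Sum>n. real (?p (n + M)) * r ^ (n + M))" for M
  proof -
    note gf = bounded_power_partitions_gf[OF k, of "exp (- w)" M, unfolded rw]
    have "(\<lambda>n. of_nat (?p n) * exp (- w) ^ n - of_nat (?a M n) * exp (- w) ^ n) sums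
        ((\<Sum>n. of_nat (?p n) * exp (- w) ^ n) - (\<Prod>m=1..M. 1 / (1 - exp (- w) ^ (m ^ k))))"
      using gf r sc by (intro sums_diff summable_sums) (auto dest: summable_norm_cancel)
    then have b1: "(\<lambda>n. of_nat (?p (n + M)) * exp (- w) ^ (n + M) - of_nat (?a M (n + M)) * exp (- w) ^ (n + M)) sums
        ((\<Sum>n. of_nat (?p n) * exp (- w) ^ n) - (\<Prod>m=1..M. 1 / (1 - exp (- w) ^ (m ^ k))))"
    proof (subst sums_iff_shift)
      have "(\<Sum>i<M. of_nat (?p i) * exp (- w) ^ i - of_nat (?a M i) * exp (- w) ^ i) = 0"
        by (rule sum.neutral) (simp add: num_power_partitions_eq_bounded[OF k])
      then show "(\<lambda>n. of_nat (?p n) * exp (- w) ^ n - of_nat (?a M n) * exp (- w) ^ n) sums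
        ((\<Sum>n. of_nat (?p n) * exp (- w) ^ n) - (\<Prod>m=1..M. 1 / (1 - exp (- w) ^ (m ^ k)))
          + (\<Sum>i<M. of_nat (?p i) * exp (- w) ^ i - of_nat (?a M i) * exp (- w) ^ i))"
        using \<open>(\<lambda>n. of_nat (?p n) * exp (- w) ^ n - of_nat (?a M n) * exp (- w) ^ n) sums _\<close> by simp
    qed
    have b2: "norm (of_nat (?p (n + M)) * exp (- w) ^ (n + M) - of_nat (?a M (n + M)) * exp (- w) ^ (n + M))
        \<le> real (?p (n + M)) * r ^ (n + M)" for n
    proof -
      have "of_nat (?p (n + M)) * exp (- w) ^ (n + M) - of_nat (?a M (n + M)) * exp (- w) ^ (n + M)
        = of_nat (?p (n + M) - ?a M (n + M)) * exp (- w) ^ (n + M)"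
        using card_bounded_power_partitions_le[OF k, of M "n + M"] by (simp add: of_nat_diff algebra_simps)
      then show ?thesis using r by (simp only: norm_mult norm_power rw norm_of_nat) (intro mult_right_mono; simp)
    qed
    have b3: "summable (\<lambda>n. real (?p (n + M)) * r ^ (n + M))" using s by (rule summable_ignore_initial_segment)
    show ?thesis using norm_suminf_le[OF b2 b3] b1 by (simp add: sums_iff)
  qed
  have "(\<lambda>M. (\<Sum>n. of_nat (?p n) * exp (- w) ^ n) - (\<Prod>m=1..M. 1 / (1 - exp (- w) ^ (m ^ k)))) \<longlonglongrightarrow> 0"
    by (rule Lim_null_comparison[OF _ suminf_exist_split2[OF s]]) (use bd in auto)
  moreover have "(\<lambda>M. (\<Sum>n. of_nat (?p n) * exp (- w) ^ n) - (\<Prod>m=1..M. 1 / (1 - exp (- w) ^ (m ^ k))))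
     \<longlonglongrightarrow> (\<Sum>n. of_nat (?p n) * exp (- w) ^ n) - exp (log_gf k w)"
    by (intro tendsto_diff tendsto_const prod_power_gf_tendsto assms)
  ultimately have "(\<Sum>n. of_nat (?p n) * exp (- w) ^ n) = exp (log_gf k w)"
    using LIMSEQ_unique by fastforce
  then show "(\<lambda>n. of_nat (?p n) * exp (- w) ^ n) sums exp (log_gf k w)"
    using summable_sums[OF summable_norm_cancel[OF sc]] by simp
qed

text \<open>Fourier inversion on the circle of radius $e^{-\sigma}$.\<close>

lemma power_partitions_difference_integral:
  assumes k: "k > 0" and \<sigma>: "\<sigma> > 0"
  shows "((\<lambda>t. exp (of_nat n * Complex \<sigma> (- t)) * (exp (Complex \<sigma> (- t)) - 1) * exp (log_gf k (Complex \<sigma> (- t))))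
     has_integral complex_of_real (2 * pi * (real (num_power_partitions k (n + 1)) - real (num_power_partitions k n)))) {-pi..pi}"
proof -
  let ?p = "\<lambda>n. complex_of_nat (num_power_partitions k n)"
  define w where "w = (\<lambda>t. Complex \<sigma> (- t))"
  define q where "q = (\<lambda>t. exp (- w t))"
  \<comment> \<open>The coefficients of (1 - q) times the generating function are the differences
    p(m) - p(m - 1). Since exp (n w) (exp w - 1) = exp ((n + 1) w) (1 - q) with q = exp (- w), the
    constant Fourier mode of the integrand is \<open>c (n + 1)\<close>.\<close>
  define c where "c = (\<lambda>m. ?p m - (if m = 0 then 0 else ?p (m - 1)))"
  have nq: "norm (q t) = exp (- \<sigma>)" for t by (simp add: q_def w_def)
  have sums: "(\<lambda>m. c m * q t ^ m) sums ((1 - q t) * exp (log_gf k (w t)))" for t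
  proof -
    have s: "(\<lambda>m. ?p m * q t ^ m) sums exp (log_gf k (w t))"
      unfolding q_def using \<sigma> by (intro num_power_partitions_gf k) (simp add: w_def)
    then have "(\<lambda>m. ?p m * q t ^ m - q t * (if 1 \<le> m then ?p (m - 1) * q t ^ (m - 1) else 0))
       sums (exp (log_gf k (w t)) - q t * exp (log_gf k (w t)))"
      by (intro sums_diff sums_mult sums_shift_right)
    moreover have "?p m * q t ^ m - q t * (if 1 \<le> m then ?p (m - 1) * q t ^ (m - 1) else 0) = c m * q t ^ m" for m
      by (cases m) (auto simp: c_def algebra_simps)
    ultimately show ?thesis by (simp add: algebra_simps)
  qed
  have sm: "summable (\<lambda>m. norm (c m) * exp (- \<sigma>) ^ m)"
  proof (rule summable_comparison_test'[where N = 0])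
    have s: "summable (\<lambda>m. real (num_power_partitions k m) * exp (- \<sigma>) ^ m)"
      using num_power_partitions_gf(1)[OF k, of "of_real \<sigma>"] \<sigma> by simp
    have "summable (\<lambda>m. if 1 \<le> m then real (num_power_partitions k (m - 1)) * exp (- \<sigma>) ^ (m - 1) else 0)"
      using s by (subst summable_Suc_iff[symmetric]) simp
    then show "summable (\<lambda>m. real (num_power_partitions k m) * exp (- \<sigma>) ^ m
       + exp (- \<sigma>) * (if 1 \<le> m then real (num_power_partitions k (m - 1)) * exp (- \<sigma>) ^ (m - 1) else 0))"
      by (intro summable_add s summable_mult)
    show "norm (norm (c m) * exp (- \<sigma>) ^ m) \<le> real (num_power_partitions k m) * exp (- \<sigma>) ^ m
       + exp (- \<sigma>) * (if 1 \<le> m then real (num_power_partitions k (m - 1)) * exp (- \<sigma>) ^ (m - 1) else 0)" for m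
    proof (cases m)
      case (Suc j)
      have "norm (c m) \<le> real (num_power_partitions k m) + real (num_power_partitions k j)"
        using norm_triangle_ineq4[of "?p m" "?p j"] by (simp add: c_def Suc)
      then have "norm (c m) * exp (- \<sigma>) ^ m \<le> (real (num_power_partitions k m) + real (num_power_partitions k j)) * exp (- \<sigma>) ^ m"
        by (intro mult_right_mono) auto
      then show ?thesis by (simp add: Suc algebra_simps)
    qed (simp add: c_def)
  qed
  let ?f = "\<lambda>t. exp (of_nat n * w t) * (exp (w t) - 1) * exp (log_gf k (w t))"
  have trm: "exp (of_nat (n + 1) * w t) * (c m * q t ^ m)
      = c m * exp ((of_nat (n + 1) - of_nat m) * w t)" for m t
    by (simp add: q_def exp_of_nat_mult[symmetric] exp_add[symmetric] algebra_simps)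
  have fsums: "(\<lambda>m. c m * exp ((of_nat (n + 1) - of_nat m) * w t)) sums ?f t" for t
  proof -
    have "(\<lambda>m. exp (of_nat (n + 1) * w t) * (c m * q t ^ m)) sums (exp (of_nat (n + 1) * w t) * ((1 - q t) * exp (log_gf k (w t))))"
      by (intro sums_mult sums)
    moreover have "exp (of_nat (n + 1) * w t) * ((1 - q t) * exp (log_gf k (w t))) = ?f t"
      by (simp add: q_def exp_minus exp_add field_simps)
    ultimately show ?thesis by (simp only: trm)
  qed
  have "uniform_limit {-pi..pi} (\<lambda>M t. \<Sum>m<M. c m * exp ((of_nat (n + 1) - of_nat m) * w t))
          (\<lambda>t. \<Sum>m. c m * exp ((of_nat (n + 1) - of_nat m) * w t)) sequentially"
  proof (rule Weierstrass_m_test)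
    show "summable (\<lambda>m. exp (real (n + 1) * \<sigma>) * (norm (c m) * exp (- \<sigma>) ^ m))"
      by (intro summable_mult sm)
    show "norm (c m * exp ((of_nat (n + 1) - of_nat m) * w t)) \<le> exp (real (n + 1) * \<sigma>) * (norm (c m) * exp (- \<sigma>) ^ m)" for m t
      unfolding trm[symmetric] norm_mult norm_power nq by (simp add: w_def)
  qed
  then have ul: "uniform_limit {-pi..pi} (\<lambda>M t. \<Sum>m<M. c m * exp ((of_nat (n + 1) - of_nat m) * w t)) ?f sequentially"
    using fsums by (simp add: sums_iff)
  have orth: "((\<lambda>t. c m * exp ((of_nat (n + 1) - of_nat m) * w t)) has_integral
      (if m = n + 1 then 2 * pi * c m else 0)) {-pi..pi}" for m
  proof (cases "m = n + 1")
    case True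
    have "((\<lambda>t. c m) has_integral ((2 * pi) *\<^sub>R c m)) {-pi..pi}"
      using has_integral_const_real[of "c m" "- pi" pi] by simp
    then show ?thesis using True by (simp add: scaleR_conv_of_real)
  next
    case False
    define N where "N = int (n + 1) - int m"
    have N: "N \<noteq> 0" using False by (simp add: N_def)
    have Nc: "of_nat (n + 1) - of_nat m = (of_int N :: complex)" by (simp add: N_def)
    let ?F = "\<lambda>t. c m * exp (of_int N * w t) / (- \<i> * of_int N)"
    have "((\<lambda>t. c m * exp (of_int N * w t)) has_integral (?F pi - ?F (- pi))) {-pi..pi}"
    proof (rule fundamental_theorem_of_calculus)
      have w: "w = (\<lambda>t. of_real \<sigma> - \<i> * of_real t)" by (rule ext) (simp add: w_def complex_eq_iff)
      show "(?F has_vector_derivative c m * exp (of_int N * w t)) (at t within {-pi..pi})" for t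
        unfolding w using N
        by (auto intro!: derivative_eq_intros has_vector_derivative_real_field simp: field_simps)
    qed simp
    \<comment> \<open>A primitive of a nonconstant mode is 2 pi-periodic because N is a nonzero
      integer, so its end values cancel.\<close>
    moreover have "exp (of_int N * w pi) = exp (of_int N * w (- pi))"
    proof -
      have "of_int N * w pi = of_int N * w (- pi) + (of_int (2 * - N) * pi) * \<i>"
        by (simp add: w_def complex_eq_iff)
      then show ?thesis unfolding exp_eq by blast
  qed
    ultimately show ?thesis using False unfolding Nc by simp
  qed
  obtain I J where IJ: "\<And>M. ((\<lambda>t. \<Sum>m<M. c m * exp ((of_nat (n + 1) - of_nat m) * w t)) has_integral I M) {-pi..pi}"
    "(?f has_integral J) {-pi..pi}" "I \<longlonglongrightarrow> J"
  proof (rule uniform_limit_integral[OF ul])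
    show "continuous_on {-pi..pi} (\<lambda>t. \<Sum>m<M. c m * exp ((of_nat (n + 1) - of_nat m) * w t))" for M
      unfolding w_def complex_eq by (intro continuous_intros)
  qed auto
  have "I M = (\<Sum>m<M. if m = n + 1 then 2 * pi * c m else 0)" for M
    by (rule has_integral_unique[OF IJ(1) has_integral_sum]) (use orth in auto)
  then have "I M = 2 * pi * c (n + 1)" if "M > n + 1" for M using that by simp
  then have "I \<longlonglongrightarrow> 2 * pi * c (n + 1)"
    by (intro tendsto_eventually eventually_mono[OF eventually_gt_at_top[of "n + 1"]])
  then have "J = 2 * pi * c (n + 1)" using IJ(3) LIMSEQ_unique by blast
  then have J: "J = complex_of_real (2 * pi * (real (num_power_partitions k (n + 1)) - real (num_power_partitions k n)))"
    by (simp add: c_def)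
  show ?thesis using IJ(2) unfolding w_def J .
qed

section \<open>Euler--Maclaurin summation and Stirling's formula\<close>

definition poly_primitive :: "real poly \<Rightarrow> real poly" where
  "poly_primitive p = (\<Sum>i\<le>degree p. monom (coeff p i / real (Suc i)) (Suc i))"

lemma pderiv_poly_primitive: "pderiv (poly_primitive p) = p"
proof (rule poly_eqI)
  fix n
  have "coeff (pderiv (poly_primitive p)) n
      = real (Suc n) * (\<Sum>i\<le>degree p. if i = n then coeff p i / real (Suc i) else 0)"
    by (simp add: coeff_pderiv poly_primitive_def coeff_sum coeff_monom del: of_nat_Suc)
  also have "\<dots> = coeff p n"
    by (cases "n \<le> degree p") (simp_all add: coeff_eq_0 del: of_nat_Suc)
  finally show "coeff (pderiv (poly_primitive p)) n = coeff p n" .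
qed

text \<open>The Bernoulli polynomials divided by the factorial of their index.\<close>

fun bernoulli_kernel :: "nat \<Rightarrow> real poly" where
  "bernoulli_kernel 0 = 1"
| "bernoulli_kernel (Suc j) = poly_primitive (bernoulli_kernel j)
     - [:poly (poly_primitive (poly_primitive (bernoulli_kernel j))) 1
         - poly (poly_primitive (poly_primitive (bernoulli_kernel j))) 0:]"

lemma pderiv_bernoulli_kernel: "pderiv (bernoulli_kernel (Suc j)) = bernoulli_kernel j"
  by (simp add: pderiv_diff pderiv_poly_primitive pderiv_pCons)

lemma poly_eq_add_const:
  fixes p q :: "real poly"
  assumes "pderiv p = pderiv q" shows "poly p x - poly q x = poly p y - poly q y"
proof -
  have "pderiv (p - q) = 0" using assms by (simp add: pderiv_diff)
  then obtain c where "p - q = [:c:]" using pderiv_iszero by blast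
  then show ?thesis by (metis poly_diff poly_pCons poly_0 mult_zero_right add.right_neutral)
qed

text \<open>The constant subtracted in the recursion is the mean over [0, 1] of the primitive, so
  every kernel of index at least 1 has mean 0 and the next one has equal end values.\<close>

lemma bernoulli_kernel_periodic:
  "poly (bernoulli_kernel (Suc (Suc j))) 1 = poly (bernoulli_kernel (Suc (Suc j))) 0"
proof -
  let ?P = "poly_primitive (poly_primitive (bernoulli_kernel j))"
  define c where "c = poly ?P 1 - poly ?P 0"
  have "pderiv (bernoulli_kernel (Suc (Suc j))) = pderiv (?P - [:0, c:])"
    by (simp only: pderiv_bernoulli_kernel pderiv_diff pderiv_poly_primitive bernoulli_kernel.simps c_def)
       (simp add: pderiv_pCons)
  from poly_eq_add_const[OF this, of 1 0] show ?thesis by (simp add: c_def)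
qed

lemma bernoulli_kernel_1: "poly (bernoulli_kernel (Suc 0)) x = x - 1 / 2"
proof -
  have "poly_primitive 1 = [:0, 1:]" by (simp add: poly_primitive_def monom_Suc)
  moreover have "poly (poly_primitive [:0, 1:]) 1 - poly (poly_primitive [:0, 1:]) 0 = 1 / 2"
    using poly_eq_add_const[of "poly_primitive [:0, 1:]" "[:0, 0, 1/2:]" 1 0]
    by (simp add: pderiv_poly_primitive pderiv_pCons)
  ultimately show ?thesis by simp
qed

text \<open>The integral over [0, N] of g_J against the 1-periodic extension of the J-th kernel, cut
  at the integers so that each piece involves a plain polynomial.\<close>

definition em_remainder :: "(nat \<Rightarrow> real \<Rightarrow> complex) \<Rightarrow> nat \<Rightarrow> nat \<Rightarrow> complex" where
  "em_remainder g N J =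
     (\<Sum>m<N. integral {real m..real (Suc m)} (\<lambda>t. poly (bernoulli_kernel J) (t - real m) *\<^sub>R g J t))"

context
  fixes g :: "nat \<Rightarrow> real \<Rightarrow> complex" and N :: nat
  assumes deriv: "\<And>j t. t \<in> {0..real N} \<Longrightarrow> (g j has_vector_derivative g (Suc j) t) (at t within {0..real N})"
begin

lemma em_continuous: "continuous_on {0..real N} (g j)"
  unfolding continuous_on_eq_continuous_within using deriv has_vector_derivative_continuous by blast

lemma em_integrable:
  assumes "m < N"
  shows "(\<lambda>t. poly (bernoulli_kernel J) (t - real m) *\<^sub>R g J t) integrable_on {real m..real (Suc m)}"
proof -
  have "{real m..real (Suc m)} \<subseteq> {0..real N}" using assms by auto
  then show ?thesis
    by (intro integrable_continuous_interval continuous_intros continuous_on_subset[OF em_continuous])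
qed

lemma em_step:
  assumes "m < N"
  shows "integral {real m..real (Suc m)} (\<lambda>t. poly (bernoulli_kernel (Suc J)) (t - real m) *\<^sub>R g (Suc J) t)
    = poly (bernoulli_kernel (Suc J)) 1 *\<^sub>R g J (real (Suc m)) - poly (bernoulli_kernel (Suc J)) 0 *\<^sub>R g J (real m)
       - integral {real m..real (Suc m)} (\<lambda>t. poly (bernoulli_kernel J) (t - real m) *\<^sub>R g J t)"
proof -
  let ?I = "{real m..real (Suc m)}" and ?b = "\<lambda>J t. poly (bernoulli_kernel J) (t - real m)"
  have sub: "?I \<subseteq> {0..real N}" using assms by auto
  have "((\<lambda>t. ?b (Suc J) t *\<^sub>R g (Suc J) t + ?b J t *\<^sub>R g J t) has_integral
     (?b (Suc J) (real (Suc m)) *\<^sub>R g J (real (Suc m)) - ?b (Suc J) (real m) *\<^sub>R g J (real m))) ?I"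
  proof (rule fundamental_theorem_of_calculus)
    fix t assume t: "t \<in> ?I"
    have 1: "(g J has_vector_derivative g (Suc J) t) (at t within ?I)"
      using deriv[of t J] t sub by (auto intro: has_vector_derivative_within_subset)
    have "((\<lambda>t. ?b (Suc J) t) has_real_derivative poly (pderiv (bernoulli_kernel (Suc J))) (t - real m)) (at t within ?I)"
      by (auto intro!: derivative_eq_intros simp del: bernoulli_kernel.simps)
    then have "((\<lambda>t. ?b (Suc J) t) has_real_derivative ?b J t) (at t within ?I)"
      by (simp only: pderiv_bernoulli_kernel)
    from has_vector_derivative_scaleR[OF this 1]
    show "((\<lambda>t. ?b (Suc J) t *\<^sub>R g J t) has_vector_derivative (?b (Suc J) t *\<^sub>R g (Suc J) t + ?b J t *\<^sub>R g J t)) (at t within ?I)" .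
  qed simp
  moreover have "integral ?I (\<lambda>t. ?b (Suc J) t *\<^sub>R g (Suc J) t + ?b J t *\<^sub>R g J t)
     = integral ?I (\<lambda>t. ?b (Suc J) t *\<^sub>R g (Suc J) t) + integral ?I (\<lambda>t. ?b J t *\<^sub>R g J t)"
    by (intro integral_add em_integrable assms)
  ultimately show ?thesis by (simp add: integral_unique algebra_simps del: bernoulli_kernel.simps)
qed

text \<open>The first kernel is t - m - 1/2 on [m, m + 1], with end values -1/2 and 1/2, so
  integration by parts gives trapezoidal means. They are written as right end value minus half the
  increment, so that the sum over 1, ..., N appears and the increments telescope.\<close>

lemma em_remainder_1:
  "em_remainder g N 1 = (\<Sum>m=1..N. g 0 (real m)) - (g 0 (real N) - g 0 0) / 2 - integral {0..real N} (g 0)"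
proof -
  have "em_remainder g N 1 = (\<Sum>m<N. ((g 0 (real (Suc m)) - (g 0 (real (Suc m)) - g 0 (real m)) / 2)
           - integral {real m..real (Suc m)} (g 0)))"
    unfolding em_remainder_def
  proof (rule sum.cong[OF refl])
    fix m assume "m \<in> {..<N}"
    then show "integral {real m..real (Suc m)} (\<lambda>t. poly (bernoulli_kernel 1) (t - real m) *\<^sub>R g 1 t)
       = (g 0 (real (Suc m)) - (g 0 (real (Suc m)) - g 0 (real m)) / 2) - integral {real m..real (Suc m)} (g 0)"
      using em_step[of m 0] by (simp add: bernoulli_kernel_1 scaleR_conv_of_real field_simps del: bernoulli_kernel.simps(2))
  qed
  also have "\<dots> = (\<Sum>m<N. g 0 (real (Suc m))) - (\<Sum>m<N. g 0 (real (Suc m)) - g 0 (real m)) / 2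
       - (\<Sum>m<N. integral {real m..real (Suc m)} (g 0))"
    unfolding sum_divide_distrib by (simp only: sum_subtractf[symmetric])
  also have "(\<Sum>m<N. g 0 (real (Suc m)) - g 0 (real m)) = g 0 (real N) - g 0 0"
    using sum_lessThan_telescope[of "\<lambda>m. g 0 (real m)" N] by simp
  also have "(\<Sum>m<N. g 0 (real (Suc m))) = (\<Sum>m=1..N. g 0 (real m))"
    by (rule sum.reindex_bij_witness[of _ "\<lambda>m. m - 1" Suc]) auto
  also have "M \<le> N \<Longrightarrow> (\<Sum>m<M. integral {real m..real (Suc m)} (g 0)) = integral {0..real M} (g 0)" for M
  proof (induction M)
    case (Suc M)
    have "integral {0..real M} (g 0) + integral {real M..real (Suc M)} (g 0) = integral {0..real (Suc M)} (g 0)"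
    proof (rule Henstock_Kurzweil_Integration.integral_combine)
      show "g 0 integrable_on {0..real (Suc M)}"
        using Suc.prems by (intro integrable_continuous_interval continuous_on_subset[OF em_continuous]) auto
    qed auto
    then show ?case using Suc by simp
  qed simp
  finally show ?thesis by simp
qed

text \<open>From index 2 on the kernel takes the same value at 0 and 1, so the boundary terms of the
  unit intervals telescope.\<close>

lemma em_remainder_Suc:
  "em_remainder g N (Suc (Suc J)) = poly (bernoulli_kernel (Suc (Suc J))) 0 *\<^sub>R (g (Suc J) (real N) - g (Suc J) 0)
     - em_remainder g N (Suc J)"
proof -
  let ?c = "poly (bernoulli_kernel (Suc (Suc J))) 0"
  have "em_remainder g N (Suc (Suc J)) = (\<Sum>m<N. ?c *\<^sub>R (g (Suc J) (real (Suc m)) - g (Suc J) (real m))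
      - integral {real m..real (Suc m)} (\<lambda>t. poly (bernoulli_kernel (Suc J)) (t - real m) *\<^sub>R g (Suc J) t))"
    unfolding em_remainder_def
    by (intro sum.cong refl) (simp only: em_step lessThan_iff bernoulli_kernel_periodic scaleR_diff_right)
  also have "\<dots> = ?c *\<^sub>R (\<Sum>m<N. g (Suc J) (real (Suc m)) - g (Suc J) (real m)) - em_remainder g N (Suc J)"
    by (simp only: sum_subtractf em_remainder_def scaleR_sum_right scaleR_diff_right)
  also have "(\<Sum>m<N. g (Suc J) (real (Suc m)) - g (Suc J) (real m)) = g (Suc J) (real N) - g (Suc J) 0"
    using sum_lessThan_telescope[of "\<lambda>m. g (Suc J) (real m)" N] by simp
  finally show ?thesis .
qed

lemma euler_maclaurin:
  "(\<Sum>m=1..N. g 0 (real m)) = integral {0..real N} (g 0) + (g 0 (real N) - g 0 0) / 2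
     + (\<Sum>j=1..J. ((-1) ^ (j - 1) * poly (bernoulli_kernel (Suc j)) 0) *\<^sub>R (g j (real N) - g j 0))
     + (-1) ^ J * em_remainder g N (Suc J)"
proof (induction J)
  case 0
  then show ?case using em_remainder_1 by simp
next
  case (Suc J)
  have "(\<Sum>j=1..Suc J. ((-1) ^ (j - 1) * poly (bernoulli_kernel (Suc j)) 0) *\<^sub>R (g j (real N) - g j 0))
     = (\<Sum>j=1..J. ((-1) ^ (j - 1) * poly (bernoulli_kernel (Suc j)) 0) *\<^sub>R (g j (real N) - g j 0))
      + (-1) ^ J * (poly (bernoulli_kernel (Suc (Suc J))) 0 *\<^sub>R (g (Suc J) (real N) - g (Suc J) 0))"
    by (simp add: scaleR_conv_of_real del: bernoulli_kernel.simps)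
  then show ?case unfolding Suc.IH em_remainder_Suc
    by (simp add: algebra_simps del: sum.cl_ivl_Suc bernoulli_kernel.simps)
qed

text \<open>The bound is an integral of a majorant rather than N times a maximum, so that a majorant
  integrable on the half-line makes it uniform in N.\<close>

lemma norm_em_remainder_le:
  assumes C: "\<And>x. x \<in> {0..1} \<Longrightarrow> \<bar>poly (bernoulli_kernel J) x\<bar> \<le> C"
    and h: "\<And>t. t \<in> {0..real N} \<Longrightarrow> norm (g J t) \<le> h t" and hint: "h integrable_on {0..real N}"
  shows "norm (em_remainder g N J) \<le> C * integral {0..real N} h"
proof -
  have hm: "h integrable_on {real m..real (Suc m)}" if "m < N" for m
    using that by (intro integrable_on_subinterval[OF hint]) auto
  have "norm (em_remainder g N J) \<le> (\<Sum>m<N. C * integral {real m..real (Suc m)} h)"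
    unfolding em_remainder_def
  proof (rule sum_norm_le)
    fix m assume m: "m \<in> {..<N}"
    have "norm (integral {real m..real (Suc m)} (\<lambda>t. poly (bernoulli_kernel J) (t - real m) *\<^sub>R g J t))
       \<le> integral {real m..real (Suc m)} (\<lambda>t. C * h t)"
    proof (rule integral_norm_bound_integral)
      show "(\<lambda>t. poly (bernoulli_kernel J) (t - real m) *\<^sub>R g J t) integrable_on {real m..real (Suc m)}"
        using m by (intro em_integrable) auto
      show "(\<lambda>t. C * h t) integrable_on {real m..real (Suc m)}"
        using hm m by (intro integrable_on_mult_right) auto
      fix t assume t: "t \<in> {real m..real (Suc m)}"
      then have "t \<in> {0..real N}" using m by auto
      moreover have "\<bar>poly (bernoulli_kernel J) (t - real m)\<bar> \<le> C" using t by (intro C) auto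
      ultimately show "norm (poly (bernoulli_kernel J) (t - real m) *\<^sub>R g J t) \<le> C * h t"
        unfolding norm_scaleR using h by (intro mult_mono) (auto intro: order.trans[OF abs_ge_zero])
    qed
    then show "norm (integral {real m..real (Suc m)} (\<lambda>t. poly (bernoulli_kernel J) (t - real m) *\<^sub>R g J t))
       \<le> C * integral {real m..real (Suc m)} h" by simp
  qed
  also have "\<dots> = C * (\<Sum>m<N. integral {real m..real (Suc m)} h)" by (simp add: sum_distrib_left)
  also have "M \<le> N \<Longrightarrow> (\<Sum>m<M. integral {real m..real (Suc m)} h) = integral {0..real M} h" for M
  proof (induction M)
    case (Suc M)
    have "integral {0..real M} h + integral {real M..real (Suc M)} h = integral {0..real (Suc M)} h"
      using Suc.prems by (intro Henstock_Kurzweil_Integration.integral_combine integrable_on_subinterval[OF hint]) auto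
    then show ?case using Suc by simp
  qed simp
  finally show ?thesis by simp
qed

end

lemma bernoulli_kernel_bounded: "\<exists>C. \<forall>x\<in>{0..1}. \<bar>poly (bernoulli_kernel J) x\<bar> \<le> C"
proof -
  have "compact ((\<lambda>x. poly (bernoulli_kernel J) x) ` {0..1})"
    by (intro compact_continuous_image continuous_intros) auto
  then show ?thesis by (auto dest!: compact_imp_bounded simp: bounded_iff)
qed

section \<open>Stirling's formula with its constant from Wallis's product\<close>

lemma ln_one_plus_bounds:
  assumes "0 \<le> (x::real)"
  shows "2 * x / (2 + x) \<le> ln (1 + x)" and "ln (1 + x) \<le> 2 * x / (2 + x) + x ^ 3 / 12"
proof -
  \<comment> \<open>The approximation 2 x / (2 + x) is chosen because at x = 1/n it equals 1 / (n +
    1/2), the reciprocal of the factor of the logarithm in Stirling's formula. This identity is the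
    derivative of the error, which lies between 0 and t^2 / 4.\<close>
  have eq: "1 / (1 + t) - 4 / (2 + t)^2 = t^2 / ((1 + t) * (2 + t)^2)" if "t \<ge> 0" for t :: real
    using that by (simp add: divide_simps add_eq_0_iff2) (simp add: power2_eq_square algebra_simps)
  have d: "((\<lambda>t. ln (1 + t) - 2 * t / (2 + t)) has_real_derivative t^2 / ((1 + t) * (2 + t)^2)) (at t)"
    if "t \<ge> 0" for t :: real
  proof -
    have "((\<lambda>t. ln (1 + t)) has_real_derivative 1 / (1 + t)) (at t)"
      using that by (auto intro!: derivative_eq_intros)
    moreover have "((\<lambda>t. 2 * t / (2 + t)) has_real_derivative
        ((2 * 1) * (2 + t) - 2 * t * (0 + 1)) / ((2 + t) * (2 + t))) (at t)"
      using that by (intro derivative_intros) auto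
    ultimately have "((\<lambda>t. ln (1 + t) - 2 * t / (2 + t)) has_real_derivative
        1 / (1 + t) - ((2 * 1) * (2 + t) - 2 * t * (0 + 1)) / ((2 + t) * (2 + t))) (at t)"
      by (rule DERIV_diff)
    moreover have "((2 * 1) * (2 + t) - 2 * t * (0 + 1)) / ((2 + t) * (2 + t)) = 4 / (2 + t)^2"
      by (simp add: power2_eq_square)
    ultimately show ?thesis unfolding eq[OF that, symmetric] by simp
  qed
  have "(\<lambda>t. ln (1 + t) - 2 * t / (2 + t)) 0 \<le> (\<lambda>t. ln (1 + t) - 2 * t / (2 + t)) x"
  proof (rule DERIV_nonneg_imp_nondecreasing[OF assms])
    fix t :: real assume "0 \<le> t" "t \<le> x"
    then show "\<exists>y. ((\<lambda>t. ln (1 + t) - 2 * t / (2 + t)) has_real_derivative y) (at t) \<and> 0 \<le> y"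
      using d[of t] by (intro exI[of _ "t^2 / ((1 + t) * (2 + t)^2)"] conjI) auto
  qed
  then show "2 * x / (2 + x) \<le> ln (1 + x)" by simp
  have d2: "((\<lambda>t. t ^ 3 / 12 - (ln (1 + t) - 2 * t / (2 + t))) has_real_derivative
      t^2 / 4 - t^2 / ((1 + t) * (2 + t)^2)) (at t)" if "t \<ge> 0" for t :: real
  proof -
    have "((\<lambda>t. t ^ 3 / 12) has_real_derivative t^2 / 4) (at t)"
      by (auto intro!: derivative_eq_intros)
    from DERIV_diff[OF this d[OF that]] show ?thesis .
  qed
  have "(\<lambda>t. t ^ 3 / 12 - (ln (1 + t) - 2 * t / (2 + t))) 0 \<le> (\<lambda>t. t ^ 3 / 12 - (ln (1 + t) - 2 * t / (2 + t))) x"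
  proof (rule DERIV_nonneg_imp_nondecreasing[OF assms])
    fix t :: real assume t: "0 \<le> t" "t \<le> x"
    have "4 \<le> (1 + t) * (2 + t)^2" using t mult_mono[of 1 "1 + t" 4 "(2 + t)^2"] power_mono[of 2 "2 + t" 2] by simp
    then have "t^2 / ((1 + t) * (2 + t)^2) \<le> t^2 / 4" using t by (intro divide_left_mono) auto
    then show "\<exists>y. ((\<lambda>t. t ^ 3 / 12 - (ln (1 + t) - 2 * t / (2 + t))) has_real_derivative y) (at t) \<and> 0 \<le> y"
      using d2[OF t(1)] by (intro exI[of _ "t^2 / 4 - t^2 / ((1 + t) * (2 + t)^2)"] conjI) auto
  qed
  then show "ln (1 + x) \<le> 2 * x / (2 + x) + x ^ 3 / 12" by simp
qed

definition stirling_seq :: "nat \<Rightarrow> real" where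
  "stirling_seq n = ln (fact n) - real n * ln (real n) + real n - ln (real n) / 2"

text \<open>Up to sign, one step of the sequence is (n + 1/2) ln(1 + 1/n) - 1. The main part of the
  logarithm cancels the 1 exactly, and the cubic error leaves O(1/n^2), which is summable.\<close>

lemma stirling_seq_diff:
  assumes "n > 0"
  shows "\<bar>stirling_seq (Suc n) - stirling_seq n\<bar> \<le> 1 / real n ^ 2"
proof -
  define x where "x = 1 / real n"
  have x: "x > 0" "real n * x = 1" "x * real n = 1" "x \<le> 1" using assms by (auto simp: x_def)
  define f where "f = ln (1 + x) - 2 * x / (2 + x)"
  have f: "0 \<le> f" "f \<le> x ^ 3 / 12" using ln_one_plus_bounds[of x] x by (auto simp: f_def)
  have "real (Suc n) = real n * (1 + x)" using x by (simp add: algebra_simps)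
  then have l: "ln (real (Suc n)) = ln (real n) + ln (1 + x)" using x assms by (simp add: ln_mult)
  have "stirling_seq n - stirling_seq (Suc n) = (real n + 1 / 2) * ln (1 + x) - 1"
    unfolding stirling_seq_def fact_Suc of_nat_mult using assms
    by (simp add: ln_mult l del: of_nat_Suc) (simp add: algebra_simps add_divide_distrib diff_divide_distrib)
  also have "\<dots> = (real n + 1 / 2) * f + ((real n + 1 / 2) * (2 * x / (2 + x)) - 1)"
    by (simp add: f_def algebra_simps)
  also have "(real n + 1 / 2) * (2 * x / (2 + x)) = 1"
    using x by (simp add: field_simps)
  finally have e: "stirling_seq n - stirling_seq (Suc n) = (real n + 1 / 2) * f" by simp
  have "(real n + 1 / 2) * f \<le> (2 * real n) * (x ^ 3 / 12)" using f assms by (intro mult_mono) auto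
  also have "\<dots> = x ^ 2 / 6" using x by (simp add: power3_eq_cube power2_eq_square)
  also have "\<dots> \<le> x ^ 2" by simp
  finally have "(real n + 1 / 2) * f \<le> 1 / real n ^ 2" by (simp add: x_def power_divide)
  moreover have "0 \<le> (real n + 1 / 2) * f" using f by simp
  ultimately show ?thesis using e by linarith
qed

lemma stirling_seq_convergent: "convergent stirling_seq"
proof -
  have "summable (\<lambda>n. norm (stirling_seq (Suc n) - stirling_seq n))"
  proof (rule summable_comparison_test'[where N = 1])
    show "summable (\<lambda>n. 1 / real n ^ 2)" using inverse_power_summable[of 2] by (simp add: inverse_eq_divide)
  qed (use stirling_seq_diff in auto)
  then have "summable (\<lambda>n. stirling_seq (Suc n) - stirling_seq n)" by (rule summable_norm_cancel)
  then have "convergent (\<lambda>N. \<Sum>n<N. stirling_seq (Suc n) - stirling_seq n)"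
    by (simp add: summable_iff_convergent)
  then have "convergent (\<lambda>N. stirling_seq N - stirling_seq 0)" by (simp add: sum_lessThan_telescope)
  then have "convergent (\<lambda>N. (stirling_seq N - stirling_seq 0) + stirling_seq 0)"
    by (intro convergent_add convergent_const)
  then show ?thesis by simp
qed

text \<open>The partial Wallis product is 2^(4n) n!^4 / ((2n)!^2 (2n + 1)). With s for the sequence,
  its logarithm is 4 s(n) - 2 s(2n) + ln(n / (2n + 1)) - ln 2, in which all growing terms have
  cancelled; in the limit 2 L - 2 ln 2 = ln(pi / 2).\<close>

lemma stirling_seq_tendsto: "stirling_seq \<longlonglongrightarrow> ln (2 * pi) / 2"
proof -
  obtain L where L: "stirling_seq \<longlonglongrightarrow> L" using stirling_seq_convergent by (auto simp: convergent_def)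
  have prod: "(\<Prod>k=1..n. (4 * real k ^ 2) / (4 * real k ^ 2 - 1))
     = 2 ^ (4 * n) * fact n ^ 4 / (fact (2 * n) ^ 2 * real (2 * n + 1))" for n
  proof (induction n)
    case (Suc n)
    have aux: "P * F / (G ^ 2 * b) * (4 * a ^ 2 / (b * c)) = (P * 16) * (a ^ 4 * F) / (((2 * a) * b * G) ^ 2 * c)"
      if "a > 0" "b > 0" "c > 0" "G > 0" for P F G a b c :: real
      using that by (simp add: divide_simps power2_eq_square power4_eq_xxxx)
    have "4 * real (Suc n) ^ 2 - 1 = real (2 * n + 1) * real (2 * n + 3)"
      by (simp add: power2_eq_square algebra_simps)
    then have "(\<Prod>k=1..Suc n. (4 * real k ^ 2) / (4 * real k ^ 2 - 1))
       = 2 ^ (4 * n) * fact n ^ 4 / (fact (2 * n) ^ 2 * real (2 * n + 1))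
          * (4 * real (Suc n) ^ 2 / (real (2 * n + 1) * real (2 * n + 3)))"
      by (simp only: prod.cl_ivl_Suc Suc.IH) simp
    also have "\<dots> = (2 ^ (4 * n) * 16) * (real (Suc n) ^ 4 * fact n ^ 4)
        / (((2 * real (Suc n)) * real (2 * n + 1) * fact (2 * n)) ^ 2 * real (2 * n + 3))"
      by (rule aux) auto
    also have "(2 * real (Suc n)) * real (2 * n + 1) * fact (2 * n) = fact (2 * Suc n)"
      by (simp add: algebra_simps)
    also have "real (Suc n) ^ 4 * fact n ^ 4 = fact (Suc n) ^ 4"
      by (simp only: fact_Suc of_nat_mult power_mult_distrib)
    also have "(2::real) ^ (4 * n) * 16 = 2 ^ (4 * Suc n)" by (simp add: power_add)
    also have "2 * n + 3 = 2 * Suc n + 1" by simp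
    finally show ?case .
  qed simp
  have ev: "ln (\<Prod>k=1..n. (4 * real k ^ 2) / (4 * real k ^ 2 - 1))
      = 4 * stirling_seq n - 2 * stirling_seq (2 * n) + (ln (real n / (2 * real n + 1)) - ln 2)" if "n > 0" for n
  proof -
    have "ln (\<Prod>k=1..n. (4 * real k ^ 2) / (4 * real k ^ 2 - 1))
        = 4 * real n * ln 2 + 4 * ln (fact n) - 2 * ln (fact (2 * n)) - ln (2 * real n + 1)"
      unfolding prod by (simp add: ln_div ln_mult ln_realpow add.commute)
    then show ?thesis using that
      by (simp add: stirling_seq_def ln_mult ln_div field_simps)
  qed
  have "(\<lambda>n. 4 * stirling_seq n - 2 * stirling_seq (2 * n) + (ln (real n / (2 * real n + 1)) - ln 2))
      \<longlonglongrightarrow> 4 * L - 2 * L + (ln (1 / 2) - ln 2)"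
  proof -
    have "(\<lambda>n. stirling_seq (2 * n)) \<longlonglongrightarrow> L"
      using LIMSEQ_subseq_LIMSEQ[OF L, of "\<lambda>n. 2 * n"] by (simp add: strict_mono_def o_def)
    moreover have "(\<lambda>n. real n / (2 * real n + 1)) \<longlonglongrightarrow> 1 / 2" by real_asymp
    ultimately show ?thesis
      by (intro tendsto_add tendsto_diff tendsto_mult tendsto_ln tendsto_const L) simp_all
  qed
  moreover have "\<forall>\<^sub>F n in sequentially. 4 * stirling_seq n - 2 * stirling_seq (2 * n) + (ln (real n / (2 * real n + 1)) - ln 2)
      = ln (\<Prod>k=1..n. (4 * real k ^ 2) / (4 * real k ^ 2 - 1))"
    using eventually_gt_at_top[of 0] by eventually_elim (simp only: ev)
  ultimately have "(\<lambda>n. ln (\<Prod>k=1..n. (4 * real k ^ 2) / (4 * real k ^ 2 - 1))) \<longlonglongrightarrow> 4 * L - 2 * L + (ln (1 / 2) - ln 2)"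
    by (rule Lim_transform_eventually)
  moreover have "(\<lambda>n. ln (\<Prod>k=1..n. (4 * real k ^ 2) / (4 * real k ^ 2 - 1))) \<longlonglongrightarrow> ln (pi / 2)"
    by (intro tendsto_ln wallis) auto
  ultimately have "4 * L - 2 * L + (ln (1 / 2) - ln 2) = ln (pi / 2)" using LIMSEQ_unique by blast
  then have L2: "L = ln (2 * pi) / 2" by (simp add: ln_div ln_mult)
  show ?thesis using L unfolding L2 .
qed

section \<open>The logarithm of the generating function near the origin\<close>

definition exp_quotient :: "complex \<Rightarrow> complex" where
  "exp_quotient z = (if z = 0 then 1 else (1 - exp (- z)) / z)"

lemma holomorphic_exp_quotient: "exp_quotient holomorphic_on UNIV"
proof -
  have "((\<lambda>z::complex. 1 - exp (- z)) has_field_derivative 1) (at 0)"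
    by (auto intro!: derivative_eq_intros)
  then have "(\<lambda>z::complex. (1 - exp (- z)) / z) \<midarrow>0\<rightarrow> 1"
    by (simp add: has_field_derivative_iff)
  then have "(\<lambda>z. if z = 0 then 1 else (1 - exp (- z)) / z) holomorphic_on UNIV"
    by (intro removable_singularity holomorphic_intros) auto
  then show ?thesis by (simp add: exp_quotient_def[abs_def])
qed

text \<open>The branch of $-\log((1-e^{-z})/z)$ that is regular at the origin.\<close>

definition regular_euler_log :: "complex \<Rightarrow> complex" where
  "regular_euler_log z = - Ln (exp_quotient z)"

lemma regular_euler_log_0 [simp]: "regular_euler_log 0 = 0"
  by (simp add: regular_euler_log_def exp_quotient_def)

text \<open>Both 1 - exp (- z) and z have arguments strictly between -pi/2 and pi/2, so the
  difference of their logarithms has imaginary part strictly between -pi and pi and is the principal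
  logarithm of the quotient. In particular the quotient avoids the cut.\<close>

lemma regular_euler_log_right_halfplane:
  assumes "Re z > 0"
  shows "exp_quotient z \<notin> \<real>\<^sub>\<le>\<^sub>0" and "regular_euler_log z = euler_log z + Ln z"
proof -
  have z: "z \<noteq> 0" using assms by auto
  have "norm (exp (- z)) < 1" using assms by simp
  then have "Re (exp (- z)) < 1" using complex_Re_le_cmod[of "exp (- z)"] by linarith
  then have "Re (1 - exp (- z)) > 0" by simp
  then have 1: "1 - exp (- z) \<noteq> 0" "\<bar>Im (Ln (1 - exp (- z)))\<bar> < pi / 2"
    using Re_Ln_pos_lt_imp[of "1 - exp (- z)"] by auto
  define u where "u = Ln (1 - exp (- z)) - Ln z"
  have "\<bar>Im (Ln z)\<bar> < pi / 2" using assms Re_Ln_pos_lt_imp by blast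
  then have u: "- pi < Im u" "Im u < pi" using 1(2) by (auto simp: u_def)
  have e: "exp u = exp_quotient z" using 1(1) z by (simp add: u_def exp_diff exp_quotient_def)
  have Ln: "Ln (exp_quotient z) = u" using u by (simp add: e[symmetric])
  show "exp_quotient z \<notin> \<real>\<^sub>\<le>\<^sub>0"
  proof
    assume "exp_quotient z \<in> \<real>\<^sub>\<le>\<^sub>0"
    moreover have "exp_quotient z \<noteq> 0" by (metis e exp_not_eq_zero)
    ultimately have "Im (Ln (exp_quotient z)) = pi"
      by (subst Im_Ln_eq_pi) (auto simp: complex_nonpos_Reals_iff complex_eq_iff)
    then show False using u Ln by simp
  qed
  show "regular_euler_log z = euler_log z + Ln z"
    unfolding regular_euler_log_def Ln by (simp add: u_def euler_log_def)
qed

text \<open>A sector around the positive axis, described as the union of the discs about x of radius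
  \<tau> x. In this form it is visibly open and stable under positive scaling and addition, and a
  narrower cone leaves room for discs of radius proportional to |y|.\<close>

definition sector_cone :: "real \<Rightarrow> complex set" where
  "sector_cone \<tau> = {y. \<exists>x>0. norm (y - of_real x) < \<tau> * x}"

lemma open_sector_cone: "open (sector_cone \<tau>)"
proof -
  have "sector_cone \<tau> = (\<Union>x\<in>{0<..}. ball (of_real x) (\<tau> * x))"
    by (auto simp: sector_cone_def dist_norm norm_minus_commute)
  then show ?thesis by auto
qed

lemma cone_scale: "y \<in> sector_cone \<tau> \<Longrightarrow> t > 0 \<Longrightarrow> of_real t * y \<in> sector_cone \<tau>"
proof -
  assume "y \<in> sector_cone \<tau>" and t: "t > 0"
  then obtain x where x: "x > 0" "norm (y - of_real x) < \<tau> * x" by (auto simp: sector_cone_def)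
  have "norm (of_real t * y - of_real (t * x)) = t * norm (y - of_real x)"
  proof -
    have "of_real t * y - of_real (t * x) = of_real t * (y - of_real x)" by (simp add: algebra_simps)
    then show ?thesis using t by (simp only: norm_mult norm_of_real abs_of_pos)
  qed
  also have "\<dots> < t * (\<tau> * x)" using t x by simp
  finally show "of_real t * y \<in> sector_cone \<tau>" using t x unfolding sector_cone_def
    by (auto intro!: exI[of _ "t * x"] simp: algebra_simps)
qed

lemma cone_add:
  assumes "y \<in> sector_cone \<tau>" "y' \<in> sector_cone \<tau>" shows "y + y' \<in> sector_cone \<tau>"
proof -
  obtain x x' where x: "x > 0" "norm (y - of_real x) < \<tau> * x" "x' > 0" "norm (y' - of_real x') < \<tau> * x'"
    using assms by (auto simp: sector_cone_def)
  have "norm (y + y' - of_real (x + x')) = norm ((y - of_real x) + (y' - of_real x'))" by (simp add: algebra_simps)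
  also have "\<dots> \<le> norm (y - of_real x) + norm (y' - of_real x')" by (rule norm_triangle_ineq)
  also have "\<dots> < \<tau> * (x + x')" using x by (simp add: algebra_simps)
  finally show ?thesis using x unfolding sector_cone_def by (auto intro!: exI[of _ "x + x'"])
qed

lemma of_real_in_cone: "x > 0 \<Longrightarrow> \<tau> > 0 \<Longrightarrow> of_real x \<in> sector_cone \<tau>"
  by (auto simp: sector_cone_def intro!: exI[of _ x])

lemma convex_sector_cone: "convex (sector_cone \<tau>)"
proof (rule convexI)
  fix x y u v assume *: "x \<in> sector_cone \<tau>" "y \<in> sector_cone \<tau>" "0 \<le> u" "0 \<le> v" "u + v = (1::real)"
  show "u *\<^sub>R x + v *\<^sub>R y \<in> sector_cone \<tau>"
  proof (cases "u = 0 \<or> v = 0")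
    case False
    then show ?thesis using * by (auto simp: scaleR_conv_of_real intro!: cone_add cone_scale)
  qed (use * in auto)
qed

text \<open>The numbers \<tau> and r collect smallness conditions. In the cone, y^k stays in the
  right half-plane and k Ln y stays in the principal strip; in the disc of radius r,
  \<open>exp_quotient\<close> stays in the right half-plane, so that its principal logarithm is
  holomorphic.\<close>

locale log_cone =
  fixes k :: nat and \<tau> r :: real
  assumes k: "k \<ge> 2" and \<tau>: "0 < \<tau>" "\<tau> < 1 / 2"
    and Ln_bound: "\<And>v. norm v < \<tau> \<Longrightarrow> norm (Ln (1 + v)) < 1 / real k"
    and power_bound: "\<And>v::complex. norm v < \<tau> \<Longrightarrow> norm ((1 + v) ^ k - 1) < 1 / 2"
    and r: "0 < r" "r \<le> 1" and exp_quotient_near: "\<And>z. norm z < r \<Longrightarrow> norm (exp_quotient z - 1) < 1"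
begin

lemma cone_decompose:
  assumes "y \<in> sector_cone \<tau>"
  obtains x v where "x > 0" "norm v < \<tau>" "y = of_real x * (1 + v)" "norm y < 2 * x" "x / 2 < norm y"
proof -
  from assms obtain x where x: "x > 0" "norm (y - of_real x) < \<tau> * x" by (auto simp: sector_cone_def)
  define v where "v = (y - of_real x) / of_real x"
  have v: "norm v < \<tau>" using x by (simp add: v_def norm_divide field_simps)
  have y: "y = of_real x * (1 + v)" using x by (simp add: v_def field_simps)
  have "norm y = x * norm (1 + v)" using x by (simp add: y norm_mult)
  moreover have "norm (1 + v) < 3 / 2" using norm_triangle_ineq[of 1 v] v \<tau> by simp
  moreover have "norm (1 + v) > 1 / 2" using norm_triangle_ineq4[of "1 + v" v] v \<tau> by simp
  ultimately show ?thesis using that[OF x(1) v y] x by auto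
qed

lemma cone_power:
  assumes "y \<in> sector_cone \<tau>"
  shows "Re (y ^ k) \<ge> norm y ^ k / 3" and "Re (y ^ k) > 0" and "Ln (y ^ k) = of_nat k * Ln y"
    and "norm (Ln y) \<le> \<bar>ln (norm y)\<bar> + 1" and "y \<noteq> 0"
proof -
  obtain x v where xv: "x > 0" "norm v < \<tau>" "y = of_real x * (1 + v)" "norm y < 2 * x" "x / 2 < norm y"
    using cone_decompose[OF assms] .
  note pb = power_bound[OF xv(2)] and lb = Ln_bound[OF xv(2)]
  \<comment> \<open>The factor 1/3 is the lower bound 1/2 for the real part of (1 + v)^k divided by
    the upper bound 3/2 for its modulus.\<close>
  have "Re ((1 + v) ^ k) > 1 / 2"
    using pb abs_Re_le_cmod[of "(1 + v) ^ k - 1"] by simp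
  moreover have "norm ((1 + v) ^ k) < 3 / 2"
    using pb norm_triangle_ineq[of "(1 + v) ^ k - 1" 1] by simp
  moreover have "Re (y ^ k) = x ^ k * Re ((1 + v) ^ k)"
    unfolding xv(3) power_mult_distrib of_real_power[symmetric] by simp
  moreover have "norm y ^ k = x ^ k * norm ((1 + v) ^ k)"
    using xv(1) by (simp add: xv(3) norm_mult norm_power power_mult_distrib)
  moreover have "x ^ k > 0" using xv(1) by simp
  ultimately show 1: "Re (y ^ k) \<ge> norm y ^ k / 3" and "Re (y ^ k) > 0"
    by (simp_all add: algebra_simps)
  show y: "y \<noteq> 0" using xv by auto
  have v1: "1 + v \<noteq> 0" using y xv by auto
  have Lny: "Ln y = of_real (ln x) + Ln (1 + v)"
    using xv(1) v1 by (simp add: xv(3) Ln_times_of_real Ln_of_real)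
  then have im: "\<bar>Im (Ln y)\<bar> < 1 / real k" using lb abs_Im_le_cmod[of "Ln (1 + v)"] by simp
  then have "real k * \<bar>Im (Ln y)\<bar> < 1" using k by (simp add: field_simps)
  then have "\<bar>Im (of_nat k * Ln y)\<bar> < pi" using pi_gt3 by (simp add: abs_mult)
  then have "Ln (exp (of_nat k * Ln y)) = of_nat k * Ln y" by (intro Ln_exp) auto
  moreover have "exp (of_nat k * Ln y) = y ^ k" using y by (simp add: exp_of_nat_mult)
  ultimately show "Ln (y ^ k) = of_nat k * Ln y" by simp
  have "norm (Ln y) \<le> \<bar>Re (Ln y)\<bar> + \<bar>Im (Ln y)\<bar>" by (rule cmod_le)
  also have "\<bar>Im (Ln y)\<bar> \<le> 1" 
  proof -
    have "1 / real k \<le> 1" using k by simp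
    then show ?thesis using im by linarith
  qed
  finally show "norm (Ln y) \<le> \<bar>ln (norm y)\<bar> + 1" using y by (simp add: Re_Ln)
qed

text \<open>The function that is summed by Euler--Maclaurin: on the cone it equals -log(1 - exp (-
  y^k)) + k Ln y, and unlike the first term alone it is regular at 0.\<close>

definition lam :: "complex \<Rightarrow> complex" where "lam y = regular_euler_log (y ^ k)"

text \<open>The disc makes the starting point 0 of the summation an interior point.\<close>

definition lam_domain :: "complex set" where "lam_domain = sector_cone \<tau> \<union> ball 0 r"

lemma open_lam_domain: "open lam_domain"
  unfolding lam_domain_def by (intro open_Un open_sector_cone open_ball)

lemma norm_power_less_r: "norm (y::complex) < r \<Longrightarrow> norm (y ^ k) < r"
proof -
  assume y: "norm y < r"
  have "norm y ^ k \<le> norm y" using y r k power_decreasing[of 1 k "norm y"] by simp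
  then show ?thesis using y by (simp add: norm_power)
qed

lemma exp_quotient_dom: "y \<in> lam_domain \<Longrightarrow> exp_quotient (y ^ k) \<notin> \<real>\<^sub>\<le>\<^sub>0"
proof -
  assume "y \<in> lam_domain"
  then consider "y \<in> sector_cone \<tau>" | "norm y < r" by (auto simp: lam_domain_def)
  then show ?thesis
  proof cases
    case 2
    then have "norm (exp_quotient (y ^ k) - 1) < 1" by (intro exp_quotient_near norm_power_less_r)
    then have "Re (exp_quotient (y ^ k)) > 0"
      using abs_Re_le_cmod[of "exp_quotient (y ^ k) - 1"] by simp
    then show ?thesis by (auto simp: complex_nonpos_Reals_iff)
  qed (intro regular_euler_log_right_halfplane cone_power)
qed

lemma holomorphic_lam: "lam holomorphic_on lam_domain"
proof -
  have "(exp_quotient \<circ> (\<lambda>y. y ^ k)) holomorphic_on lam_domain"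
    by (intro holomorphic_on_compose holomorphic_intros holomorphic_on_subset[OF holomorphic_exp_quotient]) auto
  then show ?thesis unfolding lam_def[abs_def] regular_euler_log_def
    by (intro holomorphic_intros exp_quotient_dom) (auto simp: o_def)
qed

lemma lam_0: "lam 0 = 0" using k by (simp add: lam_def power_0_left)

lemma lam_cone: "y \<in> sector_cone \<tau> \<Longrightarrow> lam y = euler_log (y ^ k) + of_nat k * Ln y"
  unfolding lam_def by (subst regular_euler_log_right_halfplane) (simp_all add: cone_power)

text \<open>With t = Re (y^k) the modulus is at most 1 / (exp t - 1). Here exp t - 1 exceeds both t
  and t^2 / 2, and t is at least |y|^k / 3.\<close>

lemma norm_euler_log_power_le:
  assumes "y \<in> sector_cone \<tau>"
  shows "norm (euler_log (y ^ k)) \<le> 6 / norm y ^ k" and "norm (euler_log (y ^ k)) \<le> 18 / norm y ^ (2 * k)"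
proof -
  define t where "t = Re (y ^ k)"
  have t: "t > 0" "t \<ge> norm y ^ k / 3" using cone_power[OF assms] by (auto simp: t_def)
  have ny: "norm y > 0" using cone_power[OF assms] by simp
  have "norm (euler_log (y ^ k)) \<le> exp (- t) / (1 - exp (- t))"
    using norm_euler_log_le[of "y ^ k"] minus_ln_one_minus_exp_le[of t] t(1) by (simp add: t_def)
  also have "\<dots> = 1 / (exp t - 1)" using t(1) by (simp add: exp_minus field_simps)
  finally have *: "norm (euler_log (y ^ k)) \<le> 1 / (exp t - 1)" .
  have "exp t \<ge> 1 + t + t^2 / 2" using exp_lower_Taylor_quadratic[of t] t by simp
  then have "t \<le> exp t - 1" "t^2 / 2 \<le> exp t - 1" using t zero_le_power2[of t] by linarith+
  moreover have "t^2 / 2 > 0" using t by simp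
  ultimately have "1 / (exp t - 1) \<le> 1 / t" "1 / (exp t - 1) \<le> 1 / (t^2 / 2)"
    using t(1) by (blast intro: frac_le[OF zero_le_one order_refl])+
  moreover have "1 / t \<le> 1 / (norm y ^ k / 3)" using t ny by (intro divide_left_mono mult_pos_pos) auto
  moreover have "1 / (t^2 / 2) \<le> 1 / ((norm y ^ k / 3)^2 / 2)"
    using t ny by (intro divide_left_mono mult_pos_pos divide_right_mono power_mono) auto
  moreover have "1 / ((norm y ^ k / 3)^2 / 2) = 18 / norm y ^ (2 * k)"
    by (simp add: power_divide power_mult[symmetric] mult.commute)
  moreover have "1 / (norm y ^ k / 3) \<le> 6 / norm y ^ k" using ny by (simp add: divide_right_mono)
  ultimately show "norm (euler_log (y ^ k)) \<le> 6 / norm y ^ k" "norm (euler_log (y ^ k)) \<le> 18 / norm y ^ (2 * k)"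
    using * by linarith+
qed

text \<open>\<open>regular_euler_log\<close> is holomorphic near 0 and vanishes there, so a bound on
  its derivative gives a linear bound; inserting y^k turns it into a zero of order at least
  k.\<close>

lemma lam_near_0: "\<exists>C>0. \<forall>y. norm y \<le> r / 2 \<longrightarrow> norm (lam y) \<le> C * norm y ^ k"
proof -
  have hol: "regular_euler_log holomorphic_on ball 0 r"
    unfolding regular_euler_log_def[abs_def]
  proof (intro holomorphic_intros)
    show "exp_quotient holomorphic_on ball 0 r" by (rule holomorphic_on_subset[OF holomorphic_exp_quotient]) auto
    fix z :: complex assume "z \<in> ball 0 r"
    then have "norm (exp_quotient z - 1) < 1" by (intro exp_quotient_near) auto
    then have "Re (exp_quotient z) > 0"
      using abs_Re_le_cmod[of "exp_quotient z - 1"] by simp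
    then show "exp_quotient z \<notin> \<real>\<^sub>\<le>\<^sub>0" by (auto simp: complex_nonpos_Reals_iff)
  qed
  have sub: "cball 0 (r / 2) \<subseteq> ball 0 r" using r by (auto simp: cball_subset_ball_iff)
  have "continuous_on (cball 0 (r / 2)) (deriv regular_euler_log)"
    by (rule continuous_on_subset[OF holomorphic_on_imp_continuous_on[OF holomorphic_deriv[OF hol]] sub]) auto
  then have "compact (deriv regular_euler_log ` cball 0 (r / 2))" by (intro compact_continuous_image) auto
  then have "bounded (deriv regular_euler_log ` cball 0 (r / 2))" by (rule compact_imp_bounded)
  then obtain B where B: "B > 0" "\<And>z. z \<in> cball 0 (r / 2) \<Longrightarrow> norm (deriv regular_euler_log z) \<le> B"
    unfolding bounded_pos by blast
  have le: "norm (regular_euler_log z) \<le> B * norm z" if "z \<in> cball 0 (r / 2)" for z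
  proof -
    have "norm (regular_euler_log z - regular_euler_log 0) \<le> B * norm (z - 0)"
    proof (rule field_differentiable_bound[of "cball 0 (r / 2)"])
      show "(regular_euler_log has_field_derivative deriv regular_euler_log u) (at u within cball 0 (r / 2))"
        if "u \<in> cball 0 (r / 2)" for u
        using that sub by (auto intro!: has_field_derivative_at_within[OF holomorphic_derivI[OF hol]])
      show "norm (deriv regular_euler_log u) \<le> B" if "u \<in> cball 0 (r / 2)" for u
        using B(2) that .
      show "0 \<in> cball (0::complex) (r / 2)" using r by simp
    qed (use that in simp_all)
    then show ?thesis by simp
  qed
  have bd: "norm (lam y) \<le> B * norm y ^ k" if "norm y \<le> r / 2" for y
  proof -
    have "norm y ^ k \<le> norm y" using power_decreasing[of 1 k "norm y"] that r k by simp
    then have "norm (y ^ k) \<le> r / 2" unfolding norm_power using that by linarith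
    then have "y ^ k \<in> cball 0 (r / 2)" by simp
    from le[OF this] show ?thesis unfolding lam_def norm_power .
  qed
  show ?thesis by (intro exI[of _ B] conjI allI impI B(1) bd)
qed

text \<open>At infinity \<open>lam\<close> grows like k log |y|. The square root is a cruder bound
  that changes only by a bounded factor on discs of radius proportional to |y|, and one derivative
  already makes it decay.\<close>

lemma lam_growth: "\<exists>C>0. \<forall>y\<in>sector_cone \<tau>. norm (lam y) \<le> C * (1 + sqrt (norm y))"
proof -
  obtain C0 where C0: "C0 > 0" "\<And>y. norm y \<le> r / 2 \<Longrightarrow> norm (lam y) \<le> C0 * norm y ^ k"
    using lam_near_0 by auto
  define D where "D = 6 / (r / 2) ^ k + real k * (\<bar>ln (r / 2)\<bar> + 3)"
  have D: "D > 0" unfolding D_def using r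
    by (intro add_pos_nonneg divide_pos_pos mult_nonneg_nonneg add_nonneg_nonneg abs_ge_zero) auto
  have bd: "norm (lam y) \<le> (C0 + D) * (1 + sqrt (norm y))" if y: "y \<in> sector_cone \<tau>" for y
  proof (cases "norm y \<le> r / 2")
    case True
    then have "norm y ^ k \<le> 1" using r by (intro power_le_one) auto
    then have "norm (lam y) \<le> C0 * 1" 
      using C0(2)[OF True] mult_left_mono[of "norm y ^ k" 1 C0] C0(1) by linarith
    also have "\<dots> \<le> (C0 + D) * (1 + sqrt (norm y))" using C0 D by (intro mult_mono) auto
    finally show ?thesis .
  next
    case False
    have y0: "norm y > 0" using cone_power(5)[OF y] by simp
    have "norm (lam y) \<le> norm (euler_log (y ^ k)) + norm (of_nat k * Ln y)"
      unfolding lam_cone[OF y] by (rule norm_triangle_ineq)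
    also have "norm (of_nat k * Ln y) \<le> real k * (\<bar>ln (norm y)\<bar> + 1)"
      using cone_power(4)[OF y] by (simp add: norm_mult mult_left_mono)
    also have "norm (euler_log (y ^ k)) \<le> 6 / (r / 2) ^ k"
    proof -
      have "(r / 2) ^ k \<le> norm y ^ k" using False r by (intro power_mono) auto
      then have "6 / norm y ^ k \<le> 6 / (r / 2) ^ k" using r y0 by (intro divide_left_mono mult_pos_pos) auto
      then show ?thesis using norm_euler_log_power_le(1)[OF y] by linarith
    qed
    also have "\<bar>ln (norm y)\<bar> \<le> \<bar>ln (r / 2)\<bar> + 2 * sqrt (norm y)"
    proof (cases "norm y \<ge> 1")
      case True
      have "ln (norm y) = 2 * ln (sqrt (norm y))" using y0 by (simp add: ln_sqrt)
      moreover have "ln (sqrt (norm y)) \<le> sqrt (norm y) - 1" using y0 by (intro ln_le_minus_one) simp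
      ultimately show ?thesis using ln_ge_zero[OF True] by linarith
    next
      case False2: False
      have "ln (r / 2) \<le> ln (norm y)" using False r y0 by (subst ln_le_cancel_iff) auto
      moreover have "ln (norm y) \<le> 0" using False2 y0 by simp
      ultimately show ?thesis using real_sqrt_ge_zero[OF norm_ge_zero[of y]] by linarith
    qed
    finally have "norm (lam y) \<le> 6 / (r / 2) ^ k + real k * (\<bar>ln (r / 2)\<bar> + 2 * sqrt (norm y) + 1)"
      by (simp add: mult_left_mono add.commute)
    also have "\<dots> \<le> D * (1 + sqrt (norm y))"
    proof -
      define A where "A = 6 / (r / 2) ^ k"
      define B where "B = \<bar>ln (r / 2)\<bar>"
      have "0 \<le> A" "0 \<le> B" using r by (auto simp: A_def B_def)
      then have "0 \<le> sqrt (norm y) * A" "0 \<le> sqrt (norm y) * (real k * B)" "0 \<le> sqrt (norm y) * real k" by auto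
      then show ?thesis unfolding D_def A_def[symmetric] B_def[symmetric] by (simp add: algebra_simps)
    qed
    also have "\<dots> \<le> (C0 + D) * (1 + sqrt (norm y))" using C0 by (intro mult_right_mono) auto
    finally show ?thesis .
  qed
  then show ?thesis using C0 D by (intro exI[of _ "C0 + D"]) auto
qed

lemma cone_half_subset: "sector_cone (\<tau> / 2) \<subseteq> sector_cone \<tau>"
proof
  fix y assume "y \<in> sector_cone (\<tau> / 2)"
  then obtain x where "x > 0" "norm (y - of_real x) < \<tau> / 2 * x" by (auto simp: sector_cone_def)
  moreover have "\<tau> / 2 * x \<le> \<tau> * x" using \<tau> \<open>x > 0\<close> by simp
  ultimately show "y \<in> sector_cone \<tau>" unfolding sector_cone_def by force
qed

text \<open>Cauchy's inequality on a disc around y of radius \<tau> x / 4. This radius is comparable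
  to |y|, and since y lies in the cone of half the aperture, the disc stays where the growth bound
  holds.\<close>

lemma higher_deriv_lam_far:
  "\<exists>C>0. \<forall>y\<in>sector_cone (\<tau> / 2). norm ((deriv ^^ j) lam y) \<le> C * (1 + sqrt (norm y)) / norm y ^ j"
proof -
  obtain C0 where C0: "C0 > 0" "\<And>y. y \<in> sector_cone \<tau> \<Longrightarrow> norm (lam y) \<le> C0 * (1 + sqrt (norm y))"
    using lam_growth by auto
  define C where "C = fact j * (C0 * 2) * (8 / \<tau>) ^ j"
  have bd: "norm ((deriv ^^ j) lam y) \<le> C * (1 + sqrt (norm y)) / norm y ^ j" if y: "y \<in> sector_cone (\<tau> / 2)" for y
  proof -
    have yc: "y \<in> sector_cone \<tau>" using y cone_half_subset by blast
    obtain x where x: "x > 0" "norm (y - of_real x) < \<tau> / 2 * x" using y by (auto simp: sector_cone_def)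
    have ny: "norm y > 0" using cone_power(5)[OF yc] by simp
    have xy: "norm y < 2 * x" "x < 2 * norm y"
    proof -
      have "\<tau> / 2 * x < x / 4" using \<tau> x by simp
      then have *: "norm (y - of_real x) < x / 4" using x by linarith
      show "norm y < 2 * x" using * norm_triangle_ineq[of "y - of_real x" "of_real x"] x by simp
      show "x < 2 * norm y" using * norm_triangle_ineq4[of y "y - of_real x"] x by simp
    qed
    define \<rho> where "\<rho> = \<tau> * x / 4"
    have \<rho>: "\<rho> > 0" using \<tau> x by (simp add: \<rho>_def)
    have sub: "cball y \<rho> \<subseteq> sector_cone \<tau>"
    proof
      fix u assume "u \<in> cball y \<rho>"
      then have "norm (u - y) \<le> \<tau> * x / 4" by (simp add: \<rho>_def dist_norm norm_minus_commute)
      then have "norm (u - of_real x) < \<tau> * x"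
      proof -
        have "\<tau> * x > 0" using \<tau> x by simp
        then show ?thesis
          using norm_triangle_ineq[of "u - y" "y - of_real x"] x(2) \<open>norm (u - y) \<le> \<tau> * x / 4\<close> by simp
      qed
      then show "u \<in> sector_cone \<tau>" using x by (auto simp: sector_cone_def)
    qed
    have subd: "cball y \<rho> \<subseteq> lam_domain" using sub by (auto simp: lam_domain_def)
    have "norm ((deriv ^^ j) lam y) \<le> fact j * (C0 * 2 * (1 + sqrt (norm y))) / \<rho> ^ j"
    proof (rule Cauchy_inequality)
      show "lam holomorphic_on ball y \<rho>" using holomorphic_lam subd ball_subset_cball holomorphic_on_subset by (metis subset_trans)
      show "continuous_on (cball y \<rho>) lam" using holomorphic_lam subd holomorphic_on_imp_continuous_on holomorphic_on_subset by metis
      fix u assume u: "norm (y - u) = \<rho>"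
      then have uc: "u \<in> sector_cone \<tau>" using sub by (auto simp: dist_norm)
      have "norm u \<le> norm y + \<rho>" using u norm_triangle_ineq2[of u y] by (simp add: norm_minus_commute)
      also have "\<rho> \<le> norm y"
      proof -
        have "\<tau> * x \<le> 1 * x" using \<tau> x by (intro mult_right_mono) auto
        then show ?thesis using xy x unfolding \<rho>_def by linarith
      qed
      finally have "norm u \<le> 4 * norm y" using norm_ge_zero[of y] by linarith
      then have "sqrt (norm u) \<le> sqrt (4 * norm y)" by simp
      then have "sqrt (norm u) \<le> 2 * sqrt (norm y)" by (simp add: real_sqrt_mult)
      then have "1 + sqrt (norm u) \<le> 2 * (1 + sqrt (norm y))" by simp
      then show "norm (lam u) \<le> C0 * 2 * (1 + sqrt (norm y))"
        using order_trans[OF C0(2)[OF uc] mult_left_mono] C0(1) by (simp add: mult.assoc)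
    qed (rule \<rho>)
    also have "\<dots> \<le> fact j * (C0 * 2 * (1 + sqrt (norm y))) / (\<tau> / 8 * norm y) ^ j"
    proof (intro divide_left_mono power_mono mult_pos_pos zero_less_power \<rho>)
      show "\<tau> / 8 * norm y \<le> \<rho>" using xy \<tau> by (simp add: \<rho>_def mult_left_mono)
    qed (use C0 \<tau> ny in auto)
    also have "\<dots> = C * (1 + sqrt (norm y)) / norm y ^ j"
      using \<tau> by (simp add: C_def power_mult_distrib power_divide mult_ac)
    finally show ?thesis .
  qed
  then show ?thesis using C0 \<tau> by (intro exI[of _ C]) (auto simp: C_def)
qed

text \<open>Cauchy's inequality on circles of radius \<rho> gives O(\<rho>^(k-j)), which tends to 0.
  Among the boundary terms at 0 in the Euler--Maclaurin formula only the one of order k survives,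
  and it has size |a|^k.\<close>

lemma higher_deriv_lam_0:
  assumes "j < k" shows "(deriv ^^ j) lam 0 = 0"
proof -
  obtain C where C: "C > 0" "\<And>y. norm y \<le> r / 2 \<Longrightarrow> norm (lam y) \<le> C * norm y ^ k"
    using lam_near_0 by auto
  have bd: "norm ((deriv ^^ j) lam 0) \<le> (fact j * C) * \<rho> ^ (k - j)" if \<rho>: "0 < \<rho>" "\<rho> < r / 2" for \<rho>
  proof -
    have sub: "cball 0 \<rho> \<subseteq> lam_domain" using \<rho> r by (auto simp: lam_domain_def)
    have "norm ((deriv ^^ j) lam 0) \<le> fact j * (C * \<rho> ^ k) / \<rho> ^ j"
    proof (rule Cauchy_inequality)
      show "lam holomorphic_on ball 0 \<rho>" using holomorphic_lam sub ball_subset_cball holomorphic_on_subset by (metis subset_trans)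
      show "continuous_on (cball 0 \<rho>) lam" using holomorphic_lam sub holomorphic_on_imp_continuous_on holomorphic_on_subset by metis
      fix u :: complex assume "norm (0 - u) = \<rho>"
      then show "norm (lam u) \<le> C * \<rho> ^ k" using C(2)[of u] \<rho> by simp
    qed (use \<rho> in simp)
    also have "\<dots> = (fact j * C) * \<rho> ^ (k - j)" using \<rho> assms by (simp add: power_diff)
    finally show ?thesis .
  qed
  have "((\<lambda>\<rho>. (fact j * C) * \<rho> ^ (k - j)) \<longlongrightarrow> (fact j * C) * 0 ^ (k - j)) (at_right (0::real))"
    by (intro tendsto_intros)
  then have lim: "((\<lambda>\<rho>. (fact j * C) * \<rho> ^ (k - j)) \<longlongrightarrow> 0) (at_right (0::real))" using assms by (simp add: power_0_left)
  have "norm ((deriv ^^ j) lam 0) \<le> 0"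
  proof (rule tendsto_lowerbound[OF lim])
    have "eventually (\<lambda>\<rho>::real. \<rho> \<in> {0<..<r / 2}) (at_right 0)" using r by (intro eventually_at_right_real) auto
    then show "\<forall>\<^sub>F \<rho> in at_right 0. norm ((deriv ^^ j) lam 0) \<le> (fact j * C) * \<rho> ^ (k - j)"
      by eventually_elim (use bd in auto)
  qed simp
  then show ?thesis by simp
qed

text \<open>The majorant 1 / (1 + |y|^2) has an arctangent as its integral along a ray, hence a
  bound independent of the length. Near 0 it comes from compactness; far out the derivative of order
  k + 1 is O(|y|^(-k-1/2)), and k is at least 2.\<close>

lemma higher_deriv_lam_integrable_bound:
  "\<exists>C>0. \<forall>y\<in>sector_cone (\<tau> / 2) \<union> {0}. norm ((deriv ^^ (Suc k)) lam y) \<le> C / (1 + norm y ^ 2)"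
proof -
  obtain C1 where C1: "C1 > 0"
    "\<And>y. y \<in> sector_cone (\<tau> / 2) \<Longrightarrow> norm ((deriv ^^ Suc k) lam y) \<le> C1 * (1 + sqrt (norm y)) / norm y ^ Suc k"
    using higher_deriv_lam_far[of "Suc k"] by (auto simp del: funpow.simps)
  have "continuous_on (cball 0 (r / 2)) ((deriv ^^ Suc k) lam)"
  proof (rule continuous_on_subset)
    show "continuous_on lam_domain ((deriv ^^ Suc k) lam)"
      by (intro holomorphic_on_imp_continuous_on holomorphic_higher_deriv holomorphic_lam open_lam_domain)
    show "cball 0 (r / 2) \<subseteq> lam_domain" using r by (auto simp: lam_domain_def)
  qed
  then have "compact ((deriv ^^ Suc k) lam ` cball 0 (r / 2))" by (intro compact_continuous_image) auto
  then obtain B where B: "B > 0" "\<And>y. y \<in> cball 0 (r / 2) \<Longrightarrow> norm ((deriv ^^ Suc k) lam y) \<le> B"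
    by (auto dest!: compact_imp_bounded simp: bounded_pos simp del: funpow.simps)
  define D where "D = 2 * C1 * (2 / r) ^ Suc k"
  have D: "D > 0" using C1 r by (simp add: D_def)
  have bd: "norm ((deriv ^^ Suc k) lam y) \<le> (2 * B + 8 * D) / (1 + norm y ^ 2)" if y: "y \<in> sector_cone (\<tau> / 2) \<union> {0}" for y
  proof (cases "norm y \<le> r / 2")
    case True
    then have "norm y ^ 2 \<le> 1" using r by (intro power_le_one) auto
    then have "B * (1 + norm y ^ 2) \<le> B * 2" using B by (intro mult_left_mono) auto
    then have "B * (1 + norm y ^ 2) \<le> 2 * B + 8 * D" using D by linarith
    moreover have "1 + norm y ^ 2 > 0" by (simp add: add_pos_nonneg)
    ultimately have "B \<le> (2 * B + 8 * D) / (1 + norm y ^ 2)" by (simp add: pos_le_divide_eq)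
    then show ?thesis using B(2)[of y] True by simp
  next
    case False
    then have yc: "y \<in> sector_cone (\<tau> / 2)" using y r by auto
    define s where "s = norm y"
    have s: "s > r / 2" "s > 0" using False r by (auto simp: s_def)
    \<comment> \<open>Rescaling by r/2 makes u at least 1, so that powers of u grow with the
      exponent and 1 + sqrt s and 1 + s^2 are bounded by 2 u and 2 u^2.\<close>
    define u where "u = s / (r / 2)"
    have u: "u \<ge> 1" "s = u * (r / 2)" using s r by (auto simp: u_def)
    have "u * (r / 2) \<le> u * 1" using u r by (intro mult_left_mono) auto
    then have su: "s \<le> u" using u(2) by linarith
    have "u \<le> u ^ 2" using u power_increasing[of 1 2 u] by simp
    then have "s \<le> u ^ 2" using su by linarith
    then have "sqrt s \<le> u" using u(1) by (simp add: real_le_lsqrt)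
    then have "1 + sqrt s \<le> 2 * u" using u(1) by linarith
    then have "C1 * (1 + sqrt s) / s ^ Suc k \<le> C1 * (2 * u) / s ^ Suc k"
      using C1 s by (intro divide_right_mono mult_left_mono) auto
    also have "\<dots> = D / u ^ k"
    proof -
      have "s ^ Suc k = u * u ^ k * (r / 2) ^ Suc k" by (simp only: u(2) power_mult_distrib power_Suc mult_ac)
      moreover have "(2 / r) ^ Suc k = 1 / (r / 2) ^ Suc k" using r by (simp add: power_divide)
      ultimately show ?thesis using u(1) by (simp only: D_def) simp
    qed
    also have "\<dots> \<le> D / u ^ 2" using u D k by (intro divide_left_mono power_increasing mult_pos_pos) auto
    also have "\<dots> \<le> 2 * D / (1 + s ^ 2)"
    proof -
      have "s ^ 2 \<le> u ^ 2" using power_mono[OF su less_imp_le[OF s(2)]] .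
      moreover have "1 \<le> u ^ 2" using u(1) by (rule one_le_power)
      ultimately have "1 + s ^ 2 \<le> 2 * u ^ 2" by simp
      then have "D * (1 + s ^ 2) \<le> D * (2 * u ^ 2)" using D by (intro mult_left_mono) auto
      moreover have "u ^ 2 > 0" "1 + s ^ 2 > 0" using u by (auto simp: add_pos_nonneg)
      ultimately show ?thesis by (simp add: field_simps)
    qed
    also have "\<dots> \<le> (2 * B + 8 * D) / (1 + s ^ 2)" using B D by (intro divide_right_mono) (auto simp: add_nonneg_nonneg)
    finally show ?thesis using C1(2)[OF yc] unfolding s_def by linarith
  qed
  show ?thesis by (intro exI[of _ "2 * B + 8 * D"] conjI ballI bd) (use B D in simp_all)
qed

end

section \<open>The integral of the summand over the positive half-line\<close>

lemma exp_power_integral: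
  assumes k: "k > 0" and c: "(c::real) > 0"
  shows "((\<lambda>x. exp (- (c * x ^ k))) has_integral Gamma (1 / real k) / real k * c powr (- 1 / real k)) {0<..}"
proof -
  define s where "s = 1 / real k"
  have s: "s > 0" using k by (simp add: s_def)
  define f where "f = (\<lambda>t. t powr (s - 1) / exp t)"
  define g where "g = (\<lambda>x. c * x ^ k)"
  define g' where "g' = (\<lambda>x. c * (real k * x ^ (k - 1)))"
  have img: "g ` {0<..} = {0<..}"
  proof (intro equalityI subsetI)
    fix t :: real assume "t \<in> {0<..}"
    then have t: "t > 0" by simp
    have "g ((t / c) powr s) = c * ((t / c) powr s) powr real k"
      using t c by (simp add: g_def powr_realpow)
    also have "\<dots> = t" using t c k by (simp add: powr_powr s_def)
    finally show "t \<in> g ` {0<..}" using t c by (intro image_eqI[of _ _ "(t / c) powr s"]) auto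
  qed (use c in \<open>auto simp: g_def\<close>)
  have inj: "inj_on g {0<..}"
  proof (rule inj_onI)
    fix x y assume "x \<in> {0<..}" "y \<in> {0<..}" "g x = g y"
    then show "x = y" using c k power_eq_imp_eq_base[of x k y] by (simp add: g_def)
  qed
  have fint: "(f has_integral Gamma s) {0<..}"
  proof -
    have "(f has_integral Gamma s) {0..}" unfolding f_def by (rule Gamma_integral_real[OF s])
    moreover have "negligible {x \<in> {0..} - {0<..}. f x \<noteq> 0}" "negligible {x \<in> {0<..} - {0..}. f x \<noteq> 0}"
      by (rule negligible_subset[of "{0}"], auto)+
    ultimately show ?thesis using has_integral_spike_set_eq[of "{0<..}" "{0..}" f] by blast
  qed
  have fabs: "f absolutely_integrable_on {0<..}"
    using fint by (intro nonnegative_absolutely_integrable_1) (auto simp: f_def)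
  \<comment> \<open>The substitution t = c x^k in Euler's integral for Gamma; the endpoint 0 was
    removed so that it is a smooth bijection of the open half-line.\<close>
  have "(\<lambda>x. \<bar>g' x\<bar> * f (g x)) absolutely_integrable_on {0<..} \<and> integral {0<..} (\<lambda>x. \<bar>g' x\<bar> * f (g x)) = Gamma s"
  proof (subst has_absolute_integral_change_of_variables_1'[where f = f and g = g and g' = g'])
    show "(g has_field_derivative g' x) (at x within {0<..})" for x
      unfolding g_def g'_def by (auto intro!: derivative_eq_intros)
    show "f absolutely_integrable_on g ` {0<..} \<and> integral (g ` {0<..}) f = Gamma s"
      unfolding img using fabs fint by (simp add: integral_unique)
  qed (use inj in auto)
  then have "(\<lambda>x. \<bar>g' x\<bar> * f (g x)) integrable_on {0<..}" "integral {0<..} (\<lambda>x. \<bar>g' x\<bar> * f (g x)) = Gamma s"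
    using set_lebesgue_integral_eq_integral(1) by blast+
  then have "((\<lambda>x. \<bar>g' x\<bar> * f (g x)) has_integral Gamma s) {0<..}"
    using integrable_integral by metis
  then have "((\<lambda>x. (c powr (- s) / real k) * (\<bar>g' x\<bar> * f (g x))) has_integral (c powr (- s) / real k) * Gamma s) {0<..}"
    by (rule has_integral_mult_right)
  moreover have "(c powr (- s) / real k) * (\<bar>g' x\<bar> * f (g x)) = exp (- (c * x ^ k))" if "x \<in> {0<..}" for x
  proof -
    have x: "x > 0" using that by simp
    have 1: "\<bar>g' x\<bar> = c * (real k * x ^ (k - 1))" using x c by (simp add: g'_def abs_mult)
    have "(c * x ^ k) powr (s - 1) = c powr (s - 1) * (x powr real k) powr (s - 1)"
      using x c by (simp add: powr_mult powr_realpow)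
    also have "(x powr real k) powr (s - 1) = x powr (1 - real k)"
    proof -
      have "real k * (s - 1) = 1 - real k" using k by (simp add: s_def right_diff_distrib)
      then show ?thesis by (simp only: powr_powr)
    qed
    finally have 2: "f (g x) = c powr (s - 1) * x powr (1 - real k) * exp (- (c * x ^ k))"
      by (simp add: f_def g_def exp_minus field_simps)
    have 3: "x powr (1 - real k) * x ^ (k - 1) = 1"
      using x k by (simp add: powr_realpow[symmetric] powr_add[symmetric] of_nat_diff)
    have 4: "c powr (- s) * c * c powr (s - 1) = 1"
      using c by (simp add: powr_mult_base mult.commute powr_add[symmetric] powr_diff powr_minus)
    have "(c powr (- s) / real k) * (\<bar>g' x\<bar> * f (g x))
       = (c powr (- s) * c * c powr (s - 1)) * (x powr (1 - real k) * x ^ (k - 1)) * exp (- (c * x ^ k))"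
      unfolding 1 2 using k by (simp add: field_simps)
    then show ?thesis by (simp only: 3 4 mult_1)
  qed
  ultimately have "((\<lambda>x. exp (- (c * x ^ k))) has_integral (c powr (- s) / real k) * Gamma s) {0<..}"
    by (rule has_integral_eq[rotated])
  then show ?thesis by (simp add: s_def mult.commute)
qed

definition log_gf_constant :: "nat \<Rightarrow> real" where
  "log_gf_constant k = Gamma (1 / real k) / real k * zeta_real ((real k + 1) / real k)"

text \<open>Expanding -log(1 - q) with q = exp (- x^k) gives integrals proportional to j^(-1-1/k),
  whose sum is the zeta value. All terms are positive, so monotone convergence justifies the
  interchange.\<close>

lemma euler_log_integral:
  assumes k: "k > 0"
  shows "((\<lambda>x. - ln (1 - exp (- (x ^ k)))) has_integral log_gf_constant k) {0<..}"
proof -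
  define p where "p = (real k + 1) / real k"
  define G where "G = Gamma (1 / real k) / real k"
  have p: "p > 1" using k by (simp add: p_def)
  define f where "f = (\<lambda>j (x::real). exp (- (x ^ k)) ^ Suc j / real (Suc j))"
  have fi: "(f j has_integral G * real (Suc j) powr (- p)) {0<..}" for j
  proof -
    have "((\<lambda>x. 1 / real (Suc j) * exp (- (real (Suc j) * x ^ k))) has_integral
        1 / real (Suc j) * (G * real (Suc j) powr (- 1 / real k))) {0<..}"
      unfolding G_def by (intro has_integral_mult_right exp_power_integral k) simp
    moreover have "(\<lambda>x. 1 / real (Suc j) * exp (- (real (Suc j) * x ^ k))) = f j"
      unfolding f_def exp_of_nat_mult[symmetric] by (rule ext) (simp del: of_nat_Suc)
    moreover have "1 / real (Suc j) * (G * real (Suc j) powr (- 1 / real k)) = G * real (Suc j) powr (- p)"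
    proof -
      have "- p = - 1 / real k - 1" using k by (simp add: p_def field_simps)
      then have "real (Suc j) powr (- p) = real (Suc j) powr (- 1 / real k) / real (Suc j)"
        by (simp add: powr_diff del: of_nat_Suc)
      then show ?thesis by (simp only:) simp
    qed
    ultimately show ?thesis by simp
  qed
  have sumi: "((\<lambda>x. \<Sum>j<M. f j x) has_integral (\<Sum>j<M. G * real (Suc j) powr (- p))) {0<..}" for M
    by (intro has_integral_sum fi) auto
  have lim: "(\<lambda>M. \<Sum>j<M. G * real (Suc j) powr (- p)) \<longlonglongrightarrow> log_gf_constant k"
  proof -
    have "(\<lambda>j. G * real (Suc j) powr (- p)) sums (G * zeta_real p)"
      using zeta_real_eq_suminf[OF p] by (intro sums_mult) (simp add: summable_sums)
    then show ?thesis by (simp add: sums_def log_gf_constant_def G_def p_def)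
  qed
  have 1: "(\<lambda>x::real. - ln (1 - exp (- (x ^ k)))) integrable_on {0<..} \<and>
     (\<lambda>M. integral {0<..} (\<lambda>x. \<Sum>j<M. f j x)) \<longlonglongrightarrow> integral {0<..} (\<lambda>x::real. - ln (1 - exp (- (x ^ k))))"
  proof (rule Henstock_Kurzweil_Integration.monotone_convergence_increasing)
    show "(\<lambda>x. \<Sum>j<M. f j x) integrable_on {0<..}" for M using sumi by blast
    show "(\<Sum>j<M. f j x) \<le> (\<Sum>j<Suc M. f j x)" for M x by (simp add: f_def)
    show "(\<lambda>M. \<Sum>j<M. f j x) \<longlonglongrightarrow> - ln (1 - exp (- (x ^ k)))" if "x \<in> {0<..}" for x
      using ln_one_minus_sums[of "exp (- (x ^ k))"] that by (simp add: sums_def f_def)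
    have "Bseq (\<lambda>M. \<Sum>j<M. G * real (Suc j) powr (- p))"
      using lim by (intro convergent_imp_Bseq) (auto simp: convergent_def)
    then show "bounded (range (\<lambda>M. integral {0<..} (\<lambda>x. \<Sum>j<M. f j x)))"
      unfolding integral_unique[OF sumi] by (simp only: Bseq_eq_bounded)
  qed
  have "(\<lambda>M. integral {0<..} (\<lambda>x. \<Sum>j<M. f j x)) \<longlonglongrightarrow> log_gf_constant k"
    unfolding integral_unique[OF sumi] by (rule lim)
  then have "integral {0<..} (\<lambda>x::real. - ln (1 - exp (- (x ^ k)))) = log_gf_constant k"
    by (rule LIMSEQ_unique[OF conjunct2[OF 1]])
  then show ?thesis using integrable_integral[OF conjunct1[OF 1]] by (simp only:)
qed

context log_cone
begin

lemma euler_log_of_real_power: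
  assumes "x > 0" shows "euler_log (of_real x ^ k) = of_real (- ln (1 - exp (- (x ^ k))))"
proof -
  have "exp (- (complex_of_real x ^ k)) = of_real (exp (- (x ^ k)))" by (simp add: exp_of_real[symmetric])
  then have "1 - exp (- (complex_of_real x ^ k)) = of_real (1 - exp (- (x ^ k)))" by simp
  moreover have "1 - exp (- (x ^ k)) > 0" using assms by simp
  ultimately show ?thesis by (simp only: euler_log_def Ln_of_real of_real_minus)
qed

text \<open>The union of the cone and the disc is star-shaped about 0, so a holomorphic function on
  it has a primitive.\<close>

lemma lam_primitive_exists: "\<exists>P. P 0 = 0 \<and> (\<forall>y\<in>lam_domain. (P has_field_derivative lam y) (at y))"
proof -
  have "starlike lam_domain" unfolding starlike_def
  proof (intro bexI ballI)
    show "0 \<in> lam_domain" using r by (simp add: lam_domain_def)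
    fix y assume y: "y \<in> lam_domain"
    show "closed_segment 0 y \<subseteq> lam_domain"
    proof
      fix u assume "u \<in> closed_segment 0 y"
      then obtain t where t: "0 \<le> t" "t \<le> 1" "u = of_real t * y"
        by (auto simp: in_segment scaleR_conv_of_real)
      show "u \<in> lam_domain"
      proof (cases "t = 0 \<or> norm y < r")
        case True
        then have "norm u < r"
        proof
          assume "norm y < r"
          moreover have "norm u \<le> norm y" using t by (simp add: norm_mult mult_left_le_one_le)
          ultimately show ?thesis by simp
        qed (use t r in auto)
        then show ?thesis by (simp add: lam_domain_def)
      next
        case False
        then show ?thesis using y t by (auto simp: lam_domain_def intro!: cone_scale)
      qed
    qed
  qed
  moreover have "continuous_on lam_domain lam" using holomorphic_lam by (rule holomorphic_on_imp_continuous_on)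
  ultimately obtain g where g: "\<And>y. y \<in> lam_domain \<Longrightarrow> (g has_field_derivative lam y) (at y)"
    using holomorphic_starlike_primitive[of lam_domain lam "{}"] open_lam_domain holomorphic_lam
    by (auto simp: holomorphic_on_open field_differentiable_def)
  have "((\<lambda>y. g y - g 0) has_field_derivative lam y) (at y)" if "y \<in> lam_domain" for y
    using DERIV_diff[OF g[OF that] DERIV_const[of "g 0"]] by simp
  then show ?thesis by (intro exI[of _ "\<lambda>y. g y - g 0"]) auto
qed

definition lam_primitive :: "complex \<Rightarrow> complex" where
  "lam_primitive = (SOME P. P 0 = 0 \<and> (\<forall>y\<in>lam_domain. (P has_field_derivative lam y) (at y)))"

lemma lam_primitive_0: "lam_primitive 0 = 0"
  and lam_primitive_deriv: "y \<in> lam_domain \<Longrightarrow> (lam_primitive has_field_derivative lam y) (at y)"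
  using someI_ex[OF lam_primitive_exists] unfolding lam_primitive_def by auto

text \<open>A primitive of \<open>\<lambda>y. euler_log (y ^ k)\<close>.\<close>

definition euler_primitive :: "complex \<Rightarrow> complex" where
  "euler_primitive y = lam_primitive y - of_nat k * y * Ln y + of_nat k * y"

lemma euler_primitive_deriv:
  assumes "y \<in> sector_cone \<tau>"
  shows "(euler_primitive has_field_derivative euler_log (y ^ k)) (at y)"
proof -
  obtain x v where xv: "x > 0" "norm v < \<tau>" "y = of_real x * (1 + v)" "norm y < 2 * x" "x / 2 < norm y"
    using cone_decompose[OF assms] .
  have "\<bar>Re v\<bar> < 1 / 2" using abs_Re_le_cmod[of v] xv \<tau> by linarith
  then have "Re (1 + v) > 0" by simp
  then have "Re y > 0" using xv by simp
  then have y: "y \<notin> \<real>\<^sub>\<le>\<^sub>0" "y \<noteq> 0" by (auto simp: complex_nonpos_Reals_iff)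
  have "(euler_primitive has_field_derivative (lam y - (of_nat k * y * (1 / y) + of_nat k * Ln y) + of_nat k)) (at y)"
    unfolding euler_primitive_def
    by (rule derivative_eq_intros lam_primitive_deriv refl y | use assms in \<open>simp add: lam_domain_def\<close>)+
  then show ?thesis using y by (simp add: lam_cone[OF assms])
qed

text \<open>Between 1/n and b n the increment of the primitive is the integral of the non-negative
  function -log(1 - exp (- x^k)), which converges to the integral over the half-line. At 1/n the
  primitive tends to 0, as x ln x does. The scale b will be the modulus of a.\<close>

lemma euler_primitive_real_limit:
  assumes b: "b > 0"
  shows "(\<lambda>n. euler_primitive (of_real (b * real n))) \<longlonglongrightarrow> of_real (log_gf_constant k)"
proof -
  define f where "f = (\<lambda>x::real. - ln (1 - exp (- (x ^ k))))"
  have fi: "(f has_integral log_gf_constant k) {0<..}" unfolding f_def using k by (intro euler_log_integral) auto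
  have f0: "f x \<ge> 0" if "x > 0" for x
  proof -
    have "ln (1 - exp (- (x ^ k))) \<le> 0" using that by (subst ln_le_zero_iff) auto
    then show ?thesis by (simp add: f_def)
  qed
  let ?S = "\<lambda>n. {1 / real n..b * real n}"
  have Spos: "?S n \<subseteq> {0<..}" if "n > 0" for n
  proof
    fix x assume "x \<in> ?S n"
    moreover have "1 / real n > 0" using that by simp
    ultimately show "x \<in> {0<..}" unfolding atLeastAtMost_iff greaterThan_iff by linarith
  qed
  have ftc: "((\<lambda>x. complex_of_real (f x)) has_integral
      (euler_primitive (of_real (b * real n)) - euler_primitive (of_real (1 / real n)))) (?S n)"
    if n: "n > 0" "1 / real n \<le> b * real n" for n
  proof (rule fundamental_theorem_of_calculus[OF n(2)])
    fix x assume "x \<in> ?S n"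
    moreover have "1 / real n > 0" using n by simp
    ultimately have x: "x > 0" unfolding atLeastAtMost_iff by linarith
    have "(euler_primitive has_field_derivative complex_of_real (f x)) (at (of_real x))"
      using euler_primitive_deriv[OF of_real_in_cone[OF x \<tau>(1)]] by (simp add: f_def euler_log_of_real_power x)
    then show "((\<lambda>x. euler_primitive (of_real x)) has_vector_derivative complex_of_real (f x)) (at x within ?S n)"
      by (rule has_vector_derivative_real_field[THEN has_vector_derivative_at_within])
  qed
  have ev: "\<forall>\<^sub>F n in sequentially. n > 0 \<and> 1 / real n \<le> b * real n"
  proof (intro eventually_conj eventually_gt_at_top)
    show "\<forall>\<^sub>F n in sequentially. 1 / real n \<le> b * real n" using b by real_asymp
  qed
  define h where "h = (\<lambda>n x. if x \<in> ?S n then f x else 0)"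
  have hint: "h n integrable_on {0<..}" for n
  proof (cases "n = 0")
    case False
    then have "f integrable_on ?S n"
    proof -
      have "continuous_on (?S n) f" unfolding f_def
      proof (intro continuous_intros ballI)
        fix x assume "x \<in> ?S n"
        moreover have "1 / real n > 0" using False by simp
        ultimately have "x > 0" unfolding atLeastAtMost_iff by linarith
        then show "1 - exp (- (x ^ k)) \<noteq> 0" by simp
      qed
      then show ?thesis by (rule integrable_continuous_interval)
    qed
    moreover have "?S n \<subseteq> {0<..}" using False by (intro Spos) simp
    ultimately show ?thesis unfolding h_def integrable_restrict_Int by (simp add: inf.absorb1)
  next
    case True
    have "h n x = 0" if "x \<in> {0<..}" for x using that True by (simp add: h_def)
    then show ?thesis using integrable_eq[of "\<lambda>_. 0" "{0<..}" "h n"] integrable_0 by metis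
  qed
  have hle: "h n x \<le> h (Suc n) x" if "x \<in> {0<..}" for n x
  proof (cases "x \<in> ?S n")
    case True
    then have n: "n > 0" using that by (cases n) auto
    have "1 / real (Suc n) \<le> 1 / real n" using n by (intro divide_left_mono) auto
    moreover have "b * real n \<le> b * real (Suc n)" using b by simp
    ultimately have "x \<in> ?S (Suc n)" using True unfolding atLeastAtMost_iff by linarith
    then show ?thesis using True by (simp add: h_def)
  qed (use f0 that in \<open>auto simp: h_def\<close>)
  have hlim: "(\<lambda>n. h n x) \<longlonglongrightarrow> f x" if "x \<in> {0<..}" for x
  proof (rule tendsto_eventually)
    have x: "x > 0" using that by simp
    have "\<forall>\<^sub>F n in sequentially. 1 / real n \<le> x" using x by real_asymp
    moreover have "\<forall>\<^sub>F n in sequentially. x \<le> b * real n" using b by real_asymp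
    ultimately show "\<forall>\<^sub>F n in sequentially. h n x = f x"
      by eventually_elim (simp add: h_def)
  qed
  have "f integrable_on {0<..} \<and> (\<lambda>n. integral {0<..} (h n)) \<longlonglongrightarrow> integral {0<..} f"
  proof (rule Henstock_Kurzweil_Integration.monotone_convergence_increasing[OF hint hle hlim])
    have "\<bar>integral {0<..} (h n)\<bar> \<le> log_gf_constant k" for n
    proof -
      have "integral {0<..} (h n) \<le> integral {0<..} f"
        using hint fi f0 by (intro integral_le) (auto simp: h_def)
      moreover have "0 \<le> integral {0<..} (h n)" using hint f0 by (intro integral_nonneg) (auto simp: h_def)
      ultimately show ?thesis using fi by (simp add: integral_unique)
    qed
    then show "bounded (range (\<lambda>n. integral {0<..} (h n)))" by (auto simp: bounded_iff)
  qed auto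
  then have "(\<lambda>n. integral {0<..} (h n)) \<longlonglongrightarrow> log_gf_constant k" using fi by (simp add: integral_unique)
  then have "(\<lambda>n. complex_of_real (integral {0<..} (h n))) \<longlonglongrightarrow> of_real (log_gf_constant k)" by (rule tendsto_of_real)
  moreover have "\<forall>\<^sub>F n in sequentially. complex_of_real (integral {0<..} (h n))
      = euler_primitive (of_real (b * real n)) - euler_primitive (of_real (1 / real n))"
    using ev
  proof eventually_elim
    case (elim n)
    then have n: "n > 0" "1 / real n \<le> b * real n" by auto
    have sub: "?S n \<subseteq> {0<..}" using n by (intro Spos)
    have "(h n has_integral integral {0<..} (h n)) {0<..}" using hint by blast
    then have "(f has_integral integral {0<..} (h n)) (?S n)"
      unfolding h_def has_integral_restrict_Int using sub by (simp add: inf.absorb1)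
    from has_integral_linear[OF this bounded_linear_of_real[where 'a = complex]]
    have "((\<lambda>x. complex_of_real (f x)) has_integral of_real (integral {0<..} (h n))) (?S n)"
      by (simp add: o_def)
    then show ?case using ftc[OF n] has_integral_unique by blast
  qed
  ultimately have "(\<lambda>n. euler_primitive (of_real (b * real n)) - euler_primitive (of_real (1 / real n))) \<longlonglongrightarrow> of_real (log_gf_constant k)"
    by (rule Lim_transform_eventually)
  moreover have "(\<lambda>n. euler_primitive (of_real (1 / real n))) \<longlonglongrightarrow> 0"
  proof -
    have "isCont lam_primitive 0"
      using lam_primitive_deriv[of 0] r by (intro DERIV_isCont) (auto simp: lam_domain_def)
    moreover have "(\<lambda>n. complex_of_real (1 / real n)) \<longlonglongrightarrow> of_real 0"
      by (intro tendsto_of_real lim_1_over_n)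
    ultimately have "(\<lambda>n. lam_primitive (of_real (1 / real n))) \<longlonglongrightarrow> lam_primitive 0"
      using isCont_tendsto_compose[of 0 lam_primitive "\<lambda>n. complex_of_real (1 / real n)" sequentially] by simp
    then have 1: "(\<lambda>n. lam_primitive (of_real (1 / real n))) \<longlonglongrightarrow> 0" by (simp add: lam_primitive_0)
    have "(\<lambda>n. real k * (1 / real n) - real k * (1 / real n) * ln (1 / real n)) \<longlonglongrightarrow> 0" by real_asymp
    then have "(\<lambda>n. complex_of_real (real k * (1 / real n) - real k * (1 / real n) * ln (1 / real n))) \<longlonglongrightarrow> of_real 0"
      by (rule tendsto_of_real)
    then have 2: "(\<lambda>n. lam_primitive (of_real (1 / real n))
        + complex_of_real (real k * (1 / real n) - real k * (1 / real n) * ln (1 / real n))) \<longlonglongrightarrow> 0 + of_real 0"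
      by (intro tendsto_add 1)
    have 3: "\<forall>\<^sub>F n in sequentially. lam_primitive (of_real (1 / real n))
        + complex_of_real (real k * (1 / real n) - real k * (1 / real n) * ln (1 / real n))
        = euler_primitive (of_real (1 / real n))"
      using eventually_gt_at_top[of 0]
    proof eventually_elim
      case (elim n)
      then have "Ln (complex_of_real (1 / real n)) = of_real (ln (1 / real n))" by (intro Ln_of_real) simp
      then show ?case by (simp only: euler_primitive_def) simp
    qed
    show ?thesis using Lim_transform_eventually[OF 2 3] by simp
  qed
  ultimately have "(\<lambda>n. (euler_primitive (of_real (b * real n)) - euler_primitive (of_real (1 / real n)))
     + euler_primitive (of_real (1 / real n))) \<longlonglongrightarrow> of_real (log_gf_constant k) + 0"
    by (rule tendsto_add)
  then show ?thesis by simp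
qed

text \<open>Turning the ray onto the real axis: with s = |a| n / 4, the values at a n and |a| n
  differ by at most the length O(s) of the segment joining them times the bound O(1/s^2) for the
  derivative, because the whole segment has real part at least s.\<close>

lemma euler_primitive_limit:
  assumes a: "a \<in> sector_cone \<tau>"
  shows "(\<lambda>n. euler_primitive (a * of_nat n)) \<longlonglongrightarrow> of_real (log_gf_constant k)"
proof -
  define b where "b = norm a"
  have b: "b > 0" using cone_power(5)[OF a] by (simp add: b_def)
  have bd: "norm (euler_primitive (a * of_nat n) - euler_primitive (of_real (b * real n))) \<le> 144 / (b * real n / 4)"
    if n: "b * real n \<ge> 4" for n
  proof -
    have n0: "real n > 0" using n b by (cases n) auto
    define s where "s = b * real n / 4"
    have s: "s \<ge> 1" using n by (simp add: s_def)
    have m1: "a * of_nat n \<in> sector_cone \<tau>"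
      using cone_scale[OF a n0] by (simp add: mult.commute)
    have m2: "of_real (b * real n) \<in> sector_cone \<tau>" using n by (intro of_real_in_cone \<tau>) linarith
    have seg: "closed_segment (a * of_nat n) (of_real (b * real n)) \<subseteq> sector_cone \<tau>"
      by (intro closed_segment_subset m1 m2 convex_sector_cone)
    have far: "norm u \<ge> s" if u: "u \<in> closed_segment (a * of_nat n) (of_real (b * real n))" for u
    proof -
      obtain x v where xv: "x > 0" "norm v < \<tau>" "a = of_real x * (1 + v)" "norm a < 2 * x" "x / 2 < norm a"
        using cone_decompose[OF a] .
      have "\<bar>Re v\<bar> < 1 / 2" using abs_Re_le_cmod[of v] xv \<tau> by linarith
      then have "x * (1 / 2) \<le> x * Re (1 + v)" using xv by (intro mult_left_mono) auto
      moreover have "Re a = x * Re (1 + v)" unfolding xv(3) by simp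
      \<comment> \<open>Here x / 2 \<le> Re a and |a| < 2 x, which explains the factor 1/4 in
        s.\<close>
      ultimately have "Re a \<ge> b / 4" using xv(4) unfolding b_def by linarith
      then have "Re a * real n \<ge> b / 4 * real n" using n0 by (intro mult_right_mono) auto
      then have r1: "Re (a * of_nat n) \<ge> s" by (simp add: s_def)
      have r2: "Re (of_real (b * real n)) \<ge> s" using s by (simp add: s_def)
      have "convex {z. Re z \<ge> s}" by (rule convex_halfspace_Re_ge)
      then have "closed_segment (a * of_nat n) (of_real (b * real n)) \<subseteq> {z. Re z \<ge> s}"
        using r1 r2 by (intro closed_segment_subset) simp_all
      then have "Re u \<ge> s" using u by blast
      then show ?thesis using complex_Re_le_cmod[of u] by linarith
    qed
    have "norm (euler_primitive (a * of_nat n) - euler_primitive (of_real (b * real n)))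
       \<le> 18 / s ^ 2 * norm (a * of_nat n - of_real (b * real n))"
    proof (rule field_differentiable_bound)
      show "convex (closed_segment (a * of_nat n) (of_real (b * real n)))" by (rule convex_closed_segment)
      fix u assume u: "u \<in> closed_segment (a * of_nat n) (of_real (b * real n))"
      then have uc: "u \<in> sector_cone \<tau>" using seg by blast
      show "(euler_primitive has_field_derivative euler_log (u ^ k)) (at u within closed_segment (a * of_nat n) (of_real (b * real n)))"
        by (rule has_field_derivative_at_within[OF euler_primitive_deriv[OF uc]])
      have "s ^ 2 \<le> s ^ (2 * k)" using s k by (intro power_increasing) auto
      also have "\<dots> \<le> norm u ^ (2 * k)" using far[OF u] s by (intro power_mono) auto
      finally have "18 / norm u ^ (2 * k) \<le> 18 / s ^ 2"
        using s by (intro divide_left_mono mult_pos_pos zero_less_power less_le_trans[OF _ far[OF u]]) auto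
      then show "norm (euler_log (u ^ k)) \<le> 18 / s ^ 2"
        using norm_euler_log_power_le(2)[OF uc] by linarith
    qed auto
    also have "norm (a * of_nat n - of_real (b * real n)) \<le> 8 * s"
      using norm_triangle_ineq4[of "a * of_nat n" "of_real (b * real n)"] b n0
      by (simp add: s_def norm_mult b_def)
    also have "18 / s ^ 2 * (8 * s) = 144 / s" using s by (simp add: power2_eq_square)
    finally show ?thesis using s by (simp add: s_def divide_right_mono)
  qed
  have "(\<lambda>n. euler_primitive (a * of_nat n) - euler_primitive (of_real (b * real n))) \<longlonglongrightarrow> 0"
  proof (rule Lim_null_comparison)
    show "\<forall>\<^sub>F n in sequentially. norm (euler_primitive (a * of_nat n) - euler_primitive (of_real (b * real n))) \<le> 144 / (b * real n / 4)"
    proof -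
      have "\<forall>\<^sub>F n in sequentially. b * real n \<ge> 4" using b by real_asymp
      then show ?thesis by eventually_elim (rule bd)
    qed
    show "(\<lambda>n. 144 / (b * real n / 4)) \<longlonglongrightarrow> 0" using b by real_asymp
  qed
  from tendsto_add[OF this euler_primitive_real_limit[OF b]] show ?thesis by simp
qed

end

section \<open>Euler--Maclaurin summation along a ray of the cone\<close>

context log_cone
begin

text \<open>A derivative of order j at least 1 is O(|y|^(1/2 - j)) far out, so the boundary terms at
  the far end N vanish in the limit.\<close>

lemma scaled_lam_far_tendsto:
  assumes a: "a \<in> sector_cone (\<tau> / 2)" and j: "j \<ge> 1"
  shows "(\<lambda>N. a ^ j * (deriv ^^ j) lam (a * of_real (real N))) \<longlonglongrightarrow> 0"
proof -
  obtain C where C: "C > 0"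
    "\<And>y. y \<in> sector_cone (\<tau> / 2) \<Longrightarrow> norm ((deriv ^^ j) lam y) \<le> C * (1 + sqrt (norm y)) / norm y ^ j"
    using higher_deriv_lam_far[of j] by (auto simp del: funpow.simps)
  define b where "b = norm a"
  have b: "b > 0" using cone_power(5)[of a] a cone_half_subset by (auto simp: b_def)
  show ?thesis
  proof (rule Lim_null_comparison)
    have "\<forall>\<^sub>F N in sequentially. b * real N \<ge> 1" using b by real_asymp
    then show "\<forall>\<^sub>F N in sequentially. norm (a ^ j * (deriv ^^ j) lam (a * of_real (real N)))
        \<le> b ^ j * (C * (2 / sqrt (b * real N)))"
    proof eventually_elim
      case (elim N)
      define s where "s = b * real N"
      have s: "s \<ge> 1" using elim by (simp add: s_def)
      then have N: "real N > 0" by (cases N) (auto simp: s_def)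
      have mem: "a * of_real (real N) \<in> sector_cone (\<tau> / 2)"
        using cone_scale[OF a N] by (simp add: mult.commute)
      have ns: "norm (a * of_real (real N)) = s" by (simp add: s_def b_def norm_mult)
      have "(1 + sqrt s) / s ^ j \<le> (2 * sqrt s) / s"
      proof (rule frac_le)
        show "1 + sqrt s \<le> 2 * sqrt s" using s by simp
        show "s \<le> s ^ j" using power_increasing[of 1 j s] s j by simp
      qed (use s in auto)
      also have "(2 * sqrt s) / s = 2 / sqrt s" using s by (simp add: field_simps)
      finally have "C * ((1 + sqrt s) / s ^ j) \<le> C * (2 / sqrt s)" using C(1) by (intro mult_left_mono) auto
      then have "norm ((deriv ^^ j) lam (a * of_real (real N))) \<le> C * (2 / sqrt s)"
        using C(2)[OF mem] unfolding ns by simp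
      then show ?case unfolding norm_mult norm_power b_def[symmetric] s_def[symmetric]
        using b by (intro mult_left_mono) auto
    qed
    show "(\<lambda>N. b ^ j * (C * (2 / sqrt (b * real N)))) \<longlonglongrightarrow> 0"
    proof -
      have "(\<lambda>N. 2 / sqrt (b * real N)) \<longlonglongrightarrow> 0" using b by real_asymp
      then have "(\<lambda>N. b ^ j * (C * (2 / sqrt (b * real N)))) \<longlonglongrightarrow> b ^ j * (C * 0)"
        by (intro tendsto_mult tendsto_const)
      then show ?thesis by simp
    qed
  qed
qed

text \<open>The formula of order k is applied to t -> \<open>lam (a * t)\<close> on [0, N], and then
  N tends to infinity. The terms k Ln (a m) add up to k (ln N! + N Ln a), the integral contributes k
  (N ln N - N) through \<open>euler_primitive\<close>, and half the end value contributes (k/2) (ln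
  N + Ln a); together the divergent parts form k times \<open>stirling_seq N\<close>. What is left
  is O(|a|^k): the boundary term of order k at 0 and the remainder.\<close>

lemma log_gf_cone_asymptotic:
  "\<exists>C. \<forall>a\<in>sector_cone (\<tau> / 2).
     norm (log_gf k (a ^ k) - (of_real (log_gf_constant k) / a + of_nat k / 2 * (Ln a - of_real (ln (2 * pi)))))
     \<le> C * norm a ^ k"
proof -
  obtain C1 where C1a: "C1 > 0"
    and C1b: "\<forall>y\<in>sector_cone (\<tau> / 2) \<union> {0}. norm ((deriv ^^ (Suc k)) lam y) \<le> C1 / (1 + norm y ^ 2)"
    using higher_deriv_lam_integrable_bound by blast
  note C1 = C1a C1b[rule_format]
  obtain C2 where C2a: "\<forall>x\<in>{0..1}. \<bar>poly (bernoulli_kernel (Suc k)) x\<bar> \<le> C2"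
    using bernoulli_kernel_bounded[of "Suc k"] by blast
  note C2 = C2a[rule_format]
  have C2': "C2 \<ge> 0" using C2[of 0] abs_ge_zero order_trans by fastforce
  define c where "c = (\<lambda>j. (-1) ^ (j - 1) * poly (bernoulli_kernel (Suc j)) 0)"
  define B where "B = C2 * (C1 * (pi / 2)) + \<bar>c k\<bar> * norm ((deriv ^^ k) lam 0)"
  have "norm (log_gf k (a ^ k) - (of_real (log_gf_constant k) / a + of_nat k / 2 * (Ln a - of_real (ln (2 * pi)))))
     \<le> B * norm a ^ k" if a2: "a \<in> sector_cone (\<tau> / 2)" for a
  proof -
    have a: "a \<in> sector_cone \<tau>" using a2 cone_half_subset by blast
    have a0: "a \<noteq> 0" using cone_power(5)[OF a] .
    define b where "b = norm a"
    have b: "b > 0" using a0 by (simp add: b_def)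
    define g where "g = (\<lambda>j t. a ^ j * (deriv ^^ j) lam (a * of_real t))"
    have mem: "a * of_real t \<in> sector_cone (\<tau> / 2) \<union> {0}" if "t \<ge> 0" for t
      using cone_scale[OF a2, of t] that by (cases "t = 0") (auto simp: mult.commute)
    have memd: "a * of_real t \<in> lam_domain" if "t \<ge> 0" for t
      using mem[OF that] cone_half_subset r by (auto simp: lam_domain_def)
    have gd: "(g j has_vector_derivative g (Suc j) t) (at t within {0..real N})" if "t \<in> {0..real N}" for j t N
    proof -
      have "((deriv ^^ j) lam has_field_derivative (deriv ^^ Suc j) lam (a * of_real t)) (at (a * of_real t))"
        using that by (intro has_field_derivative_higher_deriv[OF holomorphic_lam open_lam_domain] memd) auto
      moreover have "((\<lambda>u. a * u) has_field_derivative a) (at (of_real t))"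
        by (auto intro!: derivative_eq_intros)
      ultimately have "((\<lambda>u. (deriv ^^ j) lam (a * u)) has_field_derivative (deriv ^^ Suc j) lam (a * of_real t) * a) (at (of_real t))"
        by (rule DERIV_chain2)
      then have "((\<lambda>u. a ^ j * (deriv ^^ j) lam (a * u)) has_field_derivative a ^ j * ((deriv ^^ Suc j) lam (a * of_real t) * a)) (at (of_real t))"
        by (rule DERIV_cmult)
      moreover have "a ^ j * ((deriv ^^ Suc j) lam (a * of_real t) * a) = g (Suc j) t"
        by (simp add: g_def del: funpow.simps)
      ultimately have "((\<lambda>u. a ^ j * (deriv ^^ j) lam (a * u)) has_field_derivative g (Suc j) t) (at (of_real t))" by simp
      from has_vector_derivative_real_field[OF this, THEN has_vector_derivative_at_within]
      have "((\<lambda>u. a ^ j * (deriv ^^ j) lam (a * of_real u)) has_vector_derivative g (Suc j) t) (at t within {0..real N})" .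
      moreover have "g j = (\<lambda>u. a ^ j * (deriv ^^ j) lam (a * of_real u))" by (simp add: g_def)
      ultimately show ?thesis by (simp only:)
    qed
    have g0: "g j 0 = 0" if "1 \<le> j" "j < k" for j
      using higher_deriv_lam_0[of j] that by (simp add: g_def)
    define T where "T = (\<lambda>N. \<Sum>m<N. euler_log (of_nat (Suc m) ^ k * a ^ k))"
    \<comment> \<open>A majorant of the derivative of order k + 1. Its prefactor is b^(k+1), and
      integration along the ray returns a factor 1/b, so the remainder is O(b^k) uniformly in
      N.\<close>
    define h where "h = (\<lambda>t. b ^ Suc k * (C1 / (1 + (b * t) ^ 2)))"
    have hint: "(h has_integral b ^ k * C1 * arctan (b * real N)) {0..real N}" for N
    proof -
      have "(h has_integral (b ^ k * C1 * arctan (b * real N) - b ^ k * C1 * arctan (b * 0))) {0..real N}"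
      proof (rule fundamental_theorem_of_calculus)
        fix t assume "t \<in> {0..real N}"
        have "((\<lambda>t. b ^ k * C1 * arctan (b * t)) has_real_derivative b ^ k * C1 * (b / (1 + (b * t) ^ 2))) (at t within {0..real N})"
          by (auto intro!: derivative_eq_intros simp: inverse_eq_divide)
        moreover have "b ^ k * C1 * (b / (1 + (b * t) ^ 2)) = h t" by (simp add: h_def)
        ultimately show "((\<lambda>t. b ^ k * C1 * arctan (b * t)) has_vector_derivative h t) (at t within {0..real N})"
          by (simp add: has_real_derivative_iff_has_vector_derivative)
      qed simp
      then show ?thesis by simp
    qed
    have rem: "norm (em_remainder g N (Suc k)) \<le> C2 * (C1 * (pi / 2)) * b ^ k" for N
    proof -
      have "norm (em_remainder g N (Suc k)) \<le> C2 * integral {0..real N} h"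
      proof (rule norm_em_remainder_le[where g = g and N = N and J = "Suc k" and C = C2 and h = h])
        show "(g j has_vector_derivative g (Suc j) t) (at t within {0..real N})" if "t \<in> {0..real N}" for j t
          using that by (rule gd)
        show "\<bar>poly (bernoulli_kernel (Suc k)) x\<bar> \<le> C2" if "x \<in> {0..1}" for x
          using that by (rule C2)
        show "h integrable_on {0..real N}" using hint by (rule has_integral_integrable)
        fix t assume t: "t \<in> {0..real N}"
        have "norm ((deriv ^^ Suc k) lam (a * of_real t)) \<le> C1 / (1 + norm (a * of_real t) ^ 2)"
          using t by (intro C1(2) mem) auto
        also have "norm (a * of_real t) = b * t" using t by (simp add: norm_mult b_def)
        finally show "norm (g (Suc k) t) \<le> h t"
          unfolding g_def h_def norm_mult norm_power b_def[symmetric] using b by (intro mult_left_mono) auto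
      qed
      also have "integral {0..real N} h = b ^ k * C1 * arctan (b * real N)" by (rule integral_unique[OF hint])
      also have "C2 * (b ^ k * C1 * arctan (b * real N)) \<le> C2 * (b ^ k * C1 * (pi / 2))"
        using C2' C1 b arctan_ubound[of "b * real N"] by (intro mult_left_mono) auto
      finally show ?thesis by (simp add: algebra_simps)
    qed
    \<comment> \<open>The formula is arranged so that every term on the left converges as N grows,
      while the right side is bounded uniformly in N.\<close>
    have key: "T N - euler_primitive (a * of_nat N) / a + of_real (real k * stirling_seq N) - of_nat k / 2 * Ln a
        - euler_log ((a * of_nat N) ^ k) / 2 - (\<Sum>j=1..k. c j *\<^sub>R g j (real N)) + c k *\<^sub>R g k 0
        = (-1) ^ k * em_remainder g N (Suc k)" if N: "N > 0" for N
    proof -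
      have lnm: "Ln (a * of_nat m) = of_real (ln (real m)) + Ln a" if "m > 0" for m
        using Ln_times_of_real[of "real m" a] that a0 by (simp add: mult.commute Ln_of_real)
      have memm: "a * of_nat m \<in> sector_cone \<tau>" if "m > 0" for m
        using cone_scale[OF a, of "real m"] that by (simp add: mult.commute)
      have lamm: "lam (a * of_nat m) = euler_log ((a * of_nat m) ^ k) + of_nat k * (of_real (ln (real m)) + Ln a)" if "m > 0" for m
        using lam_cone[OF memm[OF that]] lnm[OF that] by simp
      have "(\<Sum>m=1..N. g 0 (real m)) = (\<Sum>m=1..N. euler_log ((a * of_nat m) ^ k) + of_nat k * (of_real (ln (real m)) + Ln a))"
        by (rule sum.cong) (auto simp: g_def lamm)
      also have "\<dots> = (\<Sum>m=1..N. euler_log ((a * of_nat m) ^ k)) + of_nat k * (of_real (\<Sum>m=1..N. ln (real m)) + of_nat N * Ln a)"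
        by (simp add: sum.distrib sum_distrib_left distrib_left)
      also have "(\<Sum>m=1..N. ln (real m)) = ln (fact N)"
      proof -
        have "(fact N :: real) = (\<Prod>m=1..N. real m)" by (simp add: fact_prod)
        then show ?thesis by (simp only:) (subst ln_prod, auto)
      qed
      also have "(\<Sum>m=1..N. euler_log ((a * of_nat m) ^ k)) = T N"
        unfolding T_def
        by (rule sum.reindex_bij_witness[of _ Suc "\<lambda>m. m - 1"]) (auto simp: power_mult_distrib mult.commute)
      finally have lhs: "(\<Sum>m=1..N. g 0 (real m)) = T N + of_nat k * (of_real (ln (fact N)) + of_nat N * Ln a)" .
      have "integral {0..real N} (g 0) = lam_primitive (a * of_nat N) / a"
      proof -
        have "(g 0 has_integral (lam_primitive (a * of_real (real N)) / a - lam_primitive (a * of_real 0) / a)) {0..real N}"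
        proof (rule fundamental_theorem_of_calculus)
          fix t assume t: "t \<in> {0..real N}"
          have "(lam_primitive has_field_derivative lam (a * of_real t)) (at (a * of_real t))"
            using t by (intro lam_primitive_deriv memd) auto
          moreover have "((\<lambda>u. a * u) has_field_derivative a) (at (of_real t))"
            by (auto intro!: derivative_eq_intros)
          ultimately have "((\<lambda>u. lam_primitive (a * u)) has_field_derivative lam (a * of_real t) * a) (at (of_real t))"
            by (rule DERIV_chain2)
          then have "((\<lambda>u. lam_primitive (a * u) / a) has_field_derivative lam (a * of_real t) * a / a) (at (of_real t))"
            by (rule DERIV_cdivide)
          then have "((\<lambda>u. lam_primitive (a * u) / a) has_field_derivative g 0 t) (at (of_real t))"
            using a0 by (simp add: g_def)
          then show "((\<lambda>t. lam_primitive (a * of_real t) / a) has_vector_derivative g 0 t) (at t within {0..real N})"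
            by (rule has_vector_derivative_real_field[THEN has_vector_derivative_at_within])
        qed simp
        then show ?thesis by (simp add: integral_unique lam_primitive_0)
      qed
      also have "lam_primitive (a * of_nat N) = euler_primitive (a * of_nat N)
          + of_nat k * (a * of_nat N) * (of_real (ln (real N)) + Ln a) - of_nat k * (a * of_nat N)"
        using lnm[OF N] by (simp add: euler_primitive_def)
      finally have int: "integral {0..real N} (g 0) = euler_primitive (a * of_nat N) / a
          + of_nat k * of_nat N * (of_real (ln (real N)) + Ln a) - of_nat k * of_nat N"
        using a0 by (simp add: add_divide_distrib diff_divide_distrib)
      have gN: "g 0 (real N) = euler_log ((a * of_nat N) ^ k) + of_nat k * (of_real (ln (real N)) + Ln a)"
        using lamm[OF N] by (simp add: g_def)
      have g00: "g 0 0 = 0" using lam_0 by (simp add: g_def)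
      have "(\<Sum>j=1..k. c j *\<^sub>R g j 0) = (\<Sum>j\<in>{k}. c j *\<^sub>R g j 0)"
        by (rule sum.mono_neutral_right) (use k g0 in auto)
      then have sumc: "(\<Sum>j=1..k. c j *\<^sub>R (g j (real N) - g j 0)) = (\<Sum>j=1..k. c j *\<^sub>R g j (real N)) - c k *\<^sub>R g k 0"
        by (simp add: scaleR_diff_right sum_subtractf)
      have st: "complex_of_real (real k * stirling_seq N) = of_nat k * (of_real (ln (fact N)) - of_nat N * of_real (ln (real N)) + of_nat N - of_real (ln (real N)) / 2)"
        by (simp add: stirling_seq_def)
      have em: "(\<Sum>m=1..N. g 0 (real m)) = integral {0..real N} (g 0) + (g 0 (real N) - g 0 0) / 2
         + (\<Sum>j=1..k. c j *\<^sub>R (g j (real N) - g j 0)) + (-1) ^ k * em_remainder g N (Suc k)"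
        unfolding c_def by (rule euler_maclaurin[where g = g and N = N and J = k]) (rule gd)
      have T: "T N = euler_primitive (a * of_nat N) / a
          + of_nat k * of_nat N * (of_real (ln (real N)) + Ln a) - of_nat k * of_nat N
          + (euler_log ((a * of_nat N) ^ k) + of_nat k * (of_real (ln (real N)) + Ln a)) / 2
          + ((\<Sum>j=1..k. c j *\<^sub>R g j (real N)) - c k *\<^sub>R g k 0) + (-1) ^ k * em_remainder g N (Suc k)
          - of_nat k * (of_real (ln (fact N)) + of_nat N * Ln a)"
        using em unfolding lhs int gN g00 sumc by (simp add: algebra_simps)
      show ?thesis unfolding T st by (simp add: field_simps)
    qed
    have Tlim: "T \<longlonglongrightarrow> log_gf k (a ^ k)"
    proof -
      have "(\<lambda>m. euler_log (of_nat (Suc m) ^ k * a ^ k)) sums log_gf k (a ^ k)"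
        using k by (intro log_gf_sums cone_power(2)[OF a]) auto
      then show ?thesis by (simp add: sums_def T_def)
    qed
    have glim: "(\<lambda>N. \<Sum>j=1..k. c j *\<^sub>R g j (real N)) \<longlonglongrightarrow> (\<Sum>j=1..k. c j *\<^sub>R 0)"
      unfolding g_def by (intro tendsto_sum tendsto_scaleR tendsto_const scaled_lam_far_tendsto[OF a2]) auto
    have elim: "(\<lambda>N. euler_log ((a * of_nat N) ^ k) / 2) \<longlonglongrightarrow> 0 / 2"
    proof (intro tendsto_divide tendsto_const)
      show "(\<lambda>N. euler_log ((a * of_nat N) ^ k)) \<longlonglongrightarrow> 0"
      proof (rule Lim_null_comparison)
        show "\<forall>\<^sub>F N in sequentially. norm (euler_log ((a * of_nat N) ^ k)) \<le> 6 / (b * real N)"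
        proof -
          have "\<forall>\<^sub>F N in sequentially. b * real N \<ge> 1" using b by real_asymp
          then show ?thesis
          proof eventually_elim
            case (elim N)
            then have N: "real N > 0" by (cases N) auto
            have m: "a * of_nat N \<in> sector_cone \<tau>" using cone_scale[OF a N] by (simp add: mult.commute)
            have "b * real N \<le> (b * real N) ^ k" using power_increasing[of 1 k "b * real N"] elim k by simp
            then have "6 / (b * real N) ^ k \<le> 6 / (b * real N)" using elim by (intro frac_le) auto
            then show ?case using norm_euler_log_power_le(1)[OF m] by (simp add: norm_mult b_def)
          qed
        qed
        show "(\<lambda>N. 6 / (b * real N)) \<longlonglongrightarrow> 0" using b by real_asymp
      qed
    qed simp
    have slim: "(\<lambda>N. complex_of_real (real k * stirling_seq N)) \<longlonglongrightarrow> of_real (real k * (ln (2 * pi) / 2))"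
      by (intro tendsto_of_real tendsto_mult tendsto_const stirling_seq_tendsto)
    have "(\<lambda>N. T N - euler_primitive (a * of_nat N) / a + of_real (real k * stirling_seq N) - of_nat k / 2 * Ln a
        - euler_log ((a * of_nat N) ^ k) / 2 - (\<Sum>j=1..k. c j *\<^sub>R g j (real N)) + c k *\<^sub>R g k 0)
       \<longlonglongrightarrow> log_gf k (a ^ k) - of_real (log_gf_constant k) / a + of_real (real k * (ln (2 * pi) / 2)) - of_nat k / 2 * Ln a
          - 0 / 2 - (\<Sum>j=1..k. c j *\<^sub>R 0) + c k *\<^sub>R g k 0"
      by (intro tendsto_add tendsto_diff Tlim glim elim slim tendsto_const tendsto_divide euler_primitive_limit[OF a] a0)
    then have "norm (log_gf k (a ^ k) - of_real (log_gf_constant k) / a + of_real (real k * (ln (2 * pi) / 2)) - of_nat k / 2 * Ln a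
          - 0 / 2 - (\<Sum>j=1..k. c j *\<^sub>R 0) + c k *\<^sub>R g k 0) \<le> C2 * (C1 * (pi / 2)) * b ^ k"
    proof (rule Lim_norm_ubound[rotated])
      show "\<forall>\<^sub>F N in sequentially. norm (T N - euler_primitive (a * of_nat N) / a + of_real (real k * stirling_seq N) - of_nat k / 2 * Ln a
        - euler_log ((a * of_nat N) ^ k) / 2 - (\<Sum>j=1..k. c j *\<^sub>R g j (real N)) + c k *\<^sub>R g k 0) \<le> C2 * (C1 * (pi / 2)) * b ^ k"
        using eventually_gt_at_top[of 0]
        by eventually_elim (simp only: key norm_mult norm_power norm_minus_cancel norm_one power_one mult_1 rem)
    qed simp
    moreover define E where E: "E = log_gf k (a ^ k) - (of_real (log_gf_constant k) / a + of_nat k / 2 * (Ln a - of_real (ln (2 * pi))))"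
    moreover have "log_gf k (a ^ k) - of_real (log_gf_constant k) / a + of_real (real k * (ln (2 * pi) / 2)) - of_nat k / 2 * Ln a
          - 0 / 2 - (\<Sum>j=1..k. c j *\<^sub>R 0) + c k *\<^sub>R g k 0 = E + c k *\<^sub>R g k 0"
      unfolding E by (simp add: algebra_simps)
    ultimately have "norm (E + c k *\<^sub>R g k 0) \<le> C2 * (C1 * (pi / 2)) * b ^ k"
      by (simp only:)
    moreover have "norm (c k *\<^sub>R g k 0) = \<bar>c k\<bar> * norm ((deriv ^^ k) lam 0) * b ^ k"
      by (simp add: g_def norm_mult norm_power b_def)
    ultimately have "norm E \<le> B * b ^ k"
      using norm_triangle_ineq4[of "E + c k *\<^sub>R g k 0" "c k *\<^sub>R g k 0", unfolded add_diff_cancel_right']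
      unfolding B_def distrib_right by linarith
    then show ?thesis by (simp add: E b_def)
  qed
  then show ?thesis by blast
qed

end

text \<open>All three closeness conditions hold for small arguments by continuity at 0; the cap 1/4
  keeps \<tau> below 1/2.\<close>

lemma log_cone_exists:
  assumes "k \<ge> 2" shows "\<exists>\<tau> r. log_cone k \<tau> r"
proof -
  have "((\<lambda>v. Ln (1 + v)) \<longlongrightarrow> Ln (1 + 0)) (at 0)"
    by (intro tendsto_Ln tendsto_add tendsto_const tendsto_ident_at) simp
  from tendstoD[OF this, of "1 / real k"] assms
  have "\<forall>\<^sub>F v in at 0. dist (Ln (1 + v)) (Ln (1 + 0)) < 1 / real k" by simp
  moreover have "((\<lambda>v::complex. (1 + v) ^ k) \<longlongrightarrow> (1 + 0) ^ k) (at 0)"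
    by (intro tendsto_power tendsto_add tendsto_const tendsto_ident_at)
  from tendstoD[OF this, of "1 / 2"]
  have "\<forall>\<^sub>F v in at 0. dist ((1 + v::complex) ^ k) ((1 + 0) ^ k) < 1 / 2" by simp
  moreover have "isCont exp_quotient 0"
    using holomorphic_on_imp_continuous_on[OF holomorphic_exp_quotient] by (simp add: continuous_on_eq_continuous_at)
  then have "(exp_quotient \<longlongrightarrow> exp_quotient 0) (at 0)" by (simp add: isCont_def)
  from tendstoD[OF this, of 1]
  have "\<forall>\<^sub>F v in at 0. dist (exp_quotient v) (exp_quotient 0) < 1" by simp
  ultimately obtain d1 d2 d3 where d: "d1 > 0" "\<And>v. v \<noteq> 0 \<Longrightarrow> dist v 0 < d1 \<Longrightarrow> dist (Ln (1 + v)) (Ln (1 + 0)) < 1 / real k"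
    "d2 > 0" "\<And>v::complex. v \<noteq> 0 \<Longrightarrow> dist v 0 < d2 \<Longrightarrow> dist ((1 + v) ^ k) ((1 + 0) ^ k) < 1 / 2"
    "d3 > 0" "\<And>v. v \<noteq> 0 \<Longrightarrow> dist v 0 < d3 \<Longrightarrow> dist (exp_quotient v) (exp_quotient 0) < 1"
    unfolding eventually_at by blast
  define \<tau> where "\<tau> = min (1 / 4) (min d1 d2)"
  define r where "r = min 1 d3"
  have "log_cone k \<tau> r"
  proof
    show "norm (Ln (1 + v)) < 1 / real k" if "norm v < \<tau>" for v
      using d(2)[of v] that assms by (cases "v = 0") (auto simp: \<tau>_def)
    show "norm ((1 + v) ^ k - 1) < 1 / 2" if "norm v < \<tau>" for v :: complex
      using d(4)[of v] that by (cases "v = 0") (auto simp: \<tau>_def dist_norm)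
    show "norm (exp_quotient z - 1) < 1" if "norm z < r" for z
      using d(6)[of z] that by (cases "z = 0") (auto simp: r_def dist_norm exp_quotient_def)
  qed (use assms d in \<open>auto simp: \<tau>_def r_def\<close>)
  then show ?thesis by blast
qed

lemma log_gf_asymptotic:
  assumes "k \<ge> 2"
  shows "\<exists>\<tau> C. \<tau> > 0 \<and> C > 0 \<and> (\<forall>a\<in>sector_cone \<tau>.
     a \<noteq> 0 \<and> Re (a ^ k) > 0 \<and> Ln (a ^ k) = of_nat k * Ln a \<and>
     norm (log_gf k (a ^ k) - (of_real (log_gf_constant k) / a + of_nat k / 2 * (Ln a - of_real (ln (2 * pi))))) \<le> C * norm a ^ k)"
proof -
  obtain \<tau> r where "log_cone k \<tau> r" using log_cone_exists[OF assms] by blast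
  then interpret log_cone k \<tau> r .
  obtain C where C: "\<And>a. a \<in> sector_cone (\<tau> / 2) \<Longrightarrow>
     norm (log_gf k (a ^ k) - (of_real (log_gf_constant k) / a + of_nat k / 2 * (Ln a - of_real (ln (2 * pi))))) \<le> C * norm a ^ k"
    using log_gf_cone_asymptotic by blast
  show ?thesis
  proof (rule exI[of _ "\<tau> / 2"], rule exI[of _ "max C 1"], intro conjI ballI)
    fix a assume a: "a \<in> sector_cone (\<tau> / 2)"
    have "C * norm a ^ k \<le> max C 1 * norm a ^ k" by (intro mult_right_mono) auto
    then show "norm (log_gf k (a ^ k) - (of_real (log_gf_constant k) / a + of_nat k / 2 * (Ln a - of_real (ln (2 * pi))))) \<le> max C 1 * norm a ^ k"
      using C[OF a] by linarith
    have a': "a \<in> sector_cone \<tau>" using a cone_half_subset by blast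
    show "a \<noteq> 0" "Re (a ^ k) > 0" "Ln (a ^ k) = of_nat k * Ln a"
      by (rule cone_power[OF a'])+
  qed (use \<tau> in auto)
qed

section \<open>Minor arcs\<close>

definition near_circle :: "real \<Rightarrow> real \<Rightarrow> bool" where
  "near_circle \<delta> x \<longleftrightarrow> (\<exists>n::int. \<bar>x - 2 * pi * of_int n\<bar> \<le> \<delta>)"

lemma near_circle_diff:
  assumes "near_circle \<delta> x" "near_circle \<delta>' y"
  shows "near_circle (\<delta> + \<delta>') (x - y)"
proof -
  obtain n n' where "\<bar>x - 2 * pi * of_int n\<bar> \<le> \<delta>" "\<bar>y - 2 * pi * of_int n'\<bar> \<le> \<delta>'"
    using assms by (auto simp: near_circle_def)
  then have "\<bar>x - y - 2 * pi * of_int (n - n')\<bar> \<le> \<delta> + \<delta>'" by (simp add: algebra_simps abs_if split: if_splits)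
  then show ?thesis unfolding near_circle_def by blast
qed

lemma near_circle_add_period: "near_circle \<delta> (x + 2 * pi * of_int m) \<longleftrightarrow> near_circle \<delta> x"
proof
  assume "near_circle \<delta> (x + 2 * pi * of_int m)"
  then obtain n where n: "\<bar>x + 2 * pi * of_int m - 2 * pi * of_int n\<bar> \<le> \<delta>" by (auto simp: near_circle_def)
  have "\<bar>x - 2 * pi * of_int (n - m)\<bar> \<le> \<delta>" using n by (simp add: algebra_simps)
  then show "near_circle \<delta> x" unfolding near_circle_def by blast
next
  assume "near_circle \<delta> x"
  then obtain n where n: "\<bar>x - 2 * pi * of_int n\<bar> \<le> \<delta>" by (auto simp: near_circle_def)
  have "\<bar>x + 2 * pi * of_int m - 2 * pi * of_int (n + m)\<bar> \<le> \<delta>" using n by (simp add: algebra_simps)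
  then show "near_circle \<delta> (x + 2 * pi * of_int m)" unfolding near_circle_def by blast
qed

lemma near_circle_minus: "near_circle \<delta> (- x) \<longleftrightarrow> near_circle \<delta> x"
proof -
  have *: "near_circle \<delta> (- x)" if "near_circle \<delta> x" for x
  proof -
    from that obtain n where "\<bar>x - 2 * pi * of_int n\<bar> \<le> \<delta>" by (auto simp: near_circle_def)
    then have "\<bar>- x - 2 * pi * of_int (- n)\<bar> \<le> \<delta>" by (simp add: abs_minus_commute)
    then show ?thesis unfolding near_circle_def by blast
  qed
  show ?thesis using *[of x] *[of "- x"] by auto
qed

lemma not_near_circle_between:
  assumes "\<epsilon> \<le> x" "x \<le> pi" "\<delta> < \<epsilon>" "\<epsilon> \<le> pi"
  shows "\<not> near_circle \<delta> x"
proof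
  assume "near_circle \<delta> x"
  then obtain n where n: "\<bar>x - 2 * pi * of_int n\<bar> \<le> \<delta>" by (auto simp: near_circle_def)
  consider "n = 0" | "n \<ge> 1" | "n \<le> -1" by linarith
  then show False
  proof cases
    case 1
    then show ?thesis using n assms by simp
  next
    case 2
    then have "2 * pi * 1 \<le> 2 * pi * of_int n" by (intro mult_left_mono) auto
    then show ?thesis using n assms by linarith
  next
    case 3
    then have "2 * pi * of_int n \<le> 2 * pi * (- 1)" by (intro mult_left_mono) auto
    moreover have "x \<ge> - pi"
    proof -
      have "\<delta> \<ge> 0" using n by linarith
      then show ?thesis using assms pi_ge_zero by linarith
    qed
    ultimately show ?thesis using n assms by linarith
  qed
qed

lemma cos_le_if_not_near:
  assumes "\<not> near_circle \<delta> x" "0 \<le> \<delta>" "\<delta> \<le> pi"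
  shows "cos x \<le> cos \<delta>"
proof -
  define n where "n = round (x / (2 * pi))"
  define y where "y = x - 2 * pi * of_int n"
  have "\<bar>of_int n - x / (2 * pi)\<bar> \<le> 1 / 2" unfolding n_def by (rule of_int_round_abs_le)
  then have "\<bar>2 * pi * (of_int n - x / (2 * pi))\<bar> \<le> 2 * pi * (1 / 2)"
    unfolding abs_mult by (intro mult_mono) auto
  then have y: "\<bar>y\<bar> \<le> pi" by (simp add: y_def algebra_simps abs_minus_commute)
  have "\<bar>y\<bar> > \<delta>" using assms(1) unfolding near_circle_def y_def by (meson linorder_not_less)
  have "cos x = cos (y + 2 * pi * of_int n)" by (simp add: y_def)
  also have "\<dots> = cos y" by (simp add: cos_add)
  also have "\<dots> = cos \<bar>y\<bar>" by simp
  also have "\<dots> \<le> cos \<delta>" using assms y \<open>\<bar>y\<bar> > \<delta>\<close> by (subst cos_mono_le_eq) auto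
  finally show ?thesis .
qed

section \<open>Finite differences and a count of phases away from 2 pi Z\<close>

definition fdiff :: "real \<Rightarrow> (real \<Rightarrow> real) \<Rightarrow> real \<Rightarrow> real" where
  "fdiff h f x = f (x + h) - f x"

lemma fdiff_funpow_linear:
  "(fdiff h ^^ n) (\<lambda>x. \<Sum>i\<in>A. c i * f i x) = (\<lambda>x. \<Sum>i\<in>A. c i * (fdiff h ^^ n) (f i) x)"
proof (induction n)
  case (Suc n)
  then show ?case by (simp add: fdiff_def[abs_def] sum_subtractf[symmetric] right_diff_distrib)
qed simp

text \<open>Differencing lowers the degree by one. The value on the top power needs the vanishing on
  lower powers at the preceding stage, so both are proved together.\<close>

lemma fdiff_funpow_power:
  "(\<forall>j<n. (fdiff h ^^ n) (\<lambda>x. x ^ j) = (\<lambda>_. 0)) \<and> (fdiff h ^^ n) (\<lambda>x. x ^ n) = (\<lambda>_. fact n * h ^ n)"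
proof (induction n)
  case (Suc n)
  have D: "fdiff h (\<lambda>x. x ^ j) = (\<lambda>x. \<Sum>i<j. (real (j choose i) * h ^ (j - i)) * x ^ i)" for j
  proof
    fix x
    have "(x + h) ^ j = (\<Sum>i\<le>j. of_nat (j choose i) * x ^ i * h ^ (j - i))" by (rule binomial_ring)
    also have "\<dots> = (\<Sum>i<j. of_nat (j choose i) * x ^ i * h ^ (j - i)) + x ^ j"
      by (simp add: lessThan_Suc_atMost[symmetric])
    finally show "fdiff h (\<lambda>x. x ^ j) x = (\<Sum>i<j. (real (j choose i) * h ^ (j - i)) * x ^ i)"
      by (simp add: fdiff_def algebra_simps)
  qed
  have S: "(fdiff h ^^ Suc n) (\<lambda>x. x ^ j) = (\<lambda>x. \<Sum>i<j. (real (j choose i) * h ^ (j - i)) * (fdiff h ^^ n) (\<lambda>x. x ^ i) x)" for j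
    unfolding funpow_Suc_right o_def D by (rule fdiff_funpow_linear)
  have "(fdiff h ^^ Suc n) (\<lambda>x. x ^ j) = (\<lambda>_. 0)" if "j < Suc n" for j
    unfolding S using Suc that by (intro ext sum.neutral) auto
  moreover have "(fdiff h ^^ Suc n) (\<lambda>x. x ^ Suc n) = (\<lambda>_. fact (Suc n) * h ^ Suc n)"
  proof
    fix x
    have "(\<Sum>i<Suc n. (real (Suc n choose i) * h ^ (Suc n - i)) * (fdiff h ^^ n) (\<lambda>x. x ^ i) x)
       = (\<Sum>i<n. (real (Suc n choose i) * h ^ (Suc n - i)) * (fdiff h ^^ n) (\<lambda>x. x ^ i) x)
         + (real (Suc n choose n) * h ^ (Suc n - n)) * (fdiff h ^^ n) (\<lambda>x. x ^ n) x" by simp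
    also have "(\<Sum>i<n. (real (Suc n choose i) * h ^ (Suc n - i)) * (fdiff h ^^ n) (\<lambda>x. x ^ i) x) = 0"
      using Suc by (intro sum.neutral) auto
    also have "(fdiff h ^^ n) (\<lambda>x. x ^ n) x = fact n * h ^ n" using Suc by simp
    finally show "(fdiff h ^^ Suc n) (\<lambda>x. x ^ Suc n) x = fact (Suc n) * h ^ Suc n"
      unfolding S by (simp add: Suc_diff_le algebra_simps)
  qed
  ultimately show ?case by blast
qed simp

text \<open>Each differencing subtracts two values close to multiples of 2 pi and so doubles the
  tolerance.\<close>

lemma near_circle_fdiff:
  assumes "\<And>i. i \<le> n \<Longrightarrow> near_circle \<delta> (f (x + real i * h))"
  shows "near_circle (2 ^ n * \<delta>) ((fdiff h ^^ n) f x)"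
  using assms
proof (induction n arbitrary: f \<delta>)
  case 0
  then show ?case using "0"[of 0] by simp
next
  case (Suc n)
  have "near_circle (2 * \<delta>) (fdiff h f (x + real i * h))" if "i \<le> n" for i
  proof -
    have "near_circle (\<delta> + \<delta>) (f (x + real (Suc i) * h) - f (x + real i * h))"
      using that by (intro near_circle_diff Suc.prems) auto
    then show ?thesis by (simp add: fdiff_def algebra_simps)
  qed
  then have "near_circle (2 ^ n * (2 * \<delta>)) ((fdiff h ^^ n) (fdiff h f) x)" by (rule Suc.IH)
  then show ?case by (simp only: funpow_Suc_right o_def) (simp add: mult.assoc mult.left_commute)
qed

text \<open>Among m, m + h, ..., m + k h one value must be far from 2 pi Z, for otherwise the k-th
  difference k! h^k t would be near. Each far g arises from at most k + 1 starting points g - i h,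
  and there are at least M/2 starting points.\<close>

lemma card_not_near_step:
  assumes h: "2 * k * h \<le> M" and not: "\<not> near_circle \<epsilon> (fact k * real h ^ k * t)" and \<delta>: "2 ^ k * \<delta> \<le> \<epsilon>"
  shows "real M / (2 * (real k + 1)) \<le> real (card {m\<in>{1..M}. \<not> near_circle \<delta> (real m ^ k * t)})"
proof -
  define G where "G = {m\<in>{1..M}. \<not> near_circle \<delta> (real m ^ k * t)}"
  have fin: "finite G" by (simp add: G_def)
  have cover: "{1..M - k * h} \<subseteq> (\<Union>i\<in>{..k}. (\<lambda>g. g - i * h) ` G)"
  proof
    fix m assume m: "m \<in> {1..M - k * h}"
    have "\<exists>i\<le>k. \<not> near_circle \<delta> (real (m + i * h) ^ k * t)"
    proof (rule ccontr)
      assume "\<not> (\<exists>i\<le>k. \<not> near_circle \<delta> (real (m + i * h) ^ k * t))"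
      \<comment> \<open>The monomial is written as a sum over one index to match
        \<open>fdiff_funpow_linear\<close>.\<close>
      then have *: "near_circle \<delta> ((\<lambda>x. \<Sum>i\<in>{0::nat}. t * x ^ k) (real m + real i * real h))" if "i \<le> k" for i
        using that by (auto simp: mult.commute)
      have "near_circle (2 ^ k * \<delta>) ((fdiff (real h) ^^ k) (\<lambda>x. \<Sum>i\<in>{0::nat}. t * x ^ k) (real m))"
        by (rule near_circle_fdiff) (use * in blast)
      also have "(fdiff (real h) ^^ k) (\<lambda>x. \<Sum>i\<in>{0::nat}. t * x ^ k) (real m) = fact k * real h ^ k * t"
        unfolding fdiff_funpow_linear using fdiff_funpow_power[of k "real h"] by simp
      finally obtain n where "\<bar>fact k * real h ^ k * t - 2 * pi * of_int n\<bar> \<le> 2 ^ k * \<delta>"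
        by (auto simp: near_circle_def)
      then have "\<bar>fact k * real h ^ k * t - 2 * pi * of_int n\<bar> \<le> \<epsilon>" using \<delta> by linarith
      then show False using not unfolding near_circle_def by blast
    qed
    then obtain i where i: "i \<le> k" "\<not> near_circle \<delta> (real (m + i * h) ^ k * t)" by blast
    have "i * h \<le> k * h" using i by simp
    moreover have "1 \<le> m" "m \<le> M - k * h" using m by auto
    ultimately have "m + i * h \<le> M" "1 \<le> m + i * h" by linarith+
    then have "m + i * h \<in> G" using i(2) by (simp add: G_def)
    moreover have "m = (m + i * h) - i * h" by simp
    ultimately show "m \<in> (\<Union>i\<in>{..k}. (\<lambda>g. g - i * h) ` G)" using i(1) by blast
  qed
  have "M - k * h = card {1..M - k * h}" by simp
  also have "\<dots> \<le> card (\<Union>i\<in>{..k}. (\<lambda>g. g - i * h) ` G)" using fin by (intro card_mono cover) auto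
  also have "\<dots> \<le> (\<Sum>i\<in>{..k}. card ((\<lambda>g. g - i * h) ` G))" by (rule card_UN_le) simp
  also have "\<dots> \<le> (\<Sum>i\<in>{..k}. card G)" by (intro sum_mono card_image_le fin)
  finally have "M - k * h \<le> (k + 1) * card G" by simp
  then have "real (M - k * h) \<le> (real k + 1) * real (card G)"
    by (metis of_nat_1 of_nat_add of_nat_le_iff of_nat_mult)
  moreover have "real (M - k * h) \<ge> real M / 2"
  proof -
    have "2 * (real k * real h) \<le> real M" using h by (metis mult.assoc of_nat_le_iff of_nat_mult of_nat_numeral)
    then show ?thesis using h by (simp add: of_nat_diff)
  qed
  ultimately have "real M / 2 \<le> (real k + 1) * real (card G)" by linarith
  then show ?thesis by (simp add: G_def field_simps)
qed

text \<open>For m congruent to 1 modulo q, m^k is also congruent to 1, so q m^k t equals 2 pi a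
  modulo 2 pi q up to the error m^k \<beta>. If m^k t were near 2 pi Z, a nonzero multiple of 2 pi
  would have modulus at most 2; it is nonzero because q does not divide a.\<close>

lemma card_not_near_residue:
  assumes q: "q > 0" and "k > 0" and qt: "real q * t = 2 * pi * of_int a + \<beta>" and a: "\<not> int q dvd a"
    and \<beta>: "real M ^ k * \<bar>\<beta>\<bar> \<le> 1" and \<delta>: "\<delta> \<le> 1 / real q" "\<delta> \<ge> 0" and M: "M \<ge> 2 * q"
  shows "real M / (2 * real q) \<le> real (card {m\<in>{1..M}. \<not> near_circle \<delta> (real m ^ k * t)})"
proof -
  define G where "G = {m\<in>{1..M}. \<not> near_circle \<delta> (real m ^ k * t)}"
  have "(\<lambda>s. 1 + q * s) ` {..<M div q} \<subseteq> G"
  proof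
    fix m assume "m \<in> (\<lambda>s. 1 + q * s) ` {..<M div q}"
    then obtain s where s: "s < M div q" "m = 1 + q * s" by auto
    have "q * Suc s \<le> q * (M div q)" using s by (intro mult_le_mono2) auto
    also have "\<dots> \<le> M" by simp
    finally have mM: "m \<le> M" using s q by simp
    have "[int m ^ k = 1 ^ k] (mod int q)" by (intro cong_pow) (simp add: s cong_def)
    then have "int q dvd int m ^ k - 1" by (simp add: cong_iff_dvd_diff)
    then obtain u where "int m ^ k - 1 = int q * u" by (elim dvdE)
    then have u: "int m ^ k = 1 + int q * u" by simp
    have "\<not> near_circle \<delta> (real m ^ k * t)"
    proof
      assume "near_circle \<delta> (real m ^ k * t)"
      then obtain n where n: "\<bar>real m ^ k * t - 2 * pi * of_int n\<bar> \<le> \<delta>" by (auto simp: near_circle_def)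
      have rm: "real m ^ k = 1 + real q * of_int u" using arg_cong[OF u, of real_of_int] by simp
      have "real q * (real m ^ k * t - 2 * pi * of_int n) = real m ^ k * (real q * t) - 2 * pi * (real q * of_int n)"
        by (simp add: algebra_simps)
      also have "\<dots> = real m ^ k * (2 * pi * of_int a + \<beta>) - 2 * pi * (real q * of_int n)" by (simp only: qt)
      also have "real m ^ k * (2 * pi * of_int a + \<beta>) = 2 * pi * of_int a + 2 * pi * (real q * of_int (u * a)) + real m ^ k * \<beta>"
        by (simp add: rm algebra_simps)
      finally have e: "2 * pi * of_int (a + int q * (u * a - n)) = real q * (real m ^ k * t - 2 * pi * of_int n) - real m ^ k * \<beta>"
        by (simp add: algebra_simps)
      have "\<bar>real q * (real m ^ k * t - 2 * pi * of_int n)\<bar> \<le> real q * (1 / real q)"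
        unfolding abs_mult using n \<delta> by (intro mult_mono) auto
      then have b1: "\<bar>real q * (real m ^ k * t - 2 * pi * of_int n)\<bar> \<le> 1" using q by simp
      have "\<bar>real m ^ k * \<beta>\<bar> \<le> real M ^ k * \<bar>\<beta>\<bar>" unfolding abs_mult using mM by (intro mult_right_mono) (auto intro: power_mono)
      then have "\<bar>2 * pi * of_int (a + int q * (u * a - n))\<bar> \<le> 2" using e b1 \<beta> by linarith
      moreover have "a + int q * (u * a - n) \<noteq> 0"
      proof
        assume "a + int q * (u * a - n) = 0"
        then have "a = int q * (n - u * a)" by (simp add: algebra_simps)
        then show False using a by (metis dvd_triv_left)
      qed
      then have "1 \<le> \<bar>real_of_int (a + int q * (u * a - n))\<bar>" by linarith
      then have "2 * pi * 1 \<le> \<bar>2 * pi * of_int (a + int q * (u * a - n))\<bar>"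
        unfolding abs_mult by (intro mult_mono) auto
      ultimately show False using pi_gt3 by linarith
    qed
    then show "m \<in> G" using mM s by (simp add: G_def)
  qed
  moreover have "finite G" by (simp add: G_def)
  ultimately have "card ((\<lambda>s. 1 + q * s) ` {..<M div q}) \<le> card G" by (intro card_mono)
  moreover have "inj_on (\<lambda>s. 1 + q * s) {..<M div q}" using q by (auto simp: inj_on_def)
  ultimately have "M div q \<le> card G" by (simp add: card_image)
  moreover have "real M / (2 * real q) \<le> real (M div q)"
  proof -
    have "M div q \<ge> 1" using M q by (simp add: div_greater_zero_iff Suc_leI)
    then have "q * 1 \<le> q * (M div q)" by (rule mult_le_mono2)
    moreover have "M = q * (M div q) + M mod q" "M mod q < q" using q by auto
    ultimately have "M \<le> 2 * (q * (M div q))" by linarith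
    then have "real M \<le> 2 * (real q * real (M div q))" by (metis of_nat_le_iff of_nat_mult of_nat_numeral)
    then show ?thesis using q by (simp add: field_simps)
  qed
  ultimately show ?thesis unfolding G_def by linarith
qed

text \<open>Three cases, with q = k! and q t = 2 pi a + \<beta>. If q t is not near 2 pi Z,
  differences with step 1 suffice. If |\<beta>| \<ge> c1 / X, the step q h has k-th difference (q
  h)^k \<beta> modulo 2 pi, and h is stretched until this has constant size. If |\<beta>| < c1 / X,
  then q cannot divide a, since t would lie within U / X of 0 or too close to a nonzero multiple of
  2 pi; the residue class 1 modulo q then supplies the values.\<close>

lemma minor_arc_count:
  assumes k: "k \<ge> 1" and U: "U > 0"
  shows "\<exists>\<delta> \<eta> M0. 0 < \<delta> \<and> \<delta> \<le> pi \<and> 0 < \<eta> \<and> (\<forall>M\<ge>M0. \<forall>X t. real M ^ k \<le> X \<and> X \<le> (2 * real M) ^ k \<and> U / X \<le> \<bar>t\<bar> \<and> \<bar>t\<bar> \<le> pi \<longrightarrow>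
     \<eta> * real M \<le> real (card {m\<in>{1..M}. \<not> near_circle \<delta> (real m ^ k * t)}))"
proof -
  define q :: nat where "q = fact k"
  have q: "q \<ge> 1" by (simp add: q_def fact_ge_1)
  have qr: "real q = fact k" by (simp add: q_def)
  define c1 where "c1 = min U 1"
  have c1: "0 < c1" "c1 \<le> U" "c1 \<le> 1" using U by (auto simp: c1_def)
  \<comment> \<open>The choice makes B = q^k |\<beta>| below at most 3 < pi, so that h = 1 is an
    admissible multiplier.\<close>
  define \<epsilon>0 where "\<epsilon>0 = 3 / real q ^ k"
  have qk: "real q ^ k \<ge> 1" using q by (intro one_le_power) simp
  have qk_pos: "real q ^ k > 0" using qk by linarith
  have \<epsilon>0: "0 < \<epsilon>0" "\<epsilon>0 \<le> 3"
    using divide_left_mono[OF qk, of 3] divide_pos_pos[of 3, OF _ qk_pos] qk_pos by (simp_all add: \<epsilon>0_def)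
  \<comment> \<open>A lower bound for B h^k at the largest admissible h: the first value applies
    when h + 1 would overshoot pi, the second when h is stopped by its limit H, which is at least M
    / (4 k q).\<close>
  define \<epsilon>1 where "\<epsilon>1 = min (pi / 2 ^ k) (c1 / (8 * real k) ^ k)"
  have "pi / 2 ^ k \<le> pi / 1" by (intro divide_left_mono) auto
  then have \<epsilon>1: "0 < \<epsilon>1" "\<epsilon>1 \<le> pi" using c1 k by (auto simp: \<epsilon>1_def)
  \<comment> \<open>The three limits serve the three cases: step 1, step q h, and the residue
    class.\<close>
  define \<delta> where "\<delta> = min (min (\<epsilon>0 / 2 ^ k) (\<epsilon>1 / 2 / 2 ^ k)) (1 / real q)"
  define \<eta> where "\<eta> = min (1 / (2 * (real k + 1))) (1 / (2 * real q))"
  have \<delta>0: "0 < \<delta>" using \<epsilon>0 \<epsilon>1 q by (simp add: \<delta>_def)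
  have \<delta>q: "\<delta> \<le> 1 / real q" "2 ^ k * \<delta> \<le> \<epsilon>0" "2 ^ k * \<delta> \<le> \<epsilon>1 / 2"
  proof -
    have "\<delta> \<le> \<epsilon>0 / 2 ^ k" "\<delta> \<le> \<epsilon>1 / 2 / 2 ^ k" by (auto simp: \<delta>_def)
    then show "2 ^ k * \<delta> \<le> \<epsilon>0" "2 ^ k * \<delta> \<le> \<epsilon>1 / 2" by (simp_all add: field_simps)
  qed (simp add: \<delta>_def)
  have "1 / real q \<le> 1" using q by simp
  then have \<delta>pi: "\<delta> \<le> pi" using \<delta>q pi_gt3 by linarith
  have \<eta>: "0 < \<eta>" using q by (simp add: \<eta>_def)
  have main: "\<eta> * real M \<le> real (card {m\<in>{1..M}. \<not> near_circle \<delta> (real m ^ k * t)})"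
    if M: "M \<ge> 2 * k * q" and X: "real M ^ k \<le> X" "X \<le> (2 * real M) ^ k" and t: "U / X \<le> t" "t \<le> pi" for M X t
  proof -
    have M0: "real M > 0" using M k q by (cases M) auto
    have X0: "X > 0" using X(1) M0 zero_less_power[of "real M" k] by linarith
    have \<eta>1: "\<eta> * real M \<le> real M / (2 * (real k + 1))"
    proof -
      have "\<eta> * real M \<le> 1 / (2 * (real k + 1)) * real M" by (intro mult_right_mono) (auto simp: \<eta>_def)
      then show ?thesis by simp
    qed
    have \<eta>2: "\<eta> * real M \<le> real M / (2 * real q)"
    proof -
      have "\<eta> * real M \<le> 1 / (2 * real q) * real M" by (intro mult_right_mono) (auto simp: \<eta>_def)
      then show ?thesis by simp
    qed
    have "U / X > 0" using U X0 by simp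
    then have t0: "t > 0" using t by linarith
    show ?thesis
    proof (cases "near_circle \<epsilon>0 (real q * t)")
      case False
      have "2 * k * 1 \<le> 2 * k * q" using q by (intro mult_le_mono2)
      then have "2 * k * 1 \<le> M" using M by linarith
      moreover have "\<not> near_circle \<epsilon>0 (fact k * real 1 ^ k * t)" using False by (simp add: qr)
      ultimately show ?thesis using card_not_near_step[of k 1 M \<epsilon>0 t \<delta>] \<delta>q \<eta>1 by linarith
    next
      case True
      then obtain a where a: "\<bar>real q * t - 2 * pi * of_int a\<bar> \<le> \<epsilon>0" by (auto simp: near_circle_def)
      define \<beta> where "\<beta> = real q * t - 2 * pi * of_int a"
      have qt: "real q * t = 2 * pi * of_int a + \<beta>" by (simp add: \<beta>_def)
      have \<beta>: "\<bar>\<beta>\<bar> \<le> \<epsilon>0" using a by (simp add: \<beta>_def)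
      show ?thesis
      proof (cases "\<bar>\<beta>\<bar> \<ge> c1 / X")
        case True
        define B where "B = real q ^ k * \<bar>\<beta>\<bar>"
        have B3: "B \<le> 3"
        proof -
          have "B \<le> real q ^ k * \<epsilon>0" unfolding B_def using \<beta> by (intro mult_left_mono) auto
          moreover have "real q ^ k * \<epsilon>0 = 3" using less_imp_neq[OF qk_pos] by (simp only: \<epsilon>0_def) simp
          ultimately show ?thesis by simp
        qed
        have B0: "B \<ge> 0" by (simp add: B_def)
        define D where "D = 2 * k * q"
        have D: "D > 0" using k q by (simp add: D_def)
        define H where "H = M div D"
        have H: "H \<ge> 1" using M D by (simp add: H_def D_def div_greater_zero_iff Suc_leI)
        have DH: "D * H \<le> M" by (simp add: H_def)
        have MH: "real M \<le> 2 * (real D * real H)"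
        proof -
          have "D * 1 \<le> D * H" using H by (rule mult_le_mono2)
          moreover have "M = D * H + M mod D" "M mod D < D" using D by (auto simp: H_def)
          ultimately have "M \<le> 2 * (D * H)" by linarith
          then show ?thesis by (metis of_nat_le_iff of_nat_mult of_nat_numeral)
        qed
        define S where "S = {h. 1 \<le> h \<and> h \<le> H \<and> B * real h ^ k \<le> pi}"
        have S: "finite S" "1 \<in> S" using H B3 pi_gt3 by (auto simp: S_def intro: finite_subset[of _ "{..H}"])
        define h where "h = Max S"
        have "h \<in> S" unfolding h_def using S by (intro Max_in) auto
        then have h: "1 \<le> h" "h \<le> H" "B * real h ^ k \<le> pi" by (auto simp: S_def)
        have Bh: "B * real h ^ k \<ge> \<epsilon>1"
        proof (cases "h = H")
          case True
          have "c1 / (8 * real k) ^ k = real q ^ k * (c1 / (2 * real M) ^ k) * (real M / (4 * real k * real q)) ^ k"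
            using M0 q k by (simp add: power_mult_distrib power_divide) (simp add: field_simps power_mult_distrib[symmetric])
          also have "\<dots> \<le> real q ^ k * (c1 / X) * real H ^ k"
          proof (intro mult_mono power_mono divide_left_mono)
            show "real M / (4 * real k * real q) \<le> real H" using MH k q by (simp add: D_def field_simps)
          qed (use X X0 M0 c1 in auto)
          also have "\<dots> \<le> real q ^ k * \<bar>\<beta>\<bar> * real H ^ k"
            using \<open>\<bar>\<beta>\<bar> \<ge> c1 / X\<close> by (intro mult_right_mono mult_left_mono) auto
          finally show ?thesis using True by (simp add: B_def \<epsilon>1_def)
        next
          case False
          have "Suc h \<notin> S" using Max_ge[OF S(1), of "Suc h"] by (auto simp: h_def[symmetric])
          then have "pi < B * real (Suc h) ^ k" using False h by (auto simp: S_def)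
          also have "\<dots> \<le> B * (2 * real h) ^ k" using h B0 by (intro mult_left_mono power_mono) auto
          finally have "pi / 2 ^ k \<le> B * real h ^ k" by (simp add: power_mult_distrib field_simps)
          then show ?thesis by (simp add: \<epsilon>1_def)
        qed
        have not: "\<not> near_circle (\<epsilon>1 / 2) (B * real h ^ k)"
          using Bh h(3) \<epsilon>1 by (intro not_near_circle_between[of \<epsilon>1]) auto
        have "fact k * real (q * h) ^ k * t = real (q * h) ^ k * (real q * t)" by (simp add: qr)
        also have "\<dots> = real q ^ k * real h ^ k * \<beta> + 2 * pi * of_int (a * int (q * h) ^ k)"
          unfolding qt by (simp add: algebra_simps power_mult_distrib)
        finally have e: "fact k * real (q * h) ^ k * t = real q ^ k * real h ^ k * \<beta> + 2 * pi * of_int (a * int (q * h) ^ k)" .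
        have "\<not> near_circle (\<epsilon>1 / 2) (fact k * real (q * h) ^ k * t)"
        proof (cases "\<beta> \<ge> 0")
          case True
          then have eq: "real q ^ k * real h ^ k * \<beta> = B * real h ^ k" by (simp add: B_def)
          show ?thesis using not unfolding e near_circle_add_period eq .
        next
          case False
          then have eq: "real q ^ k * real h ^ k * \<beta> = - (B * real h ^ k)" by (simp add: B_def)
          show ?thesis using not unfolding e near_circle_add_period eq near_circle_minus .
        qed
        moreover have "2 * k * (q * h) \<le> M"
        proof -
          have "D * h \<le> D * H" using h by (intro mult_le_mono2)
          then have "D * h \<le> M" using DH by (rule order_trans)
          then show ?thesis by (simp only: D_def mult.assoc)
        qed
        ultimately show ?thesis using card_not_near_step[of k "q * h" M "\<epsilon>1 / 2" t \<delta>] \<delta>q \<eta>1 by linarith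
      next
        case False
        have "\<not> int q dvd a"
        proof
          assume "int q dvd a"
          then obtain n where n: "a = int q * n" by (elim dvdE)
          have "real q * (t - 2 * pi * of_int n) = \<beta>" unfolding \<beta>_def n by (simp add: algebra_simps)
          then have tb: "real q * \<bar>t - 2 * pi * of_int n\<bar> = \<bar>\<beta>\<bar>" by (metis abs_mult abs_of_nat)
          moreover have "1 * \<bar>t - 2 * pi * of_int n\<bar> \<le> real q * \<bar>t - 2 * pi * of_int n\<bar>" using q by (intro mult_right_mono) auto
          ultimately have tn: "\<bar>t - 2 * pi * of_int n\<bar> \<le> \<bar>\<beta>\<bar>" by simp
          have "c1 / X \<le> U / X" using c1 X0 by (intro divide_right_mono) auto
          consider "n = 0" | "n \<ge> 1" | "n \<le> -1" by linarith
          then show False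
          proof cases
            case 1
            then show ?thesis using tn False t t0 \<open>c1 / X \<le> U / X\<close> by simp
          next
            case 2
            then have "2 * pi * 1 \<le> 2 * pi * of_int n" by (intro mult_left_mono) auto
            then show ?thesis using tn t \<beta> \<epsilon>0 pi_gt3 by linarith
          next
            case 3
            then have "2 * pi * of_int n \<le> 2 * pi * (- 1)" by (intro mult_left_mono) auto
            then show ?thesis using tn t0 \<beta> \<epsilon>0 pi_gt3 by linarith
          qed
        qed
        moreover have "real M ^ k * \<bar>\<beta>\<bar> \<le> 1"
        proof -
          have "real M ^ k * \<bar>\<beta>\<bar> \<le> X * (c1 / X)" using X X0 False by (intro mult_mono) auto
          then show ?thesis using X0 c1 by simp
        qed
        moreover have "2 * q \<le> M"
        proof -
          have "1 * (2 * q) \<le> k * (2 * q)" using k by (intro mult_le_mono1)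
          then show ?thesis using M by linarith
        qed
        ultimately show ?thesis
          using card_not_near_residue[of q k t a \<beta> M \<delta>] qt q k \<delta>q \<delta>0 \<eta>2 by linarith
      qed
    qed
  qed
  have "\<eta> * real M \<le> real (card {m\<in>{1..M}. \<not> near_circle \<delta> (real m ^ k * t)})"
    if "M \<ge> 2 * k * q" "real M ^ k \<le> X" "X \<le> (2 * real M) ^ k" "U / X \<le> \<bar>t\<bar>" "\<bar>t\<bar> \<le> pi" for M X t
  proof (cases "t \<ge> 0")
    case False
    have "near_circle \<delta> (real m ^ k * t) \<longleftrightarrow> near_circle \<delta> (real m ^ k * \<bar>t\<bar>)" for m
      using False near_circle_minus[of \<delta> "real m ^ k * t"] by simp
    then show ?thesis using main[OF that] by simp
  qed (use main[of M X t] that in auto)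
  then show ?thesis using \<delta>0 \<delta>pi \<eta> by blast
qed

text \<open>After expansion of both logarithms every term x^j - Re (y^j) with x = |y| is
  non-negative; only j = 1 is kept.\<close>

lemma Re_euler_log_diff:
  assumes "Re z > 0"
  shows "exp (- Re z) * (1 - cos (Im z)) \<le> Re (euler_log (of_real (Re z))) - Re (euler_log z)"
proof -
  define y where "y = exp (- z)"
  define x where "x = exp (- Re z)"
  have x: "0 < x" "x < 1" using assms by (auto simp: x_def)
  have ny: "norm y = x" by (simp add: y_def x_def)
  have xe: "exp (- complex_of_real (Re z)) = of_real x" by (simp add: x_def exp_of_real[symmetric])
  have s1: "(\<lambda>j. Re (y ^ Suc j / of_nat (Suc j))) sums Re (euler_log z)"
    unfolding euler_log_def y_def[symmetric] using ny x by (intro sums_Re Ln_one_minus_sums) simp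
  have s2: "(\<lambda>j. Re (of_real x ^ Suc j / of_nat (Suc j))) sums Re (euler_log (of_real (Re z)))"
    unfolding euler_log_def xe using x by (intro sums_Re Ln_one_minus_sums) simp
  have re: "Re (u / of_nat (Suc j)) = Re u / real (Suc j)" for u j
    by (metis Re_divide_of_real of_real_of_nat_eq)
  have s: "(\<lambda>j. (x ^ Suc j - Re (y ^ Suc j)) / real (Suc j)) sums (Re (euler_log (of_real (Re z))) - Re (euler_log z))"
    using sums_diff[OF s2 s1] unfolding re by (simp add: diff_divide_distrib flip: of_real_power of_real_mult)
  have nn: "0 \<le> (x ^ Suc j - Re (y ^ Suc j)) / real (Suc j)" for j
  proof -
    have "Re (y ^ Suc j) \<le> x ^ Suc j" using complex_Re_le_cmod[of "y ^ Suc j"] by (simp only: norm_power ny)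
    then show ?thesis by simp
  qed
  have "(\<Sum>j\<in>{0}. (x ^ Suc j - Re (y ^ Suc j)) / real (Suc j)) \<le> (\<Sum>j. (x ^ Suc j - Re (y ^ Suc j)) / real (Suc j))"
    using s nn by (intro sum_le_suminf) (auto simp: sums_iff)
  moreover have "x - Re y = exp (- Re z) * (1 - cos (Im z))"
    by (simp add: x_def y_def Re_exp algebra_simps)
  ultimately show ?thesis using s by (simp add: sums_iff)
qed

text \<open>A counted m is at most s = X^(1/k), so m^k / X is at most 1, and its cosine is at most
  cos \<delta>; it therefore lowers the logarithm by at least exp (- 1) (1 - cos \<delta>), while no
  other m raises it. With M the floor of s, the inequality s \<le> 2 M accounts for the factor 1/2
  in c.\<close>

lemma minor_arc_bound:
  assumes k: "k \<ge> 1" and U: "U > 0"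
  shows "\<exists>c X0. c > 0 \<and> (\<forall>X\<ge>X0. \<forall>t. U / X \<le> \<bar>t\<bar> \<and> \<bar>t\<bar> \<le> pi \<longrightarrow>
     Re (log_gf k (Complex (1 / X) t)) \<le> Re (log_gf k (of_real (1 / X))) - c * X powr (1 / real k))"
proof -
  obtain \<delta> \<eta> M0 where \<delta>: "0 < \<delta>" "\<delta> \<le> pi" and \<eta>: "0 < \<eta>"
    and count: "\<And>M X t. M \<ge> M0 \<Longrightarrow> real M ^ k \<le> X \<Longrightarrow> X \<le> (2 * real M) ^ k \<Longrightarrow> U / X \<le> \<bar>t\<bar> \<Longrightarrow> \<bar>t\<bar> \<le> pi \<Longrightarrow>
     \<eta> * real M \<le> real (card {m\<in>{1..M}. \<not> near_circle \<delta> (real m ^ k * t)})"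
    using minor_arc_count[OF assms] by blast
  define c where "c = \<eta> / 2 * (exp (- 1) * (1 - cos \<delta>))"
  have "cos \<delta> < 1" using \<delta> cos_monotone_0_pi[of 0 \<delta>] by simp
  then have c: "c > 0" using \<eta> by (simp add: c_def)
  have "Re (log_gf k (Complex (1 / X) t)) \<le> Re (log_gf k (of_real (1 / X))) - c * X powr (1 / real k)"
    if X: "X \<ge> (real M0 + 1) ^ k" and t: "U / X \<le> \<bar>t\<bar>" "\<bar>t\<bar> \<le> pi" for X t
  proof -
    have X1: "X \<ge> 1"
    proof -
      have "1 \<le> (real M0 + 1) ^ k" by (intro one_le_power) simp
      then show ?thesis using X by linarith
    qed
    define s where "s = X powr (1 / real k)"
    have sk: "s ^ k = X" using X1 k by (simp add: s_def powr_realpow[symmetric] powr_powr)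
    have s0: "s \<ge> 0" by (simp add: s_def)
    have sM: "real M0 + 1 \<le> s"
    proof (rule ccontr)
      assume "\<not> real M0 + 1 \<le> s"
      then have "s ^ k < (real M0 + 1) ^ k" using s0 k by (intro power_strict_mono) auto
      then show False using X sk by simp
    qed
    define M where "M = nat \<lfloor>s\<rfloor>"
    have M: "real M \<le> s" "s < real M + 1" using s0 by (auto simp: M_def)
    have "M \<ge> M0" "real M > 0" using sM M by linarith+
    then have "real M \<ge> 1" by simp
    then have s2: "s \<le> 2 * real M" using M by linarith
    have "real M ^ k \<le> X" using power_mono[OF M(1), of k] sk by simp
    moreover have "X \<le> (2 * real M) ^ k" using power_mono[OF s2 s0, of k] sk by simp
    ultimately have cnt: "\<eta> * real M \<le> real (card {m\<in>{1..M}. \<not> near_circle \<delta> (real m ^ k * t)})"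
      using count \<open>M \<ge> M0\<close> t by blast
    define G where "G = {m\<in>{1..M}. \<not> near_circle \<delta> (real m ^ k * t)}"
    define w where "w = Complex (1 / X) t"
    define d where "d = (\<lambda>m. Re (euler_log (of_nat (Suc m) ^ k * of_real (1 / X))) - Re (euler_log (of_nat (Suc m) ^ k * w)))"
    have ds: "d sums (Re (log_gf k (of_real (1 / X))) - Re (log_gf k w))"
      unfolding d_def using X1 k by (intro sums_diff sums_Re log_gf_sums) (auto simp: w_def)
    have dge: "exp (- (real (Suc m) ^ k / X)) * (1 - cos (real (Suc m) ^ k * t)) \<le> d m" for m
    proof -
      define z where "z = of_nat (Suc m) ^ k * w"
      have z: "Re z = real (Suc m) ^ k / X" "Im z = real (Suc m) ^ k * t"
      proof -
        have "z = of_real (real (Suc m) ^ k) * w" by (simp add: z_def)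
        then show "Re z = real (Suc m) ^ k / X" "Im z = real (Suc m) ^ k * t"
          by (simp_all only: times_complex.sel Re_complex_of_real Im_complex_of_real w_def complex.sel) simp_all
      qed
      have "Re z > 0" unfolding z using X1 by (intro divide_pos_pos zero_less_power) auto
      from Re_euler_log_diff[OF this]
      have "exp (- (real (Suc m) ^ k / X)) * (1 - cos (real (Suc m) ^ k * t)) \<le> Re (euler_log (of_real (real (Suc m) ^ k / X))) - Re (euler_log z)"
        unfolding z .
      moreover have "complex_of_real (real (Suc m) ^ k / X) = of_nat (Suc m) ^ k * of_real (1 / X)" by simp
      ultimately show ?thesis unfolding d_def z_def by (simp only:)
    qed
    have d0: "0 \<le> d m" for m
    proof -
      have "0 \<le> exp (- (real (Suc m) ^ k / X)) * (1 - cos (real (Suc m) ^ k * t))" by simp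
      then show ?thesis using dge[of m] by linarith
    qed
    have dG: "exp (- 1) * (1 - cos \<delta>) \<le> d (g - 1)" if g: "g \<in> G" for g
    proof -
      have g1: "1 \<le> g" "g \<le> M" "\<not> near_circle \<delta> (real g ^ k * t)" using g by (auto simp: G_def)
      have "real g ^ k \<le> X" using g1 M s0 sk power_mono[of "real g" s k] by simp
      then have "real g ^ k / X \<le> 1" using X1 by simp
      then have "exp (- 1) * (1 - cos \<delta>) \<le> exp (- (real g ^ k / X)) * (1 - cos (real g ^ k * t))"
        using cos_le_if_not_near[OF g1(3)] \<delta> by (intro mult_mono) auto
      then show ?thesis using dge[of "g - 1"] g1 by simp
    qed
    have fin: "finite G" by (simp add: G_def)
    have "real (card G) * (exp (- 1) * (1 - cos \<delta>)) \<le> (\<Sum>g\<in>G. d (g - 1))"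
      using sum_mono[of G "\<lambda>_. exp (- 1) * (1 - cos \<delta>)" "\<lambda>g. d (g - 1)"] dG by simp
    also have "\<dots> = (\<Sum>m\<in>(\<lambda>g. g - 1) ` G. d m)"
      by (subst sum.reindex) (auto simp: inj_on_def G_def)
    also have "\<dots> \<le> suminf d" using ds d0 fin by (intro sum_le_suminf) (auto simp: sums_iff)
    also have "suminf d = Re (log_gf k (of_real (1 / X))) - Re (log_gf k w)" using ds by (simp add: sums_iff)
    finally have A: "real (card G) * (exp (- 1) * (1 - cos \<delta>)) \<le> Re (log_gf k (of_real (1 / X))) - Re (log_gf k w)" .
    have "\<eta> * (s / 2) \<le> \<eta> * real M" using s2 \<eta> by (intro mult_left_mono) auto
    then have "\<eta> * (s / 2) \<le> real (card G)" using cnt by (simp add: G_def)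
    then have "\<eta> * (s / 2) * (exp (- 1) * (1 - cos \<delta>)) \<le> real (card G) * (exp (- 1) * (1 - cos \<delta>))"
      by (intro mult_right_mono) auto
    then have "c * s \<le> real (card G) * (exp (- 1) * (1 - cos \<delta>))" by (simp add: c_def mult_ac)
    then show ?thesis using A by (simp add: w_def s_def)
  qed
  then show ?thesis using c by blast
qed

section \<open>Laplace's method\<close>

lemma power_le_fact_exp:
  assumes "x \<ge> (0::real)" shows "x ^ n \<le> fact n * exp x"
proof -
  have s: "(\<lambda>n. x ^ n /\<^sub>R fact n) sums exp x" by (rule exp_converges)
  have "(\<Sum>i\<in>{n}. x ^ i /\<^sub>R fact i) \<le> (\<Sum>i. x ^ i /\<^sub>R fact i)"
    using s assms by (intro sum_le_suminf) (auto simp: sums_iff)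
  then show ?thesis using s by (simp add: sums_iff field_simps)
qed

section \<open>Gaussian moments on a finite interval\<close>

definition gaussian_moment :: "real \<Rightarrow> nat \<Rightarrow> real \<Rightarrow> real" where
  "gaussian_moment u i Y = integral {-u..u} (\<lambda>x. x ^ i * exp (- Y * x ^ 2))"

lemma gaussian_has_integral:
  assumes "c > 0" shows "((\<lambda>x. exp (- (c * x ^ 2))) has_integral sqrt pi / 2 / sqrt c) {0<..}"
proof -
  have "((\<lambda>x. exp (- (c * x ^ 2))) has_integral Gamma (1 / real 2) / real 2 * c powr (- 1 / real 2)) {0<..}"
    using assms by (intro exp_power_integral) auto
  moreover have "c powr (- 1 / real 2) = 1 / sqrt c"
    using assms by (simp add: powr_minus powr_half_sqrt inverse_eq_divide)
  ultimately show ?thesis by (simp add: Gamma_one_half_real mult.commute)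
qed

lemma gaussian_integral_le:
  assumes c: "c > 0" and u: "u \<ge> 0"
  shows "integral {-u..u} (\<lambda>x. exp (- (c * x ^ 2))) \<le> sqrt pi / sqrt c"
    and "integral {-u..u} (\<lambda>x. exp (- (c * x ^ 2))) = 2 * integral {0..u} (\<lambda>x. exp (- (c * x ^ 2)))"
    and "integral {0..u} (\<lambda>x. exp (- (c * x ^ 2))) \<le> sqrt pi / 2 / sqrt c"
    and "sqrt pi / 2 / sqrt c - integral {0..u} (\<lambda>x. exp (- (c * x ^ 2))) \<le> exp (- (c * u ^ 2 / 2)) * sqrt pi / sqrt c"
proof -
  let ?f = "\<lambda>x. exp (- (c * x ^ 2))"
  have int: "?f integrable_on {a..b}" for a b by (intro integrable_continuous_interval continuous_intros)
  have "integral {-u..u} ?f = integral {-u..0} ?f + integral {0..u} ?f"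
    using u by (intro Henstock_Kurzweil_Integration.integral_combine[symmetric] int) auto
  also have "integral {-u..0} ?f = integral {0..u} ?f"
    using Henstock_Kurzweil_Integration.integral_reflect_real[of u 0 ?f] by simp
  finally show e: "integral {-u..u} ?f = 2 * integral {0..u} ?f" by simp
  have half: "(?f has_integral sqrt pi / 2 / sqrt c) {0<..}" by (rule gaussian_has_integral[OF c])
  have i0: "(?f has_integral integral {0..u} ?f) {0<..u}"
  proof -
    have "(?f has_integral integral {0..u} ?f) {0..u}" using int by blast
    moreover have "negligible {x \<in> {0..u} - {0<..u}. ?f x \<noteq> 0}" "negligible {x \<in> {0<..u} - {0..u}. ?f x \<noteq> 0}"
      by (rule negligible_subset[of "{0}"], auto)+
    ultimately show ?thesis using has_integral_spike_set_eq[of "{0..u}" "{0<..u}" ?f] by blast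
  qed
  show le: "integral {0..u} ?f \<le> sqrt pi / 2 / sqrt c"
    by (rule has_integral_subset_le[OF _ i0 half]) auto
  show "integral {-u..u} ?f \<le> sqrt pi / sqrt c" using e le by simp
  have rest: "((\<lambda>x. if x \<le> u then 0 else ?f x) has_integral (sqrt pi / 2 / sqrt c - integral {0..u} ?f)) {0<..}"
  proof -
    have "((\<lambda>x. if x \<in> {0<..u} then ?f x else 0) has_integral integral {0..u} ?f) {0<..}"
      using i0 by (subst has_integral_restrict) auto
    from has_integral_diff[OF half this]
    show ?thesis by (rule has_integral_eq[rotated]) auto
  qed
  \<comment> \<open>On the tail x > u one half of the exponent is at least c u^2 / 2, and the other
    half stays integrable.\<close>
  have "((\<lambda>x. exp (- (c * u ^ 2 / 2)) * exp (- ((c / 2) * x ^ 2))) has_integral exp (- (c * u ^ 2 / 2)) * (sqrt pi / 2 / sqrt (c / 2))) {0<..}"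
    using c by (intro has_integral_mult_right gaussian_has_integral) simp
  then have "sqrt pi / 2 / sqrt c - integral {0..u} ?f \<le> exp (- (c * u ^ 2 / 2)) * (sqrt pi / 2 / sqrt (c / 2))"
  proof (rule has_integral_le[OF rest])
    fix x :: real assume "x \<in> {0<..}"
    show "(if x \<le> u then 0 else ?f x) \<le> exp (- (c * u ^ 2 / 2)) * exp (- ((c / 2) * x ^ 2))"
    proof (cases "x \<le> u")
      case False
      then have "u ^ 2 \<le> x ^ 2" using u by (intro power_mono) auto
      then have "c * u ^ 2 \<le> c * x ^ 2" using c by (intro mult_left_mono) auto
      then have "?f x \<le> exp (- (c * u ^ 2 / 2) + - ((c / 2) * x ^ 2))" by simp
      then show ?thesis using False by (simp only: exp_add) simp
    qed simp
  qed
  also have "sqrt pi / 2 / sqrt (c / 2) \<le> sqrt pi / sqrt c"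
  proof -
    have "sqrt pi / 2 / sqrt (c / 2) = sqrt pi / sqrt c * (sqrt 2 / 2)" by (simp add: real_sqrt_divide)
    also have "\<dots> \<le> sqrt pi / sqrt c * 1"
      using real_sqrt_le_mono[of 2 4] c by (intro mult_left_mono) auto
    finally show ?thesis by simp
  qed
  finally show "sqrt pi / 2 / sqrt c - integral {0..u} ?f \<le> exp (- (c * u ^ 2 / 2)) * sqrt pi / sqrt c"
    by (simp add: mult_left_mono)
qed

lemma gaussian_moment_odd: "odd i \<Longrightarrow> gaussian_moment u i Y = 0"
proof -
  assume "odd i"
  then have "integral {-u..u} (\<lambda>x. (- x) ^ i * exp (- Y * (- x) ^ 2)) = - gaussian_moment u i Y"
    by (simp add: gaussian_moment_def)
  moreover have "integral {-u..u} (\<lambda>x. (- x) ^ i * exp (- Y * (- x) ^ 2)) = gaussian_moment u i Y"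
    using Henstock_Kurzweil_Integration.integral_reflect_real[of u "-u" "\<lambda>x. x ^ i * exp (- Y * x ^ 2)"] by (simp add: gaussian_moment_def)
  ultimately show ?thesis by simp
qed

text \<open>The derivative of x^(i+1) exp (- Y x^2) is integrated over [-u, u].\<close>

lemma gaussian_moment_rec:
  assumes Y: "Y > 0" and u: "u \<ge> 0"
  shows "gaussian_moment u (i + 2) Y = (real i + 1) / (2 * Y) * gaussian_moment u i Y
     - (u ^ (i + 1) - (- u) ^ (i + 1)) * exp (- Y * u ^ 2) / (2 * Y)"
proof -
  let ?F = "\<lambda>x. x ^ (i + 1) * exp (- Y * x ^ 2)"
  have int: "(\<lambda>x. x ^ j * exp (- Y * x ^ 2)) integrable_on {a..b}" for j a b
    by (intro integrable_continuous_interval continuous_intros)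
  have "((\<lambda>x. (real i + 1) * (x ^ i * exp (- Y * x ^ 2)) - (2 * Y) * (x ^ (i + 2) * exp (- Y * x ^ 2))) has_integral (?F u - ?F (- u))) {-u..u}"
  proof (rule fundamental_theorem_of_calculus)
    fix x
    have "((\<lambda>x. x ^ (i + 1)) has_real_derivative real (i + 1) * x ^ i) (at x within {-u..u})"
      using DERIV_power[OF DERIV_ident, where n = "i + 1"] by simp
    moreover have "((\<lambda>x. exp (- Y * x ^ 2)) has_real_derivative exp (- Y * x ^ 2) * (- Y * (2 * x))) (at x within {-u..u})"
      by (auto intro!: derivative_eq_intros)
    ultimately have "(?F has_real_derivative (real (i + 1) * x ^ i * exp (- Y * x ^ 2) + exp (- Y * x ^ 2) * (- Y * (2 * x)) * x ^ (i + 1))) (at x within {-u..u})"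
      by (rule DERIV_mult)
    moreover have "real (i + 1) * x ^ i * exp (- Y * x ^ 2) + exp (- Y * x ^ 2) * (- Y * (2 * x)) * x ^ (i + 1)
      = (real i + 1) * (x ^ i * exp (- Y * x ^ 2)) - (2 * Y) * (x ^ (i + 2) * exp (- Y * x ^ 2))"
      by (simp add: algebra_simps power2_eq_square)
    ultimately show "(?F has_vector_derivative (real i + 1) * (x ^ i * exp (- Y * x ^ 2)) - (2 * Y) * (x ^ (i + 2) * exp (- Y * x ^ 2))) (at x within {-u..u})"
      by (simp only: has_real_derivative_iff_has_vector_derivative)
  qed (use u in simp)
  moreover have "((\<lambda>x. (real i + 1) * (x ^ i * exp (- Y * x ^ 2)) - (2 * Y) * (x ^ (i + 2) * exp (- Y * x ^ 2))) has_integral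
     ((real i + 1) * gaussian_moment u i Y - (2 * Y) * gaussian_moment u (i + 2) Y)) {-u..u}"
    unfolding gaussian_moment_def by (intro has_integral_diff has_integral_mult_right integrable_integral int)
  ultimately have "(real i + 1) * gaussian_moment u i Y - (2 * Y) * gaussian_moment u (i + 2) Y = ?F u - ?F (- u)"
    by (rule has_integral_unique[rotated])
  also have "\<dots> = (u ^ (i + 1) - (- u) ^ (i + 1)) * exp (- Y * u ^ 2)" by (simp only: left_diff_distrib power2_minus)
  finally have "(2 * Y) * gaussian_moment u (i + 2) Y = (real i + 1) * gaussian_moment u i Y - (u ^ (i + 1) - (- u) ^ (i + 1)) * exp (- Y * u ^ 2)"
    by linarith
  then have "gaussian_moment u (i + 2) Y = ((real i + 1) * gaussian_moment u i Y - (u ^ (i + 1) - (- u) ^ (i + 1)) * exp (- Y * u ^ 2)) / (2 * Y)"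
    using Y by (subst eq_divide_eq) (simp add: mult.commute)
  then show ?thesis by (simp only: diff_divide_distrib times_divide_eq_left)
qed

text \<open>The coefficients c are those of the moments on the whole line, generated from sqrt pi by
  the factors (2p + 1) / 2 of the recurrence; the truncation at u and the boundary terms cost only
  exponentially small amounts. The value at p = 0 is recorded because the leading term of the result
  is explicit.\<close>

lemma gaussian_moment_even:
  assumes u: "0 < u" "u \<le> 1"
  shows "\<exists>c C. (p = 0 \<longrightarrow> c = sqrt pi) \<and> (\<forall>Y\<ge>1. \<bar>gaussian_moment u (2 * p) Y - c * Y powr (- 1 / 2 - real p)\<bar> \<le> C * exp (- (Y * u ^ 2 / 2)))"
proof (induction p)
  case 0
  have "\<bar>gaussian_moment u 0 Y - sqrt pi * Y powr (- 1 / 2)\<bar> \<le> 2 * sqrt pi * exp (- (Y * u ^ 2 / 2))" if "Y \<ge> 1" for Y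
  proof -
    have Y: "Y > 0" using that by simp
    have g: "gaussian_moment u 0 Y = 2 * integral {0..u} (\<lambda>x. exp (- (Y * x ^ 2)))"
      using gaussian_integral_le(2)[OF Y, of u] u by (simp add: gaussian_moment_def)
    have p: "Y powr (- 1 / 2) = 1 / sqrt Y"
      using Y by (simp add: powr_minus powr_half_sqrt inverse_eq_divide)
    have "exp (- (Y * u ^ 2 / 2)) * sqrt pi / sqrt Y \<le> exp (- (Y * u ^ 2 / 2)) * sqrt pi / 1"
      using that by (intro divide_left_mono) auto
    then show ?thesis
      using gaussian_integral_le(3,4)[OF Y, of u] u unfolding g p by (simp add: abs_if algebra_simps)
  qed
  then show ?case by (intro exI[of _ "sqrt pi"] exI[of _ "2 * sqrt pi"]) simp
next
  case (Suc p)
  then obtain c C where cC: "\<And>Y. Y \<ge> 1 \<Longrightarrow> \<bar>gaussian_moment u (2 * p) Y - c * Y powr (- 1 / 2 - real p)\<bar> \<le> C * exp (- (Y * u ^ 2 / 2))"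
    by blast
  define m where "m = (real (2 * p) + 1) / 2"
  define C' where "C' = m * C + 1"
  have "\<bar>gaussian_moment u (2 * Suc p) Y - (m * c) * Y powr (- 1 / 2 - real (Suc p))\<bar> \<le> C' * exp (- (Y * u ^ 2 / 2))" if Y: "Y \<ge> 1" for Y
  proof -
    define B where "B = (u ^ (2 * p + 1) - (- u) ^ (2 * p + 1)) * exp (- Y * u ^ 2) / (2 * Y)"
    have pw: "Y powr (- 1 / 2 - real (Suc p)) = Y powr (- 1 / 2 - real p) / Y"
    proof -
      have "- 1 / 2 - real (Suc p) = (- 1 / 2 - real p) - 1" by simp
      then show ?thesis using Y by (simp only: powr_diff) simp
    qed
    have "gaussian_moment u (2 * Suc p) Y = m / Y * gaussian_moment u (2 * p) Y - B"
      using gaussian_moment_rec[of Y u "2 * p"] Y u by (simp add: B_def m_def)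
    then have e: "gaussian_moment u (2 * Suc p) Y - (m * c) * Y powr (- 1 / 2 - real (Suc p))
        = m / Y * (gaussian_moment u (2 * p) Y - c * Y powr (- 1 / 2 - real p)) - B"
      unfolding pw by (simp add: algebra_simps)
    have m0: "m \<ge> 0" by (simp add: m_def)
    have "\<bar>m / Y * (gaussian_moment u (2 * p) Y - c * Y powr (- 1 / 2 - real p))\<bar> \<le> m * (C * exp (- (Y * u ^ 2 / 2)))"
    proof -
      have "m / Y \<le> m / 1" using Y m0 by (intro divide_left_mono) auto
      then show ?thesis unfolding abs_mult using cC[OF Y] m0 Y by (intro mult_mono) auto
    qed
    moreover have "\<bar>B\<bar> \<le> exp (- (Y * u ^ 2 / 2))"
    proof -
      define R where "R = u ^ (2 * p + 1) / Y"
      have B: "B = R * exp (- Y * u ^ 2)" by (simp add: B_def R_def)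
      have "R \<le> 1 / 1" unfolding R_def using u Y by (intro frac_le power_le_one) auto
      moreover have "0 \<le> R" using u Y by (simp add: R_def)
      moreover have "exp (- Y * u ^ 2) \<le> exp (- (Y * u ^ 2 / 2))" using Y by simp
      ultimately have "R * exp (- Y * u ^ 2) \<le> 1 * exp (- (Y * u ^ 2 / 2))"
        by (intro mult_mono) auto
      moreover have "0 \<le> R * exp (- Y * u ^ 2)" using \<open>0 \<le> R\<close> by simp
      ultimately show ?thesis unfolding B by simp
    qed
    ultimately show ?thesis unfolding e C'_def distrib_right by linarith
  qed
  then show ?case by (intro exI[of _ "m * c"] exI[of _ C']) auto
qed

text \<open>Scaling by s = sqrt Y |x|: half of the exponential absorbs the power s^i, and the other
  half is a Gaussian integral of size 1 / sqrt Y.\<close>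

lemma gaussian_abs_moment_bound:
  "\<exists>C. \<forall>u Y. 0 \<le> u \<and> Y > 0 \<longrightarrow> integral {-u..u} (\<lambda>x. \<bar>x\<bar> ^ i * exp (- (Y * x ^ 2 / 2))) \<le> C * Y powr (- (real i + 1) / 2)"
proof -
  define C :: real where "C = 1 + 4 ^ i * fact i"
  have C0: "C > 0" by (simp add: C_def add_pos_pos)
  have pt: "s ^ i * exp (- (s ^ 2 / 4)) \<le> C" if s: "s \<ge> 0" for s :: real
  proof -
    \<comment> \<open>The even exponent yields a power of s^2 / 4, to which the bound from the
      exponential series applies.\<close>
    have "s ^ i \<le> 1 + s ^ (2 * i)"
    proof (cases "s \<le> 1")
      case True
      then have "s ^ i \<le> 1" using s by (intro power_le_one) auto
      moreover have "0 \<le> s ^ (2 * i)" using s by simp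
      ultimately show ?thesis by linarith
    next
      case False
      then have "s ^ i \<le> s ^ (2 * i)" by (intro power_increasing) auto
      then show ?thesis by linarith
    qed
    also have "s ^ (2 * i) = 4 ^ i * (s ^ 2 / 4) ^ i" by (simp add: power_mult power_divide)
    also have "(s ^ 2 / 4) ^ i \<le> fact i * exp (s ^ 2 / 4)" by (rule power_le_fact_exp) simp
    finally have "s ^ i \<le> 1 + 4 ^ i * (fact i * exp (s ^ 2 / 4))" by simp
    also have "\<dots> \<le> C * exp (s ^ 2 / 4)" by (simp add: C_def distrib_right)
    finally have "s ^ i * exp (- (s ^ 2 / 4)) \<le> C * exp (s ^ 2 / 4) * exp (- (s ^ 2 / 4))" by (intro mult_right_mono) auto
    then show ?thesis by (simp only: mult.assoc exp_minus_inverse mult_1_right)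
  qed
  have "integral {-u..u} (\<lambda>x. \<bar>x\<bar> ^ i * exp (- (Y * x ^ 2 / 2))) \<le> (C * 2 * sqrt pi) * Y powr (- (real i + 1) / 2)" if u: "0 \<le> u" and Y: "Y > 0" for u Y
  proof -
    have "integral {-u..u} (\<lambda>x. \<bar>x\<bar> ^ i * exp (- (Y * x ^ 2 / 2))) \<le> integral {-u..u} (\<lambda>x. (C * Y powr (- real i / 2)) * exp (- ((Y / 4) * x ^ 2)))"
    proof (rule integral_le)
      fix x
      have "Y powr (- real i / 2) = 1 / sqrt Y ^ i"
        using Y by (simp add: powr_minus powr_half_sqrt[symmetric] powr_realpow[symmetric] powr_powr inverse_eq_divide)
      moreover have "sqrt Y > 0" using Y by simp
      ultimately have e: "\<bar>x\<bar> ^ i = Y powr (- real i / 2) * (sqrt Y * \<bar>x\<bar>) ^ i"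
        by (simp add: power_mult_distrib)
      have "(sqrt Y * \<bar>x\<bar>) ^ 2 = Y * x ^ 2" using Y by (simp add: power_mult_distrib)
      then have p: "(sqrt Y * \<bar>x\<bar>) ^ i * exp (- (Y * x ^ 2 / 4)) \<le> C" using pt[of "sqrt Y * \<bar>x\<bar>"] Y by simp
      have "exp (- (Y * x ^ 2 / 2)) = exp (- (Y * x ^ 2 / 4)) * exp (- ((Y / 4) * x ^ 2))"
        by (simp add: exp_add[symmetric])
      then have "\<bar>x\<bar> ^ i * exp (- (Y * x ^ 2 / 2)) = (Y powr (- real i / 2) * exp (- ((Y / 4) * x ^ 2))) * ((sqrt Y * \<bar>x\<bar>) ^ i * exp (- (Y * x ^ 2 / 4)))"
        by (simp only: e mult_ac)
      also have "\<dots> \<le> (Y powr (- real i / 2) * exp (- ((Y / 4) * x ^ 2))) * C" by (intro mult_left_mono p) auto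
      finally show "\<bar>x\<bar> ^ i * exp (- (Y * x ^ 2 / 2)) \<le> (C * Y powr (- real i / 2)) * exp (- ((Y / 4) * x ^ 2))" by (simp only: mult_ac)
    qed (auto intro!: integrable_continuous_interval continuous_intros)
    also have "\<dots> = (C * Y powr (- real i / 2)) * integral {-u..u} (\<lambda>x. exp (- ((Y / 4) * x ^ 2)))" by simp
    also have "\<dots> \<le> (C * Y powr (- real i / 2)) * (sqrt pi / sqrt (Y / 4))"
      using C0 Y u by (intro mult_left_mono gaussian_integral_le) auto
    also have "sqrt pi / sqrt (Y / 4) = 2 * sqrt pi * Y powr (- 1 / 2)"
      using Y by (simp add: powr_minus powr_half_sqrt real_sqrt_divide inverse_eq_divide)
    also have "(C * Y powr (- real i / 2)) * (2 * sqrt pi * Y powr (- 1 / 2)) = (C * 2 * sqrt pi) * (Y powr (- real i / 2) * Y powr (- 1 / 2))"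
      by (simp only: mult_ac)
    also have "Y powr (- real i / 2) * Y powr (- 1 / 2) = Y powr (- (real i + 1) / 2)"
      by (subst powr_add[symmetric]) (simp add: field_simps)
    finally show ?thesis .
  qed
  then show ?thesis by blast
qed

text \<open>An expansion in the powers Y^(-1/2-j) of which only the leading coefficient is recorded.
  The others stay existential, so the class is closed under linear combinations without any
  computation of coefficients.\<close>

definition half_expansion :: "nat \<Rightarrow> (real \<Rightarrow> complex) \<Rightarrow> complex \<Rightarrow> bool" where
  "half_expansion N f a \<longleftrightarrow> (\<exists>d C. d 0 = a \<and> (\<forall>Y\<ge>1. norm (f Y - of_real (Y powr (- 1 / 2)) * (\<Sum>j<N. d j * of_real (Y powr (- real j))))
     \<le> C * Y powr (- 1 / 2 - real N)))"

lemma half_expansion_add: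
  assumes "half_expansion N f a" "half_expansion N g b"
  shows "half_expansion N (\<lambda>Y. f Y + g Y) (a + b)"
proof -
  obtain d C where 1: "d 0 = a" "\<And>Y. Y \<ge> 1 \<Longrightarrow> norm (f Y - of_real (Y powr (- 1 / 2)) * (\<Sum>j<N. d j * of_real (Y powr (- real j)))) \<le> C * Y powr (- 1 / 2 - real N)"
    using assms(1) unfolding half_expansion_def by blast
  obtain e D where 2: "e 0 = b" "\<And>Y. Y \<ge> 1 \<Longrightarrow> norm (g Y - of_real (Y powr (- 1 / 2)) * (\<Sum>j<N. e j * of_real (Y powr (- real j)))) \<le> D * Y powr (- 1 / 2 - real N)"
    using assms(2) unfolding half_expansion_def by blast
  show ?thesis unfolding half_expansion_def
  proof (intro exI conjI allI impI)
    show "(\<lambda>j. d j + e j) 0 = a + b" by (simp add: 1 2)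
    fix Y :: real assume Y: "Y \<ge> 1"
    have "f Y + g Y - of_real (Y powr (- 1 / 2)) * (\<Sum>j<N. (d j + e j) * of_real (Y powr (- real j)))
      = (f Y - of_real (Y powr (- 1 / 2)) * (\<Sum>j<N. d j * of_real (Y powr (- real j)))) + (g Y - of_real (Y powr (- 1 / 2)) * (\<Sum>j<N. e j * of_real (Y powr (- real j))))"
      by (simp add: sum.distrib distrib_right algebra_simps)
    also have "norm \<dots> \<le> C * Y powr (- 1 / 2 - real N) + D * Y powr (- 1 / 2 - real N)"
      by (rule norm_triangle_le[OF add_mono[OF 1(2)[OF Y] 2(2)[OF Y]]])
    finally show "norm (f Y + g Y - of_real (Y powr (- 1 / 2)) * (\<Sum>j<N. (d j + e j) * of_real (Y powr (- real j)))) \<le> (C + D) * Y powr (- 1 / 2 - real N)"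
      by (simp add: distrib_right)
  qed
qed

lemma half_expansion_cmult:
  assumes "half_expansion N f a" shows "half_expansion N (\<lambda>Y. c * f Y) (c * a)"
proof -
  obtain d C where 1: "d 0 = a" "\<And>Y. Y \<ge> 1 \<Longrightarrow> norm (f Y - of_real (Y powr (- 1 / 2)) * (\<Sum>j<N. d j * of_real (Y powr (- real j)))) \<le> C * Y powr (- 1 / 2 - real N)"
    using assms(1) unfolding half_expansion_def by blast
  show ?thesis unfolding half_expansion_def
  proof (intro exI conjI allI impI)
    show "(\<lambda>j. c * d j) 0 = c * a" by (simp add: 1)
    fix Y :: real assume Y: "Y \<ge> 1"
    have "c * f Y - of_real (Y powr (- 1 / 2)) * (\<Sum>j<N. c * d j * of_real (Y powr (- real j)))
      = c * (f Y - of_real (Y powr (- 1 / 2)) * (\<Sum>j<N. d j * of_real (Y powr (- real j))))"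
      by (simp add: sum_distrib_left algebra_simps)
    then show "norm (c * f Y - of_real (Y powr (- 1 / 2)) * (\<Sum>j<N. c * d j * of_real (Y powr (- real j)))) \<le> (norm c * C) * Y powr (- 1 / 2 - real N)"
      using mult_left_mono[OF 1(2)[OF Y] norm_ge_zero[of c]] by (simp add: norm_mult mult.assoc)
  qed
qed

lemma half_expansion_small:
  assumes "\<And>Y. Y \<ge> 1 \<Longrightarrow> norm (f Y) \<le> C * Y powr (- 1 / 2 - real N)"
  shows "half_expansion N f 0"
  unfolding half_expansion_def using assms by (intro exI[of _ "\<lambda>_. 0"] exI[of _ C]) auto

lemma half_expansion_sum:
  assumes "finite A" "\<And>i. i \<in> A \<Longrightarrow> half_expansion N (f i) (a i)"
  shows "half_expansion N (\<lambda>Y. \<Sum>i\<in>A. f i Y) (\<Sum>i\<in>A. a i)"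
  using assms
proof (induction A rule: finite_induct)
  case empty
  show ?case using half_expansion_small[of "\<lambda>_. 0" 0 N] by simp
next
  case (insert x A)
  then show ?case using half_expansion_add[of N "f x" "a x" "\<lambda>Y. \<Sum>i\<in>A. f i Y" "\<Sum>i\<in>A. a i"] by simp
qed

lemma half_expansion_monomial:
  assumes N: "N > 0"
  shows "half_expansion N (\<lambda>Y. of_real (Y powr (- 1 / 2 - real l))) (if l = 0 then 1 else 0)"
proof (cases "l < N")
  case True
  show ?thesis unfolding half_expansion_def
  proof (intro exI conjI allI impI)
    show "(\<lambda>j. if j = l then 1 else 0 :: complex) 0 = (if l = 0 then 1 else 0)" by simp
    fix Y :: real assume Y: "Y \<ge> 1"
    have "(\<Sum>j<N. (if j = l then 1 else 0) * complex_of_real (Y powr (- real j))) = of_real (Y powr (- real l))"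
      using True by (simp add: if_distrib[of "\<lambda>x. x * _"] cong: if_cong)
    moreover have "Y powr (- 1 / 2 - real l) = Y powr (- 1 / 2) * Y powr (- real l)"
      by (simp add: powr_add[symmetric])
    ultimately show "norm (complex_of_real (Y powr (- 1 / 2 - real l)) - of_real (Y powr (- 1 / 2)) * (\<Sum>j<N. (if j = l then 1 else 0) * of_real (Y powr (- real j))))
        \<le> 0 * Y powr (- 1 / 2 - real N)" by simp
  qed
next
  case False
  have "half_expansion N (\<lambda>Y. of_real (Y powr (- 1 / 2 - real l))) 0"
  proof (rule half_expansion_small[of _ 1])
    fix Y :: real assume "Y \<ge> 1"
    then show "norm (complex_of_real (Y powr (- 1 / 2 - real l))) \<le> 1 * Y powr (- 1 / 2 - real N)"
      using False by (simp add: powr_mono)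
  qed
  then show ?thesis using False N by simp
qed

text \<open>By scaling, Y^j times the moment of order 3 j + i has size Y^(-1/2 - (i + j)/2). This
  fits the expansion when i + j is even; when i + j is odd the moment vanishes by symmetry.\<close>

lemma half_expansion_moment:
  assumes u: "0 < u" "u \<le> 1" and N: "N > 0"
  shows "half_expansion N (\<lambda>Y. of_real (Y ^ j * gaussian_moment u (3 * j + i) Y)) (if j = 0 \<and> i = 0 then of_real (sqrt pi) else 0)"
proof (cases "even (i + j)")
  case False
  then have "odd (3 * j + i)" by simp
  then show ?thesis using half_expansion_small[of "\<lambda>_. 0" 0 N] False by (auto simp: gaussian_moment_odd)
next
  case True
  then have "even (3 * j + i)" by simp
  then obtain p where p: "3 * j + i = 2 * p" by (elim evenE)
  define l where "l = (i + j) div 2"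
  have l: "i + j = 2 * l" using True by (simp add: l_def)
  then have pl: "p = j + l" using p by simp
  obtain c C where cC: "p = 0 \<longrightarrow> c = sqrt pi" "\<And>Y. Y \<ge> 1 \<Longrightarrow> \<bar>gaussian_moment u (2 * p) Y - c * Y powr (- 1 / 2 - real p)\<bar> \<le> C * exp (- (Y * u ^ 2 / 2))"
    using gaussian_moment_even[OF u, of p] by blast
  have "half_expansion N (\<lambda>Y. of_real c * of_real (Y powr (- 1 / 2 - real l)) + of_real (Y ^ j * gaussian_moment u (3 * j + i) Y - c * Y powr (- 1 / 2 - real l)))
     (of_real c * (if l = 0 then 1 else 0) + 0)"
  proof (intro half_expansion_add half_expansion_cmult half_expansion_monomial N)
    \<comment> \<open>The exponentially small error is traded for Y^(-q); this pays for the factor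
      Y^j and leaves Y^(-N-1).\<close>
    define q where "q = N + 1 + j"
    define D where "D = \<bar>C\<bar> * (fact q * (2 / u ^ 2) ^ q)"
    show "half_expansion N (\<lambda>Y. complex_of_real (Y ^ j * gaussian_moment u (3 * j + i) Y - c * Y powr (- 1 / 2 - real l))) 0"
    proof (rule half_expansion_small[of _ D])
      fix Y :: real assume Y: "Y \<ge> 1"
      have eq: "Y powr (- 1 / 2 - real l) = Y ^ j * Y powr (- 1 / 2 - real p)"
        using Y by (simp add: powr_realpow[symmetric] powr_add[symmetric] pl)
      have "Y ^ j * gaussian_moment u (3 * j + i) Y - c * Y powr (- 1 / 2 - real l) = Y ^ j * (gaussian_moment u (2 * p) Y - c * Y powr (- 1 / 2 - real p))"
        unfolding eq p by (simp only: right_diff_distrib mult.left_commute)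
      then have "\<bar>Y ^ j * gaussian_moment u (3 * j + i) Y - c * Y powr (- 1 / 2 - real l)\<bar> = Y ^ j * \<bar>gaussian_moment u (2 * p) Y - c * Y powr (- 1 / 2 - real p)\<bar>"
        using Y by (simp add: abs_mult)
      also have "\<dots> \<le> Y ^ j * (\<bar>C\<bar> * exp (- (Y * u ^ 2 / 2)))"
      proof (rule mult_left_mono)
        have "C * exp (- (Y * u ^ 2 / 2)) \<le> \<bar>C\<bar> * exp (- (Y * u ^ 2 / 2))" by (intro mult_right_mono) auto
        then show "\<bar>gaussian_moment u (2 * p) Y - c * Y powr (- 1 / 2 - real p)\<bar> \<le> \<bar>C\<bar> * exp (- (Y * u ^ 2 / 2))" using cC(2)[OF Y] by linarith
      qed (use Y in simp)
      also have "exp (- (Y * u ^ 2 / 2)) \<le> fact q * (2 / u ^ 2) ^ q * (1 / Y ^ q)"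
      proof -
        have "(Y * u ^ 2 / 2) ^ q \<le> fact q * exp (Y * u ^ 2 / 2)" using Y by (intro power_le_fact_exp) simp
        then have "exp (- (Y * u ^ 2 / 2)) * (Y * u ^ 2 / 2) ^ q \<le> exp (- (Y * u ^ 2 / 2)) * (fact q * exp (Y * u ^ 2 / 2))" by (intro mult_left_mono) auto
        also have "\<dots> = fact q" by (simp add: exp_minus)
        finally have "exp (- (Y * u ^ 2 / 2)) \<le> fact q / (Y * u ^ 2 / 2) ^ q"
          using Y u by (simp add: pos_le_divide_eq)
        also have "\<dots> = fact q * (2 / u ^ 2) ^ q * (1 / Y ^ q)"
          using Y u by (simp add: power_mult_distrib power_divide)
        finally show ?thesis .
      qed
      then have "Y ^ j * (\<bar>C\<bar> * exp (- (Y * u ^ 2 / 2))) \<le> Y ^ j * (\<bar>C\<bar> * (fact q * (2 / u ^ 2) ^ q * (1 / Y ^ q)))"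
        using Y by (intro mult_left_mono) auto
      also have "\<dots> = D * (1 / Y ^ (N + 1))" using Y by (simp add: D_def q_def power_add)
      also have "1 / Y ^ (N + 1) \<le> Y powr (- 1 / 2 - real N)"
      proof -
        have "1 / Y ^ (N + 1) = Y powr (- real (N + 1))" using Y by (simp add: powr_minus powr_realpow inverse_eq_divide del: of_nat_add of_nat_Suc)
        also have "\<dots> \<le> Y powr (- 1 / 2 - real N)" using Y by (intro powr_mono) auto
        finally show ?thesis .
      qed
      finally have "\<bar>Y ^ j * gaussian_moment u (3 * j + i) Y - c * Y powr (- 1 / 2 - real l)\<bar> \<le> D * Y powr (- 1 / 2 - real N)"
        by (simp add: D_def mult_left_mono)
      then show "norm (complex_of_real (Y ^ j * gaussian_moment u (3 * j + i) Y - c * Y powr (- 1 / 2 - real l))) \<le> D * Y powr (- 1 / 2 - real N)"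
        by (simp only: norm_of_real)
    qed
  qed
  moreover have "of_real c * (if l = 0 then 1 else 0) + 0 = (if j = 0 \<and> i = 0 then complex_of_real (sqrt pi) else 0)"
    using cC(1) l pl by auto
  ultimately show ?thesis by simp
qed

text \<open>One Taylor coefficient is split off at a time through the removable singularity of (f z
  - f 0) / z. The remainder is a power times a holomorphic function, which compactness bounds; the
  identity holds for every z because the quotient is defined outside S as well.\<close>

lemma holomorphic_factor_powers:
  assumes "open S"
  shows "f holomorphic_on S \<Longrightarrow> \<exists>c h. h holomorphic_on S \<and> (\<forall>z. f z = (\<Sum>i<L. c i * z ^ i) + z ^ L * h z) \<and> (L > 0 \<longrightarrow> c 0 = f 0)"
proof (induction L arbitrary: f)
  case 0
  then show ?case by (intro exI[of _ "\<lambda>_. 0"] exI[of _ f]) auto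
next
  case (Suc L)
  define f1 where "f1 = (\<lambda>z. if z = 0 then deriv f 0 else (f z - f 0) / (z - 0))"
  have "f1 holomorphic_on S" unfolding f1_def by (rule pole_lemma_open[OF Suc.prems assms])
  then obtain c h where ch: "h holomorphic_on S" "\<And>z. f1 z = (\<Sum>i<L. c i * z ^ i) + z ^ L * h z" using Suc.IH by blast
  have f: "f z = f 0 + z * f1 z" for z by (simp add: f1_def)
  have "f z = (\<Sum>i<Suc L. (case i of 0 \<Rightarrow> f 0 | Suc i \<Rightarrow> c i) * z ^ i) + z ^ Suc L * h z" for z
    unfolding sum.lessThan_Suc_shift by (subst f, subst ch(2)) (simp add: algebra_simps sum_distrib_left)
  then show ?case using ch(1) by (intro exI[of _ "\<lambda>i. case i of 0 \<Rightarrow> f 0 | Suc i \<Rightarrow> c i"] exI[of _ h]) auto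
qed

text \<open>The three coefficients are read off from the factored form at 0: they are f(0), D(0) and
  half the derivative of D, that is 0, 0 and -1.\<close>

lemma holomorphic_quadratic_leading_term:
  assumes S: "open S" "0 \<in> S" and D: "\<And>z. z \<in> S \<Longrightarrow> (f has_field_derivative D z) (at z)"
    and 0: "f 0 = 0" "D 0 = 0" and D2: "(D has_field_derivative (- 2)) (at 0)"
  shows "\<exists>g. g holomorphic_on S \<and> (\<forall>z. f z = - (z ^ 2) + z ^ 3 * g z)"
proof -
  have hol: "f holomorphic_on S" using D S by (auto simp: holomorphic_on_open)
  obtain c h where h: "h holomorphic_on S" and f: "\<And>z. f z = (\<Sum>i<3. c i * z ^ i) + z ^ 3 * h z" and c0: "c 0 = f 0"
    using holomorphic_factor_powers[OF S(1) hol, of 3] by auto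
  have h': "(h has_field_derivative deriv h z) (at z)" if "z \<in> S" for z using h S that holomorphic_derivI by blast
  have f': "f = (\<lambda>z. c 1 * z + c 2 * z ^ 2 + z ^ 3 * h z)"
    by (rule ext, subst f) (simp add: c0 0 eval_nat_numeral)
  have Dz: "D z = c 1 + c 2 * (2 * z) + (3 * z ^ 2 * h z + deriv h z * z ^ 3)" if "z \<in> S" for z
  proof (rule DERIV_unique[OF D[OF that]])
    show "(f has_field_derivative c 1 + c 2 * (2 * z) + (3 * z ^ 2 * h z + deriv h z * z ^ 3)) (at z)"
      unfolding f' by (rule derivative_eq_intros h'[OF that] refl | simp)+
  qed
  have c1: "c 1 = 0" using Dz[OF S(2)] 0 by simp
  have h0: "(deriv h has_field_derivative deriv (deriv h) 0) (at 0)"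
    using holomorphic_derivI[OF holomorphic_deriv[OF h S(1)] S(1) S(2)] .
  have "((\<lambda>z. c 1 + c 2 * (2 * z) + (3 * z ^ 2 * h z + deriv h z * z ^ 3)) has_field_derivative c 2 * 2) (at 0)"
    by (rule derivative_eq_intros h'[OF S(2)] h0 refl | simp)+
  then have "(D has_field_derivative c 2 * 2) (at 0)"
    by (rule has_field_derivative_transform_within_open[OF _ S]) (simp add: Dz)
  then have "c 2 * 2 = - 2" using D2 DERIV_unique by blast
  from arg_cong[OF this, of "\<lambda>x. x / 2"] have "c 2 = - 1" by simp
  then have "f z = - (z ^ 2) + z ^ 3 * h z" for z using c1 by (subst f') simp
  then show ?thesis using h by blast
qed

lemma cubic_perturbation_bound:
  fixes w :: complex
  assumes "M > 0" "norm w \<le> M" "\<bar>x\<bar> \<le> 1 / (2 * M)"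
  shows "norm (of_real x ^ 3 * w) \<le> M * \<bar>x\<bar> ^ 3 \<and> M * \<bar>x\<bar> ^ 3 \<le> x ^ 2 / 2"
proof -
  define y where "y = \<bar>x\<bar>"
  have y: "0 \<le> y" "y \<le> 1 / (2 * M)" "x ^ 2 = y ^ 2" using assms(3) by (auto simp: y_def)
  have "norm (of_real x ^ 3 * w) = y ^ 3 * norm w" by (simp add: norm_mult norm_power y_def)
  also have "\<dots> \<le> y ^ 3 * M" by (intro mult_left_mono assms(2) zero_le_power y(1))
  also have "\<dots> = M * y ^ 3" by (rule mult.commute)
  finally have 1: "norm (of_real x ^ 3 * w) \<le> M * y ^ 3" .
  have "y * (2 * M) \<le> 1" using y(2) assms(1) by (simp add: pos_le_divide_eq)
  from mult_right_mono[OF this zero_le_power2[of y]] have "y * (2 * M) * y ^ 2 \<le> y ^ 2" by (simp only: mult_1_left)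
  moreover have "y * (2 * M) * y ^ 2 = 2 * (M * y ^ 3)" by (simp add: power3_eq_cube power2_eq_square)
  ultimately have "M * y ^ 3 \<le> y ^ 2 / 2" by linarith
  from conjI[OF 1 this] show ?thesis unfolding y(3) unfolding y_def .
qed

text \<open>The exponent is split into -Y x^2, which is kept, and q = Y x^3 g(x), whose exponential
  is expanded to J terms; the factors g^j H / j! are expanded in powers of x as well, which leaves
  Y^j times moments of order 3 j + i. Every u up to u0 is covered because the interval is shortened
  again once the approximation of the generating function enters.\<close>

theorem laplace_expansion:
  fixes g H :: "complex \<Rightarrow> complex"
  assumes g: "g holomorphic_on ball 0 1" and H: "H holomorphic_on ball 0 1" and N: "N > 0"
  shows "\<exists>u0>0. u0 \<le> 1 / 2 \<and> (\<forall>u. 0 < u \<and> u \<le> u0 \<longrightarrow>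
     (\<forall>x\<in>{-u..u}. Re (- (of_real x ^ 2) + of_real x ^ 3 * g (of_real x)) \<le> - (x ^ 2 / 2)) \<and>
     half_expansion N (\<lambda>Y. integral {-u..u} (\<lambda>x. exp (of_real Y * (- (of_real x ^ 2) + of_real x ^ 3 * g (of_real x))) * H (of_real x)))
       (of_real (sqrt pi) * H 0))"
proof -
  have bounded: "\<exists>B>0. \<forall>z\<in>cball 0 (1 / 2). norm (f z) \<le> B" if "f holomorphic_on ball 0 1" for f :: "complex \<Rightarrow> complex"
  proof -
    have "continuous_on (cball 0 (1 / 2)) f"
      by (rule continuous_on_subset[OF holomorphic_on_imp_continuous_on[OF that]]) auto
    then have "compact (f ` cball 0 (1 / 2))" by (intro compact_continuous_image) auto
    then show ?thesis using compact_imp_bounded bounded_pos[of "f ` cball 0 (1 / 2)"] by blast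
  qed
  obtain M where M: "M > 0" "\<And>z. z \<in> cball 0 (1 / 2) \<Longrightarrow> norm (g z) \<le> M" using bounded[OF g] by blast
  obtain BH where BH: "BH > 0" "\<And>z. z \<in> cball 0 (1 / 2) \<Longrightarrow> norm (H z) \<le> BH" using bounded[OF H] by blast
  \<comment> \<open>In this range the cubic term is at most x^2 / 2, so half of the Gaussian
    survives and absorbs all error terms.\<close>
  define u0 where "u0 = min (1 / 2) (1 / (2 * M))"
  have u0: "u0 > 0" "u0 \<le> 1 / 2" "u0 \<le> 1 / (2 * M)" using M by (auto simp: u0_def)
  \<comment> \<open>For x of size Y^(-1/2), each further power of q = Y x^3 g(x) or of x gains only
    Y^(-1/2), so precision Y^(-N) takes 2 N terms.\<close>
  define J where "J = 2 * N"
  have J: "J > 0" using N by (simp add: J_def)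
  have "\<forall>j. \<exists>p. snd p holomorphic_on ball 0 1 \<and> (\<forall>z. (g z ^ j * H z / fact j) = (\<Sum>i<J. fst p i * z ^ i) + z ^ J * snd p z)
      \<and> (J > 0 \<longrightarrow> fst p 0 = g 0 ^ j * H 0 / fact j)"
  proof
    fix j
    have hol: "(\<lambda>z. g z ^ j * H z / fact j) holomorphic_on ball 0 1" by (intro holomorphic_intros g H) simp
    from holomorphic_factor_powers[OF open_ball hol, of J]
    obtain c h where "h holomorphic_on ball 0 1" "\<forall>z. (g z ^ j * H z / fact j) = (\<Sum>i<J. c i * z ^ i) + z ^ J * h z"
      "J > 0 \<longrightarrow> c 0 = g 0 ^ j * H 0 / fact j" by (elim exE conjE) (rule that)
    then show "\<exists>p. snd p holomorphic_on ball 0 1 \<and> (\<forall>z. (g z ^ j * H z / fact j) = (\<Sum>i<J. fst p i * z ^ i) + z ^ J * snd p z)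
      \<and> (J > 0 \<longrightarrow> fst p 0 = g 0 ^ j * H 0 / fact j)" by (intro exI[of _ "(c, h)"]) (simp only: fst_conv snd_conv simp_thms)
  qed
  from choice[OF this] obtain p where p: "\<forall>j. snd (p j) holomorphic_on ball 0 1 \<and> (\<forall>z. (g z ^ j * H z / fact j) = (\<Sum>i<J. fst (p j) i * z ^ i) + z ^ J * snd (p j) z)
      \<and> (J > 0 \<longrightarrow> fst (p j) 0 = g 0 ^ j * H 0 / fact j)" by (elim exE) (rule that)
  define c h where "c = (\<lambda>j. fst (p j))" and "h = (\<lambda>j. snd (p j))"
  have h: "h j holomorphic_on ball 0 1" for j using p[rule_format, of j] unfolding h_def by (elim conjE)
  have ch: "(g z ^ j * H z / fact j) = (\<Sum>i<J. c j i * z ^ i) + z ^ J * h j z" for j z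
    using p[rule_format, of j] unfolding c_def h_def by (elim conjE) (erule spec)
  have c0: "c j 0 = g 0 ^ j * H 0 / fact j" for j
    using p[rule_format, of j] J unfolding c_def by (elim conjE) (erule mp)
  have "\<forall>j. \<exists>B. B > 0 \<and> (\<forall>z\<in>cball 0 (1 / 2). norm (h j z) \<le> B)" by (intro allI bounded[OF h])
  from choice[OF this] obtain B where B': "\<forall>j. B j > 0 \<and> (\<forall>z\<in>cball 0 (1 / 2). norm (h j z) \<le> B j)" by (elim exE) (rule that)
  have B: "B j > 0" "z \<in> cball 0 (1 / 2) \<Longrightarrow> norm (h j z) \<le> B j" for j z
    using B' by blast+
  have "\<forall>i. \<exists>K. \<forall>u Y. 0 \<le> u \<and> Y > 0 \<longrightarrow> integral {-u..u} (\<lambda>x. \<bar>x\<bar> ^ i * exp (- (Y * x ^ 2 / 2))) \<le> K * Y powr (- (real i + 1) / 2)"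
    by (intro allI gaussian_abs_moment_bound)
  from choice[OF this] obtain K where K': "\<forall>i u Y. 0 \<le> u \<and> Y > 0 \<longrightarrow> integral {-u..u} (\<lambda>x. \<bar>x\<bar> ^ i * exp (- (Y * x ^ 2 / 2))) \<le> K i * Y powr (- (real i + 1) / 2)"
    by (elim exE) (rule that)
  have K: "integral {-u..u} (\<lambda>x. \<bar>x\<bar> ^ i * exp (- (Y * x ^ 2 / 2))) \<le> K i * Y powr (- (real i + 1) / 2)" if "0 \<le> u" "Y > 0" for i u Y
    using K'[rule_format, OF conjI[OF that]] .
  have cubic: "norm (of_real x ^ 3 * g (of_real x)) \<le> M * \<bar>x\<bar> ^ 3" "M * \<bar>x\<bar> ^ 3 \<le> x ^ 2 / 2" if "\<bar>x\<bar> \<le> u0" for x :: real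
  proof -
    have "complex_of_real x \<in> cball 0 (1 / 2)"
      unfolding mem_cball_0 norm_of_real using that u0(2) by (rule order_trans)
    note bound = cubic_perturbation_bound[OF M(1) M(2)[OF this] order_trans[OF that u0(3)]]
    from conjunct1[OF bound] show "norm (of_real x ^ 3 * g (of_real x)) \<le> M * \<bar>x\<bar> ^ 3" .
    from conjunct2[OF bound] show "M * \<bar>x\<bar> ^ 3 \<le> x ^ 2 / 2" .
  qed
  have "half_expansion N (\<lambda>Y. integral {-u..u} (\<lambda>x. exp (of_real Y * (- (of_real x ^ 2) + of_real x ^ 3 * g (of_real x))) * H (of_real x)))
       (of_real (sqrt pi) * H 0)" if u: "0 < u" "u \<le> u0" for u
  proof -
    have u1: "u \<le> 1" using u u0 by simp
    have cball: "complex_of_real x \<in> cball 0 (1 / 2)" if "x \<in> {-u..u}" for x using that u u0 by auto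
    have ball: "complex_of_real x \<in> ball 0 1" if "x \<in> {-u..u}" for x using cball[OF that] by auto
    have cont: "continuous_on {-u..u} (\<lambda>x. f (complex_of_real x))" if "f holomorphic_on ball 0 1" for f
      by (rule continuous_on_compose2[OF holomorphic_on_imp_continuous_on[OF that]]) (use ball in \<open>auto intro!: continuous_intros\<close>)
    define F where "F = (\<lambda>Y x. exp (of_real Y * (- (of_real x ^ 2) + of_real x ^ 3 * g (of_real x))) * H (complex_of_real x))"
    define P where "P = (\<lambda>Y x. \<Sum>j<J. \<Sum>i<J. c j i * complex_of_real (Y ^ j * (x ^ (3 * j + i) * exp (- Y * x ^ 2))))"
    define A where "A = (\<lambda>Y. \<Sum>j<J. \<Sum>i<J. c j i * complex_of_real (Y ^ j * gaussian_moment u (3 * j + i) Y))"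
    \<comment> \<open>The sum majorises the Taylor remainders of the functions g^j H / j!, the last
      term the truncation of the exponential series after J terms.\<close>
    define R where "R = (\<lambda>Y x. (\<Sum>j<J. B j * (Y ^ j * (\<bar>x\<bar> ^ (3 * j + J) * exp (- (Y * x ^ 2 / 2)))))
        + BH * M ^ J * (Y ^ J * (\<bar>x\<bar> ^ (3 * J) * exp (- (Y * x ^ 2 / 2)))))"
    have Fint: "F Y integrable_on {-u..u}" for Y
      unfolding F_def by (intro integrable_continuous_interval continuous_intros cont g H)
    have Pint: "(P Y has_integral A Y) {-u..u}" for Y
    proof -
      have "((\<lambda>x. complex_of_real (Y ^ j * (x ^ i * exp (- Y * x ^ 2)))) has_integral complex_of_real (Y ^ j * gaussian_moment u i Y)) {-u..u}" for i j
      proof -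
        have "(\<lambda>x. x ^ i * exp (- Y * x ^ 2)) integrable_on {-u..u}" by (intro integrable_continuous_interval continuous_intros)
        then have "((\<lambda>x. Y ^ j * (x ^ i * exp (- Y * x ^ 2))) has_integral (Y ^ j * gaussian_moment u i Y)) {-u..u}"
          unfolding gaussian_moment_def by (intro has_integral_mult_right integrable_integral)
        from has_integral_linear[OF this bounded_linear_of_real[where 'a = complex]] show ?thesis by (simp only: o_def)
      qed
      then show ?thesis unfolding P_def A_def by (intro has_integral_sum has_integral_mult_right) auto
    qed
    have Rint: "R Y integrable_on {-u..u}" for Y
      unfolding R_def by (auto intro!: integrable_continuous_interval continuous_intros)
    have pointwise: "norm (F Y x - P Y x) \<le> R Y x" if Y: "Y \<ge> 1" and x: "x \<in> {-u..u}" for Y x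
    proof -
      define z where "z = complex_of_real x"
      define q where "q = of_real Y * (z ^ 3 * g z)"
      have xu: "\<bar>x\<bar> \<le> u0" using x u by auto
      have nq: "norm q \<le> Y * (M * \<bar>x\<bar> ^ 3)" "norm q \<le> Y * x ^ 2 / 2"
      proof -
        have "norm q = Y * norm (z ^ 3 * g z)" using Y by (simp add: q_def norm_mult)
        then show "norm q \<le> Y * (M * \<bar>x\<bar> ^ 3)" "norm q \<le> Y * x ^ 2 / 2"
          using mult_left_mono[OF cubic(1)[OF xu], of Y] mult_left_mono[OF cubic(2)[OF xu], of Y] Y unfolding z_def by auto
      qed
      define ex where "ex = exp (- Y * x ^ 2)"
      have exF: "F Y x = of_real ex * exp q * H z"
      proof -
        have "of_real Y * (- (of_real x ^ 2) + of_real x ^ 3 * g (of_real x)) = of_real (- Y * x ^ 2) + q"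
          by (simp add: q_def z_def algebra_simps)
        then show ?thesis by (simp only: F_def exp_add exp_of_real ex_def z_def)
      qed
      define T where "T = (\<Sum>j<J. q ^ j / fact j)"
      have PT: "of_real ex * T * H z = P Y x + (\<Sum>j<J. of_real (Y ^ j * (x ^ (3 * j + J) * ex)) * h j z)"
      proof -
        have "of_real ex * T * H z = (\<Sum>j<J. of_real ex * of_real Y ^ j * z ^ (3 * j) * (g z ^ j * H z / fact j))"
          unfolding T_def sum_distrib_left sum_distrib_right
          by (intro sum.cong refl) (simp add: q_def power_mult_distrib mult_ac flip: power_mult)
        also have "\<dots> = (\<Sum>j<J. (\<Sum>i<J. c j i * complex_of_real (Y ^ j * (x ^ (3 * j + i) * ex))) + of_real (Y ^ j * (x ^ (3 * j + J) * ex)) * h j z)"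
          unfolding ch distrib_left sum_distrib_left
          by (intro sum.cong refl arg_cong2[of _ _ _ _ "(+)"]) (simp_all add: z_def power_add mult_ac)
        finally show ?thesis by (simp add: sum.distrib P_def ex_def)
      qed
      have Rem: "norm (exp q - T) \<le> exp (Y * x ^ 2 / 2) * (Y * (M * \<bar>x\<bar> ^ 3)) ^ J"
      proof -
        have "norm (exp q - (\<Sum>j\<le>J - 1. q ^ j / fact j)) \<le> exp (norm q) * norm q ^ Suc (J - 1) / fact (J - 1)"
          by (rule Taylor_exp_field)
        moreover have "{..J - 1} = {..<J}" using J by auto
        ultimately have "norm (exp q - T) \<le> exp (norm q) * norm q ^ J / fact (J - 1)" using J by (simp add: T_def)
        also have "\<dots> \<le> exp (norm q) * norm q ^ J / 1" by (intro divide_left_mono) (auto simp: fact_ge_1)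
        also have "\<dots> \<le> exp (Y * x ^ 2 / 2) * (Y * (M * \<bar>x\<bar> ^ 3)) ^ J" using nq by (auto intro!: mult_mono power_mono)
        finally show ?thesis .
      qed
      have ex0: "ex > 0" by (simp add: ex_def)
      have ex_half: "ex \<le> exp (- (Y * x ^ 2 / 2))" "ex * exp (Y * x ^ 2 / 2) = exp (- (Y * x ^ 2 / 2))"
        using Y by (auto simp: ex_def exp_add[symmetric])
      have "F Y x - P Y x = of_real ex * (exp q - T) * H z + (\<Sum>j<J. of_real (Y ^ j * (x ^ (3 * j + J) * ex)) * h j z)"
        unfolding exF using PT by (simp add: algebra_simps)
      then have "norm (F Y x - P Y x) \<le> norm (of_real ex * (exp q - T) * H z) + norm (\<Sum>j<J. of_real (Y ^ j * (x ^ (3 * j + J) * ex)) * h j z)"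
        by (simp only: norm_triangle_ineq)
      also have "norm (of_real ex * (exp q - T) * H z) \<le> BH * M ^ J * (Y ^ J * (\<bar>x\<bar> ^ (3 * J) * exp (- (Y * x ^ 2 / 2))))"
      proof -
        have "norm (of_real ex * (exp q - T) * H z) = ex * norm (exp q - T) * norm (H z)" using ex0 by (simp add: norm_mult)
        also have "\<dots> \<le> ex * (exp (Y * x ^ 2 / 2) * (Y * (M * \<bar>x\<bar> ^ 3)) ^ J) * BH"
          using Rem BH(2)[OF cball[OF x]] ex0 Y M unfolding z_def by (intro mult_mono) auto
        also have "\<dots> = (ex * exp (Y * x ^ 2 / 2)) * (BH * M ^ J * (Y ^ J * \<bar>x\<bar> ^ (3 * J)))"
          by (simp add: power_mult_distrib mult_ac flip: power_mult)
        finally show ?thesis unfolding ex_half(2) by (simp only: mult_ac)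
      qed
      also have "norm (\<Sum>j<J. of_real (Y ^ j * (x ^ (3 * j + J) * ex)) * h j z) \<le> (\<Sum>j<J. B j * (Y ^ j * (\<bar>x\<bar> ^ (3 * j + J) * exp (- (Y * x ^ 2 / 2)))))"
      proof (rule sum_norm_le)
        fix j
        have "norm (complex_of_real (Y ^ j * (x ^ (3 * j + J) * ex)) * h j z) = (Y ^ j * (\<bar>x\<bar> ^ (3 * j + J) * ex)) * norm (h j z)"
          using Y ex0 by (simp add: norm_mult norm_power)
        also have "\<dots> \<le> (Y ^ j * (\<bar>x\<bar> ^ (3 * j + J) * exp (- (Y * x ^ 2 / 2)))) * B j"
          using B(2)[OF cball[OF x], of j] ex_half(1) Y ex0 unfolding z_def by (intro mult_mono) auto
        finally show "norm (complex_of_real (Y ^ j * (x ^ (3 * j + J) * ex)) * h j z) \<le> B j * (Y ^ j * (\<bar>x\<bar> ^ (3 * j + J) * exp (- (Y * x ^ 2 / 2))))"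
          by (simp only: mult.commute)
      qed
      finally show ?thesis by (simp only: R_def add.commute)
    qed
    define C where "C = (\<Sum>j<J. B j * K (3 * j + J)) + BH * M ^ J * K (3 * J)"
    have small: "norm (integral {-u..u} (F Y) - A Y) \<le> C * Y powr (- 1 / 2 - real N)" if Y: "Y \<ge> 1" for Y
    proof -
      have K0: "0 \<le> K i" for i
      proof -
        have "0 \<le> integral {-u..u} (\<lambda>x. \<bar>x\<bar> ^ i * exp (- (1 * x ^ 2 / 2)))" by (intro integral_nonneg integrable_continuous_interval continuous_intros) auto
        also have "\<dots> \<le> K i * 1 powr (- (real i + 1) / 2)" using u by (intro K) auto
        finally show ?thesis by simp
      qed
      \<comment> \<open>The condition says that at least J = 2 N powers of x remain after 2 j of
        them have offset Y^j; both kinds of term in R satisfy it.\<close>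
      have trm: "Y ^ j * integral {-u..u} (\<lambda>x. \<bar>x\<bar> ^ i * exp (- (Y * x ^ 2 / 2))) \<le> K i * Y powr (- 1 / 2 - real N)" if "2 * j + J \<le> i" for i j
      proof -
        have "Y ^ j * integral {-u..u} (\<lambda>x. \<bar>x\<bar> ^ i * exp (- (Y * x ^ 2 / 2))) \<le> Y ^ j * (K i * Y powr (- (real i + 1) / 2))"
          using Y u by (intro mult_left_mono K) auto
        also have "\<dots> = K i * Y powr (real j + - (real i + 1) / 2)" using Y by (simp add: powr_add powr_realpow)
        also have "\<dots> \<le> K i * Y powr (- 1 / 2 - real N)"
        proof (intro mult_left_mono powr_mono K0)
          have "2 * real j + 2 * real N \<le> real i" using that by (simp add: J_def)
          then show "real j + - (real i + 1) / 2 \<le> - 1 / 2 - real N" by (simp add: field_simps)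
        qed (use Y in auto)
        finally show ?thesis .
      qed
      have "norm (integral {-u..u} (F Y) - A Y) = norm (integral {-u..u} (\<lambda>x. F Y x - P Y x))"
        unfolding integral_diff[OF Fint has_integral_integrable[OF Pint]] integral_unique[OF Pint] ..
      also have "\<dots> \<le> integral {-u..u} (R Y)"
      proof (rule integral_norm_bound_integral)
        show "(\<lambda>x. F Y x - P Y x) integrable_on {-u..u}" using Fint Pint by (intro integrable_diff) auto
      qed (use Rint pointwise[OF Y] in auto)
      also have "integral {-u..u} (R Y) = (\<Sum>j<J. B j * (Y ^ j * integral {-u..u} (\<lambda>x. \<bar>x\<bar> ^ (3 * j + J) * exp (- (Y * x ^ 2 / 2)))))
         + BH * M ^ J * (Y ^ J * integral {-u..u} (\<lambda>x. \<bar>x\<bar> ^ (3 * J) * exp (- (Y * x ^ 2 / 2))))"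
      proof -
        have "((\<lambda>x. \<bar>x\<bar> ^ i * exp (- (Y * x ^ 2 / 2))) has_integral integral {-u..u} (\<lambda>x. \<bar>x\<bar> ^ i * exp (- (Y * x ^ 2 / 2)))) {-u..u}" for i
          by (intro integrable_integral) (auto intro!: integrable_continuous_interval continuous_intros)
        then show ?thesis unfolding R_def by (intro integral_unique has_integral_add has_integral_sum has_integral_mult_right) auto
      qed
      also have "\<dots> \<le> (\<Sum>j<J. B j * (K (3 * j + J) * Y powr (- 1 / 2 - real N))) + BH * M ^ J * (K (3 * J) * Y powr (- 1 / 2 - real N))"
        using B(1) BH M by (intro add_mono sum_mono mult_left_mono trm) (auto intro: less_imp_le)
      also have "\<dots> = C * Y powr (- 1 / 2 - real N)" by (simp add: C_def sum_distrib_right distrib_right mult.assoc)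
      finally show ?thesis .
    qed
    have "half_expansion N (\<lambda>Y. A Y + (integral {-u..u} (F Y) - A Y)) ((\<Sum>j<J. \<Sum>i<J. c j i * (if j = 0 \<and> i = 0 then of_real (sqrt pi) else 0)) + 0)"
      unfolding A_def
      by (intro half_expansion_add half_expansion_sum half_expansion_cmult half_expansion_moment u(1) u1 N finite_lessThan
          half_expansion_small[of _ C] small[unfolded A_def])
    moreover have "(\<Sum>j<J. \<Sum>i<J. c j i * (if j = 0 \<and> i = 0 then complex_of_real (sqrt pi) else 0)) = of_real (sqrt pi) * H 0"
    proof -
      have "(\<Sum>j<J. \<Sum>i<J. c j i * (if j = 0 \<and> i = 0 then complex_of_real (sqrt pi) else 0)) = (\<Sum>j<J. if j = 0 then of_real (sqrt pi) * H 0 else 0)"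
      proof (rule sum.cong[OF refl])
        fix j
        show "(\<Sum>i<J. c j i * (if j = 0 \<and> i = 0 then complex_of_real (sqrt pi) else 0)) = (if j = 0 then of_real (sqrt pi) * H 0 else 0)"
          using J c0[of 0] by (cases "j = 0") (simp_all add: if_distrib[of "\<lambda>x. _ * x"] cong: if_cong)
      qed
      then show ?thesis using J by simp
    qed
    ultimately show ?thesis by (simp add: F_def)
  qed
  moreover have "Re (- (of_real x ^ 2) + of_real x ^ 3 * g (of_real x)) \<le> - (x ^ 2 / 2)" if "\<bar>x\<bar> \<le> u0" for x
  proof -
    have "Re (of_real x ^ 3 * g (of_real x)) \<le> x ^ 2 / 2"
      using cubic[OF that] complex_Re_le_cmod[of "of_real x ^ 3 * g (of_real x)"] by linarith
    moreover have "Re (- (of_real x ^ 2)) = - (x ^ 2)" by (simp flip: of_real_power)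
    ultimately show ?thesis by simp
  qed
  ultimately show ?thesis using u0 by (intro exI[of _ u0]) auto
qed

section \<open>The saddle point\<close>

text \<open>With $w = (1 - iu)/X$ and $Y$ as in the theorem, the logarithm of the integrand is
  $(k+1)B - 1/2 - \frac12\log X - \frac k2\log 2\pi + Y G(u) + K(u)$ up to $O(1/X)$, where $B$ is
  the constant multiple of $X^{1/k}$ in the saddle point equation. Here \<open>saddle_phase\<close> is $G$
  and \<open>saddle_amplitude\<close> is $(1 - iu)e^{K(u)}$.\<close>

definition saddle_log :: "complex \<Rightarrow> complex" where
  "saddle_log z = Ln (1 - \<i> * z)"

text \<open>Multiplied by B it is the varying part of order B in the exponent: k B (1 - i z)^(-1/k)
  comes from the generating function, B (1 - i z) from exp (n w), and the value (k + 1) B at z = 0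
  is subtracted.\<close>

definition saddle_profile :: "nat \<Rightarrow> complex \<Rightarrow> complex" where
  "saddle_profile k z = of_nat k * (exp (- saddle_log z / of_nat k) - 1) - \<i> * z"

definition saddle_phase :: "nat \<Rightarrow> complex \<Rightarrow> complex" where
  "saddle_phase k z = of_nat (2 * k) / of_nat (k + 1) * saddle_profile k z"

definition saddle_amplitude :: "nat \<Rightarrow> complex \<Rightarrow> complex" where
  "saddle_amplitude k z = (1 - \<i> * z) *
     exp (of_nat k / of_nat (2 * (k + 1)) * saddle_profile k z + (saddle_log z + \<i> * z) / 2)"

lemma saddle_log_deriv:
  assumes "z \<in> ball 0 1"
  shows "(saddle_log has_field_derivative - \<i> / (1 - \<i> * z)) (at z)" and "1 - \<i> * z \<noteq> 0"
    and "exp (saddle_log z) = 1 - \<i> * z"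
proof -
  have "\<bar>Im z\<bar> < 1" using abs_Im_le_cmod[of z] assms by simp
  then have re: "Re (1 - \<i> * z) > 0" by simp
  then show nz: "1 - \<i> * z \<noteq> 0" by (metis less_irrefl zero_complex.simps(1))
  have "1 - \<i> * z \<notin> \<real>\<^sub>\<le>\<^sub>0" using re by (auto simp: complex_nonpos_Reals_iff)
  then show "(saddle_log has_field_derivative - \<i> / (1 - \<i> * z)) (at z)"
    unfolding saddle_log_def[abs_def] by (auto intro!: derivative_eq_intros simp: divide_inverse)
  show "exp (saddle_log z) = 1 - \<i> * z" using nz by (simp add: saddle_log_def)
qed

lemma saddle_log_0 [simp]: "saddle_log 0 = 0"
  by (simp add: saddle_log_def)

lemma holomorphic_saddle_log: "saddle_log holomorphic_on ball 0 1"
  unfolding holomorphic_on_open[OF open_ball] using saddle_log_deriv(1) by blast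

text \<open>The derivative D vanishes at 0, which is the saddle point condition. The profile has
  second derivative -(k + 1) / k at 0, and the factor 2 k / (k + 1) of the phase normalises it to
  -2.\<close>

lemma saddle_phase_leading_term:
  assumes k: "k > 0"
  shows "\<exists>g. g holomorphic_on ball 0 1 \<and> (\<forall>z. saddle_phase k z = - (z ^ 2) + z ^ 3 * g z)"
proof -
  define \<phi> where "\<phi> = (\<lambda>z. exp (- saddle_log z / of_nat k))"
  have d\<phi>: "(\<phi> has_field_derivative \<i> / (1 - \<i> * z) / of_nat k * \<phi> z) (at z)" if "z \<in> ball 0 1" for z
    unfolding \<phi>_def using k by (auto intro!: derivative_eq_intros saddle_log_deriv[OF that])
  define c :: complex where "c = of_nat (2 * k) / of_nat (k + 1)"
  define D where "D = (\<lambda>z. c * (\<i> * \<phi> z / (1 - \<i> * z) - \<i>))"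
  have \<phi>0: "\<phi> 0 = 1" by (simp add: \<phi>_def)
  have phase: "saddle_phase k = (\<lambda>z. c * (of_nat k * (\<phi> z - 1) - \<i> * z))"
    by (rule ext) (simp only: saddle_phase_def saddle_profile_def \<phi>_def c_def)
  show ?thesis
  proof (rule holomorphic_quadratic_leading_term[where D = D])
    fix z :: complex assume z: "z \<in> ball 0 1"
    have "((\<lambda>z. of_nat k * (\<phi> z - 1) - \<i> * z) has_field_derivative
       of_nat k * (\<i> / (1 - \<i> * z) / of_nat k * \<phi> z) - \<i>) (at z)"
      by (auto intro!: derivative_eq_intros d\<phi>[OF z])
    moreover have "of_nat k * (\<i> / (1 - \<i> * z) / of_nat k * \<phi> z) - \<i> = \<i> * \<phi> z / (1 - \<i> * z) - \<i>"
      using k by simp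
    ultimately show "(saddle_phase k has_field_derivative D z) (at z)"
      unfolding phase D_def by (simp only: DERIV_cmult)
  next
    have "((\<lambda>z. \<i> * \<phi> z / (1 - \<i> * z) - \<i>) has_field_derivative - (1 / of_nat k) - 1) (at 0)"
      by (auto intro!: derivative_eq_intros d\<phi> simp: \<phi>0)
    then have "(D has_field_derivative c * (- (1 / of_nat k) - 1)) (at 0)"
      unfolding D_def by (rule DERIV_cmult)
    moreover have "c * (- (1 / of_nat k) - 1) = - 2"
    proof -
      have "- (1 / of_nat k) - 1 = - (of_nat (k + 1) / of_nat k :: complex)" using k by (simp add: field_simps)
      moreover have "of_nat (k + 1) \<noteq> (0 :: complex)" by (metis Suc_eq_plus1 of_nat_neq_0)
      ultimately show ?thesis using k by (simp only: c_def) (simp del: of_nat_Suc of_nat_add)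
    qed
    ultimately show "(D has_field_derivative - 2) (at 0)" by simp
  qed (auto simp: phase D_def \<phi>0)
qed

lemma holomorphic_saddle_amplitude: "k > 0 \<Longrightarrow> saddle_amplitude k holomorphic_on ball 0 1"
  unfolding saddle_amplitude_def[abs_def] saddle_profile_def
  by (intro holomorphic_intros holomorphic_saddle_log) auto

lemma saddle_amplitude_0: "saddle_amplitude k 0 = 1"
  by (simp add: saddle_amplitude_def saddle_profile_def)

text \<open>The k-th root of w = (1 - i x) / X is a = X^(-1/k) (1 - i x)^(1/k). Its second factor is
  near 1 for small x, and the cone is stable under scaling, so u0 does not depend on X. The error is
  governed by |a|^k = |w|, at most 2 / X.\<close>

lemma log_gf_near_real_axis:
  assumes k: "k \<ge> 2"
  shows "\<exists>u0 C. 0 < u0 \<and> u0 < 1 \<and> C > 0 \<and> (\<forall>X x. X > 0 \<and> \<bar>x\<bar> \<le> u0 \<longrightarrow>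
     norm (log_gf k (of_real (1 / X) * (1 - \<i> * of_real x)) -
       (of_real (log_gf_constant k * X powr (1 / real k)) * exp (- saddle_log (of_real x) / of_nat k)
        + (saddle_log (of_real x) - of_real (ln X)) / 2 - of_real (real k / 2 * ln (2 * pi)))) \<le> C / X)"
proof -
  obtain \<tau> C where \<tau>: "\<tau> > 0" and C: "C > 0"
    and "\<forall>a\<in>sector_cone \<tau>. a \<noteq> 0 \<and> Re (a ^ k) > 0 \<and> Ln (a ^ k) = of_nat k * Ln a \<and>
     norm (log_gf k (a ^ k) - (of_real (log_gf_constant k) / a + of_nat k / 2 * (Ln a - of_real (ln (2 * pi))))) \<le> C * norm a ^ k"
    using log_gf_asymptotic[OF k] by blast
  then have as: "\<And>a. a \<in> sector_cone \<tau> \<Longrightarrow> norm (log_gf k (a ^ k) - (of_real (log_gf_constant k) / a + of_nat k / 2 * (Ln a - of_real (ln (2 * pi)))))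
     \<le> C * norm a ^ k"
    and cone: "\<And>a. a \<in> sector_cone \<tau> \<Longrightarrow> Ln (a ^ k) = of_nat k * Ln a"
    by blast+
  define \<alpha> where "\<alpha> = (\<lambda>z. exp (saddle_log z / of_nat k))"
  have "isCont \<alpha> 0" unfolding \<alpha>_def
    using k DERIV_isCont[OF saddle_log_deriv(1)[of 0]] by (intro continuous_intros) auto
  then obtain d where d: "d > 0" "\<And>z. norm z < d \<Longrightarrow> norm (\<alpha> z - 1) < \<tau>"
    using \<tau> unfolding continuous_at_eps_delta by (auto simp: dist_norm \<alpha>_def)
  define u0 where "u0 = min (d / 2) (1 / 2)"
  have u0: "0 < u0" "u0 < 1" "u0 < d" using d by (auto simp: u0_def)
  have "norm (log_gf k (of_real (1 / X) * (1 - \<i> * of_real x)) -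
       (of_real (log_gf_constant k * X powr (1 / real k)) * exp (- saddle_log (of_real x) / of_nat k)
        + (saddle_log (of_real x) - of_real (ln X)) / 2 - of_real (real k / 2 * ln (2 * pi)))) \<le> (2 * C) / X"
    if X: "X > 0" and x: "\<bar>x\<bar> \<le> u0" for X x
  proof -
    define z where "z = complex_of_real x"
    have z1: "z \<in> ball 0 1" using x u0 by (simp add: z_def)
    define \<rho> where "\<rho> = X powr (- 1 / real k)"
    have \<rho>: "\<rho> > 0" using X by (simp add: \<rho>_def)
    have \<rho>k: "\<rho> ^ k = 1 / X"
    proof -
      have "\<rho> ^ k = X powr (- 1 / real k * real k)"
        unfolding powr_realpow[OF \<rho>, symmetric] unfolding \<rho>_def by (rule powr_powr)
      also have "\<dots> = 1 / X" using X k by (simp add: powr_minus inverse_eq_divide)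
      finally show ?thesis .
    qed
    define a where "a = of_real \<rho> * \<alpha> z"
    have "norm (\<alpha> z - 1) < \<tau>" using d(2)[of z] x u0 by (simp add: z_def)
    then have "\<alpha> z \<in> sector_cone \<tau>" by (auto simp: sector_cone_def intro!: exI[of _ 1])
    then have a: "a \<in> sector_cone \<tau>" unfolding a_def using \<rho> by (rule cone_scale)
    have "\<alpha> z ^ k = exp (saddle_log z)"
      unfolding \<alpha>_def using k by (simp add: exp_of_nat_mult[symmetric])
    then have ak: "a ^ k = of_real (1 / X) * (1 - \<i> * z)"
      using saddle_log_deriv(3)[OF z1] by (simp add: a_def power_mult_distrib \<rho>k flip: of_real_power)
    have nz: "1 - \<i> * z \<noteq> 0" by (rule saddle_log_deriv(2)[OF z1])
    have "Ln (a ^ k) = of_real (ln (1 / X)) + saddle_log z"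
    proof -
      have "1 / X > 0" using X by simp
      from Ln_times_of_real[OF this nz] Ln_of_real[OF this] show ?thesis
        unfolding ak saddle_log_def by (simp only:)
    qed
    then have Lna: "of_nat k * Ln a = saddle_log z - of_real (ln X)"
      using cone[OF a] X by (simp add: ln_div)
    have inv: "of_real (log_gf_constant k) / a = of_real (log_gf_constant k * X powr (1 / real k)) * exp (- saddle_log z / of_nat k)"
    proof -
      have "1 / \<rho> = X powr (1 / real k)" by (simp add: \<rho>_def powr_minus inverse_eq_divide)
      then have "of_real (X powr (1 / real k)) = 1 / complex_of_real \<rho>" by (metis of_real_1 of_real_divide)
      moreover have "exp (- saddle_log z / of_nat k) = 1 / \<alpha> z" by (simp add: \<alpha>_def exp_minus inverse_eq_divide)
      ultimately show ?thesis by (simp add: a_def)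
    qed
    have "of_nat k / 2 * (Ln a - of_real (ln (2 * pi))) = (of_nat k * Ln a) / 2 - of_real (real k / 2 * ln (2 * pi))"
      by (simp add: algebra_simps)
    then have main: "of_real (log_gf_constant k) / a + of_nat k / 2 * (Ln a - of_real (ln (2 * pi)))
        = of_real (log_gf_constant k * X powr (1 / real k)) * exp (- saddle_log z / of_nat k)
          + (saddle_log z - of_real (ln X)) / 2 - of_real (real k / 2 * ln (2 * pi))"
      unfolding inv Lna by simp
    have "norm a ^ k = norm (a ^ k)" by (simp add: norm_power)
    also have "\<dots> = 1 / X * norm (1 - \<i> * z)" unfolding ak norm_mult norm_of_real using X by simp
    also have "norm (1 - \<i> * z) \<le> 2"
      using norm_triangle_ineq4[of 1 "\<i> * z"] x u0 by (simp add: norm_mult z_def)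
    finally have "norm a ^ k \<le> 1 / X * 2" using X by (simp add: divide_right_mono)
    then have "C * norm a ^ k \<le> C * (1 / X * 2)" using C by (intro mult_left_mono) auto
    moreover have "C * (1 / X * 2) = (2 * C) / X" by simp
    ultimately show ?thesis using as[OF a] unfolding main ak z_def by linarith
  qed
  then show ?thesis using u0 C by (intro exI[of _ u0] exI[of _ "2 * C"]) auto
qed

lemma log_gf_constant_pos: "k > 0 \<Longrightarrow> log_gf_constant k > 0"
proof -
  assume k: "k > 0"
  define p where "p = (real k + 1) / real k"
  have p: "p > 1" using k by (simp add: p_def)
  have "(\<Sum>n. real (Suc n) powr (- p)) > 0"
    using zeta_real_eq_suminf(1)[OF p] by (intro suminf_pos) auto
  then have "zeta_real p > 0" using zeta_real_eq_suminf(2)[OF p] by simp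
  moreover have "Gamma (1 / real k) > 0" using k by (intro Gamma_real_pos) simp
  ultimately show ?thesis using k by (simp add: log_gf_constant_def p_def)
qed

section \<open>Existence and growth of the saddle parameters\<close>

definition saddle_coefficient :: "nat \<Rightarrow> real" where
  "saddle_coefficient k = log_gf_constant k / real k"

lemma saddle_parameters_iff:
  assumes k: "k > 0"
  defines "B \<equiv> \<lambda>X. saddle_coefficient k * X powr (1 / real k)"
  shows "saddle_parameters k n X Y \<longleftrightarrow> X > 0 \<and> Y > 0 \<and>
     real n = X * B X - X / 2 - zeta_real (- real k) / 2 \<and> Y = (real k + 1) / (2 * real k) * B X - 1 / 4"
proof -
  have "1 / real k ^ 2 * zeta_real ((real k + 1) / real k) * Gamma (1 / real k) = saddle_coefficient k"
    by (simp add: saddle_coefficient_def log_gf_constant_def power2_eq_square)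
  moreover have "(real k + 1) / (2 * real k ^ 3) * zeta_real ((real k + 1) / real k) * Gamma (1 / real k)
     = (real k + 1) / (2 * real k) * saddle_coefficient k"
    by (simp add: saddle_coefficient_def log_gf_constant_def power3_eq_cube mult_ac)
  ultimately show ?thesis
    unfolding saddle_parameters_def B_def by (auto simp: right_diff_distrib mult.assoc)
qed

text \<open>For X below |R| the saddle point equation bounds n by a constant depending on R and
  k.\<close>

lemma saddle_parameters_large:
  assumes k: "k > 0"
  shows "\<forall>\<^sub>F n in sequentially. \<forall>X Y. saddle_parameters k n X Y \<longrightarrow> X \<ge> R"
proof -
  define A where "A = saddle_coefficient k"
  have A: "A > 0" using log_gf_constant_pos[OF k] k by (simp add: A_def saddle_coefficient_def)
  define z where "z = zeta_real (- real k)"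
  have "\<forall>\<^sub>F n in sequentially. real n > \<bar>R\<bar> * (A * \<bar>R\<bar> powr (1 / real k)) + \<bar>z\<bar>"
    by (rule filterlim_real_sequentially[unfolded filterlim_at_top_dense, rule_format])
  then show ?thesis
  proof eventually_elim
    case (elim n)
    show ?case
    proof (intro allI impI)
      fix X Y assume "saddle_parameters k n X Y"
      then have X: "X > 0" "real n = X * (A * X powr (1 / real k)) - X / 2 - z / 2"
        unfolding saddle_parameters_iff[OF k] A_def z_def by auto
      show "X \<ge> R"
      proof (rule ccontr)
        assume "\<not> X \<ge> R"
        then have XR: "X \<le> \<bar>R\<bar>" by simp
        have "X * (A * X powr (1 / real k)) \<le> \<bar>R\<bar> * (A * \<bar>R\<bar> powr (1 / real k))"
          using X XR A k by (intro mult_mono powr_mono2) auto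
        then show False using X elim by linarith
      qed
    qed
  qed
qed

text \<open>The intermediate value theorem between R, where B = 2, and X1. Beyond R the value of B
  is at least 2, so X B - X/2 is at least 3 X / 2, which at X1 outweighs n and z; the same bound
  gives Y \<ge> 3/4.\<close>

lemma saddle_parameters_exist:
  assumes k: "k > 0"
  shows "\<forall>\<^sub>F n in sequentially. \<exists>X Y. saddle_parameters k n X Y"
proof -
  define A where "A = saddle_coefficient k"
  have A: "A > 0" using log_gf_constant_pos[OF k] k by (simp add: A_def saddle_coefficient_def)
  define z where "z = zeta_real (- real k)"
  define B where "B = (\<lambda>X. A * X powr (1 / real k))"
  define f where "f = (\<lambda>X. X * B X - X / 2 - z / 2)"
  define R where "R = (2 / A) ^ k"
  have R: "R > 0" using A by (simp add: R_def)
  have BR: "B R = 2"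
  proof -
    have "R powr (1 / real k) = (2 / A) powr (real k * (1 / real k))"
      using A by (simp add: R_def powr_realpow[symmetric] powr_powr)
    then show ?thesis using A k by (simp add: B_def)
  qed
  have B2: "B X \<ge> 2" if "X \<ge> R" for X
  proof -
    have "B R \<le> B X" unfolding B_def using that A R by (intro mult_left_mono powr_mono2) auto
    then show ?thesis using BR by simp
  qed
  have "\<forall>\<^sub>F n in sequentially. real n > f R"
    by (rule filterlim_real_sequentially[unfolded filterlim_at_top_dense, rule_format])
  then show ?thesis
  proof eventually_elim
    case (elim n)
    define X1 where "X1 = R + real n + \<bar>z\<bar>"
    have X1: "X1 \<ge> R" by (simp add: X1_def)
    have "X1 * B X1 \<ge> X1 * 2" using B2[OF X1] X1 R by (intro mult_left_mono) auto
    moreover have "X1 \<ge> real n + \<bar>z\<bar>" "X1 \<ge> 0" using R X1 by (auto simp: X1_def)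
    ultimately have "f X1 \<ge> real n" unfolding f_def using abs_ge_self[of z] abs_ge_zero[of z] by linarith
    moreover have "continuous_on {R..X1} f" unfolding f_def B_def
      using R by (intro continuous_intros) auto
    ultimately obtain X where X: "R \<le> X" "X \<le> X1" "f X = real n"
      using IVT'[of f R "real n" X1] elim X1 by auto
    define Y where "Y = (real k + 1) / (2 * real k) * B X - 1 / 4"
    have "(real k + 1) / (2 * real k) \<ge> 1 / 2" using k by (simp add: field_simps)
    then have "(real k + 1) / (2 * real k) * B X \<ge> 1 / 2 * 2" using B2[OF X(1)] by (intro mult_mono) auto
    then have "Y > 0" unfolding Y_def by linarith
    then have "saddle_parameters k n X Y"
      unfolding saddle_parameters_iff[OF k] using X R by (auto simp: f_def B_def A_def z_def Y_def)
    then show ?case by blast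
  qed
qed

text \<open>Two relative errors at once: e is an error in the exponent, and (exp w - 1) / w comes
  from replacing exp w - 1 by w. For moduli up to 1, |exp e - 1| is at most 3 |e| and the quotient
  has modulus at most 4, hence 12.\<close>

lemma exp_times_quotient_bound:
  fixes e w :: complex
  assumes "norm e \<le> 1" "norm w \<le> 1" "w \<noteq> 0"
  shows "norm (exp e * ((exp w - 1) / w) - 1) \<le> 12 * norm e + 3 * norm w"
proof -
  define b where "b = (exp w - 1) / w"
  have le3: "exp (norm z) \<le> 3" if "norm z \<le> 1" for z :: complex
    using that exp_le order_trans[of "exp (norm z)" "exp 1" 3] by simp
  have "norm (exp e - 1) \<le> exp (norm e) * norm e" using Taylor_exp_field[of e 0] by simp
  also have "\<dots> \<le> 3 * norm e" using le3[OF assms(1)] by (intro mult_right_mono) auto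
  finally have e: "norm (exp e - 1) \<le> 3 * norm e" .
  have "norm (exp w - 1 - w) \<le> exp (norm w) * norm w ^ 2"
    using Taylor_exp_field[of w 1] by (simp add: diff_diff_eq numeral_2_eq_2)
  also have "\<dots> \<le> 3 * norm w ^ 2" using le3[OF assms(2)] by (intro mult_right_mono) auto
  finally have w: "norm (exp w - 1 - w) \<le> 3 * norm w ^ 2" .
  have "b - 1 = (exp w - 1 - w) / w" using assms(3) by (simp add: b_def diff_divide_distrib)
  then have "norm (b - 1) = norm (exp w - 1 - w) / norm w" by (simp add: norm_divide)
  also have "\<dots> \<le> 3 * norm w ^ 2 / norm w" using w by (intro divide_right_mono) auto
  also have "\<dots> = 3 * norm w" using assms(3) by (simp add: power2_eq_square)
  finally have b: "norm (b - 1) \<le> 3 * norm w" .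
  then have "norm b \<le> 4" using assms(2) norm_triangle_ineq[of "b - 1" 1] by simp
  then have "norm (exp e - 1) * norm b \<le> 3 * norm e * 4" using e by (intro mult_mono) auto
  moreover have "exp e * b - 1 = (exp e - 1) * b + (b - 1)" by (simp add: algebra_simps)
  ultimately show ?thesis
    using norm_triangle_ineq[of "(exp e - 1) * b" "b - 1"] b unfolding b_def[symmetric] norm_mult[symmetric] by (simp only:)
qed

text \<open>Because of the shift -1/4, Y times 2 k / (k + 1) falls short of B by k / (2 (k + 1)).
  This missing multiple of the profile does not depend on B and moves into the amplitude.\<close>

lemma saddle_exponent:
  fixes B Y :: real
  assumes k: "k > 0" and Y: "Y = (real k + 1) / (2 * real k) * B - 1 / 4"
  shows "of_real (B - 1 / 2) * (1 - \<i> * z) + of_real (real k * B) * exp (- saddle_log z / of_nat k) + saddle_log z / 2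
     = of_real ((real k + 1) * B - 1 / 2) + of_real Y * saddle_phase k z
       + (of_nat k / of_nat (2 * (k + 1)) * saddle_profile k z + (saddle_log z + \<i> * z) / 2)"
proof -
  define K L where "K = real k" and "L = real k + 1"
  have nz: "K \<noteq> 0" "L \<noteq> 0" using k by (auto simp: K_def L_def)
  have "(L / (2 * K) * B - 1 / 4) * (2 * K / L) + K / (2 * L) = B"
    using nz by (simp add: left_diff_distrib diff_divide_distrib)
  then have "Y * (real (2 * k) / real (k + 1)) + real k / real (2 * (k + 1)) = B"
    unfolding Y K_def L_def by (simp add: add.commute)
  then have "complex_of_real (Y * (real (2 * k) / real (k + 1)) + real k / real (2 * (k + 1))) = of_real B" by (simp only:)
  then have c: "of_real Y * (of_nat (2 * k) / of_nat (k + 1)) + of_nat k / of_nat (2 * (k + 1)) = complex_of_real B" by simp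
  have "of_real Y * saddle_phase k z + of_nat k / of_nat (2 * (k + 1)) * saddle_profile k z
      = (of_real Y * (of_nat (2 * k) / of_nat (k + 1)) + of_nat k / of_nat (2 * (k + 1))) * saddle_profile k z"
    unfolding saddle_phase_def by (simp only: distrib_right mult.assoc)
  also have "\<dots> = of_real B * saddle_profile k z" by (simp only: c)
  finally have "of_real Y * saddle_phase k z + of_nat k / of_nat (2 * (k + 1)) * saddle_profile k z
      = of_real B * saddle_profile k z" .
  moreover have "of_real (B - 1 / 2) * (1 - \<i> * z) + of_real (real k * B) * exp (- saddle_log z / of_nat k) + saddle_log z / 2
     = of_real ((real k + 1) * B - 1 / 2) + of_real B * saddle_profile k z + (saddle_log z + \<i> * z) / 2"
    unfolding saddle_profile_def by (simp add: algebra_simps add_divide_distrib diff_divide_distrib)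
  ultimately show ?thesis by (simp only: add.assoc[symmetric]) (simp only: add.assoc)
qed

text \<open>The integral over [-pi, pi] is split at |t| = u / X. Inside, t = x / X gives the measure
  dx / X and exp w - 1 is about (1 - i x) / X, which accounts for W / X^2. Outside, the minor arc
  bound is used with U = u, after u has been fixed by the two local approximations.\<close>

lemma difference_integral_estimate:
  assumes k: "k \<ge> 2"
  shows "\<exists>u c C X0. 0 < c \<and> half_expansion k (\<lambda>Y. integral {-u..u} (\<lambda>x. exp (of_real Y * saddle_phase k (of_real x)) * saddle_amplitude k (of_real x))) (of_real (sqrt pi)) \<and>
    (\<forall>n X Y W. saddle_parameters k n X Y \<and> X \<ge> X0 \<and>
       W = exp ((real k + 1) * (saddle_coefficient k * X powr (1 / real k)) - 1 / 2) * X powr (- 1 / 2) * (2 * pi) powr (- (real k / 2)) \<longrightarrow>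
       Y \<ge> 1 \<and> norm (of_real (2 * pi * (real (num_power_partitions k (n + 1)) - real (num_power_partitions k n)))
         - of_real (W / X ^ 2) * integral {-u..u} (\<lambda>x. exp (of_real Y * saddle_phase k (of_real x)) * saddle_amplitude k (of_real x)))
       \<le> W * C * (1 / (X ^ 3 * sqrt Y) + exp (- (c * X powr (1 / real k)))))"
proof -
  have k0: "k > 0" "k \<ge> 1" using k by auto
  define A where "A = saddle_coefficient k"
  have A: "A > 0" using log_gf_constant_pos[OF k0(1)] k by (simp add: A_def saddle_coefficient_def)
  define \<zeta> where "\<zeta> = zeta_real (- real k)"
  obtain g where g: "g holomorphic_on ball 0 1" and phase: "\<And>z. saddle_phase k z = - (z ^ 2) + z ^ 3 * g z"
    using saddle_phase_leading_term[OF k0(1)] by blast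
  obtain u1 where u1: "u1 > 0" "u1 \<le> 1 / 2" and
    lap: "\<And>u. 0 < u \<Longrightarrow> u \<le> u1 \<Longrightarrow> (\<forall>x\<in>{-u..u}. Re (saddle_phase k (of_real x)) \<le> - (x ^ 2 / 2)) \<and>
     half_expansion k (\<lambda>Y. integral {-u..u} (\<lambda>x. exp (of_real Y * saddle_phase k (of_real x)) * saddle_amplitude k (of_real x)))
       (of_real (sqrt pi) * saddle_amplitude k 0)"
    using laplace_expansion[OF g holomorphic_saddle_amplitude[OF k0(1)] k0(1)] unfolding phase by blast
  obtain u2 C0 where u2: "0 < u2" "u2 < 1" and C0: "C0 > 0" and near: "\<And>X x. X > 0 \<Longrightarrow> \<bar>x\<bar> \<le> u2 \<Longrightarrow>
     norm (log_gf k (of_real (1 / X) * (1 - \<i> * of_real x)) -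
       (of_real (log_gf_constant k * X powr (1 / real k)) * exp (- saddle_log (of_real x) / of_nat k)
        + (saddle_log (of_real x) - of_real (ln X)) / 2 - of_real (real k / 2 * ln (2 * pi)))) \<le> C0 / X"
    using log_gf_near_real_axis[OF k] by blast
  define u where "u = min u1 u2"
  have u: "0 < u" "u \<le> u1" "u \<le> u2" "u \<le> 1 / 2" using u1 u2 by (auto simp: u_def)
  note half = conjunct2[OF lap[OF u(1,2)]] and Rephase = conjunct1[OF lap[OF u(1,2)], rule_format]
  obtain c X1 where c: "c > 0" and minor: "\<And>X t. X \<ge> X1 \<Longrightarrow> u / X \<le> \<bar>t\<bar> \<Longrightarrow> \<bar>t\<bar> \<le> pi \<Longrightarrow>
     Re (log_gf k (Complex (1 / X) t)) \<le> Re (log_gf k (of_real (1 / X))) - c * X powr (1 / real k)"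
    using minor_arc_bound[OF k0(2) u(1)] by blast
  have ball: "complex_of_real x \<in> ball 0 1" if "x \<in> {-u..u}" for x using that u by auto
  have contf: "continuous_on {-u..u} (\<lambda>x. f (complex_of_real x))" if "f holomorphic_on ball 0 1" for f
    by (rule continuous_on_compose2[OF holomorphic_on_imp_continuous_on[OF that]]) (use ball in \<open>auto intro!: continuous_intros\<close>)
  have phase_hol: "saddle_phase k holomorphic_on ball 0 1"
    unfolding phase[abs_def] by (intro holomorphic_intros g)
  note amp_hol = holomorphic_saddle_amplitude[OF k0(1)]
  have "compact ((\<lambda>x. saddle_amplitude k (complex_of_real x)) ` {-u..u})"
    by (intro compact_continuous_image contf amp_hol) auto
  then obtain BH where BH: "BH > 0" "\<And>x. x \<in> {-u..u} \<Longrightarrow> norm (saddle_amplitude k (of_real x)) \<le> BH"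
    using compact_imp_bounded bounded_pos[of "(\<lambda>x. saddle_amplitude k (complex_of_real x)) ` {-u..u}"] by blast
  define F where "F = (\<lambda>Y x. exp (of_real Y * saddle_phase k (of_real x)) * saddle_amplitude k (complex_of_real x))"
  have Fint: "F Y integrable_on {-u..u}" for Y
    unfolding F_def by (intro integrable_continuous_interval continuous_intros contf phase_hol amp_hol)
  have Fbound: "norm (F Y x) \<le> BH * exp (- (Y / 2 * x ^ 2))" if "Y > 0" "x \<in> {-u..u}" for Y x
  proof -
    have "Y * Re (saddle_phase k (of_real x)) \<le> Y * (- (x ^ 2 / 2))"
      using Rephase[OF that(2)] that(1) by (intro mult_left_mono) auto
    then have "norm (exp (of_real Y * saddle_phase k (of_real x))) \<le> exp (- (Y / 2 * x ^ 2))" by simp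
    then show ?thesis unfolding F_def norm_mult using BH that by (subst mult.commute) (intro mult_mono, auto)
  qed
  \<comment> \<open>C0 bounds the error in the logarithm of the generating function, and |\<zeta>|
    the term \<zeta> (1 - i x) / (2 X) coming from the saddle point equation for n.\<close>
  define C1 where "C1 = C0 + \<bar>\<zeta>\<bar>"
  have C1: "C1 > 0" using C0 by (simp add: C1_def)
  \<comment> \<open>This is 12 |E| + 3 |w| with |E| at most C1 / X and |w| at most 2 / X.\<close>
  define C3 where "C3 = 12 * C1 + 6"
  have C3: "C3 > 0" using C1 by (simp add: C3_def)
  define C where "C = C3 * BH * (sqrt pi * sqrt 2) + 2 * pi * (4 * exp (\<bar>\<zeta>\<bar> + C0))"
  \<comment> \<open>The bounds C1 and 2 make |E| and |w| at most 1; the last entry gives B \<ge> 3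
    and hence Y \<ge> 1.\<close>
  define X0 where "X0 = max (max X1 2) (max C1 ((3 / A) ^ k))"
  have "Y \<ge> 1 \<and> norm (of_real (2 * pi * (real (num_power_partitions k (n + 1)) - real (num_power_partitions k n)))
         - of_real (W / X ^ 2) * integral {-u..u} (F Y)) \<le> W * C * (1 / (X ^ 3 * sqrt Y) + exp (- (c * X powr (1 / real k))))"
    if sp: "saddle_parameters k n X Y" and XX0: "X \<ge> X0"
      and W: "W = exp ((real k + 1) * (A * X powr (1 / real k)) - 1 / 2) * X powr (- 1 / 2) * (2 * pi) powr (- (real k / 2))" for n X Y W
  proof -
    define s where "s = X powr (1 / real k)"
    define B where "B = A * s"
    have X: "X \<ge> X1" "X \<ge> 2" "X \<ge> C1" "X \<ge> (3 / A) ^ k" using XX0 by (auto simp: X0_def)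
    have Xpos: "X > 0" using X(2) by simp
    have n: "real n = X * B - X / 2 - \<zeta> / 2" and Y: "Y = (real k + 1) / (2 * real k) * B - 1 / 4"
      using sp unfolding saddle_parameters_iff[OF k0(1)] B_def s_def A_def \<zeta>_def by auto
    have "((3 / A) ^ k) powr (1 / real k) \<le> s"
      unfolding s_def using X(4) A k0 by (intro powr_mono2) auto
    moreover have "((3 / A) ^ k) powr (1 / real k) = 3 / A"
      using A k0 by (simp add: powr_realpow[symmetric] powr_powr)
    ultimately have "3 / A \<le> s" by (simp only:)
    then have B3: "B \<ge> 3" using A unfolding B_def by (simp only: pos_divide_le_eq mult.commute)
    have "(real k + 1) / (2 * real k) \<ge> 1 / 2" using k0 by (simp add: field_simps)
    then have "(real k + 1) / (2 * real k) * B \<ge> 1 / 2 * 3" using B3 by (intro mult_mono) auto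
    then have Y1: "Y \<ge> 1" unfolding Y by linarith
    have Wpos: "W > 0" using Xpos by (simp add: W)
    define \<sigma> where "\<sigma> = 1 / X"
    have \<sigma>: "\<sigma> > 0" "\<sigma> \<le> 1 / 2" using X(2) by (auto simp: \<sigma>_def field_simps)
    define f where "f = (\<lambda>t. exp (of_nat n * Complex \<sigma> (- t)) * (exp (Complex \<sigma> (- t)) - 1) * exp (log_gf k (Complex \<sigma> (- t))))"
    define \<Delta> where "\<Delta> = 2 * pi * (real (num_power_partitions k (n + 1)) - real (num_power_partitions k n))"
    have fI: "(f has_integral of_real \<Delta>) {-pi..pi}"
      unfolding f_def \<Delta>_def by (rule power_partitions_difference_integral[OF k0(1) \<sigma>(1)])
    have fint: "f integrable_on {a..b}" if "-pi \<le> a" "b \<le> pi" for a b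
      using has_integral_integrable[OF fI] that by (rule_tac integrable_on_subinterval) auto
    define v where "v = u / X"
    have v: "0 < v" "v \<le> pi"
    proof -
      show "0 < v" using u Xpos by (simp add: v_def)
      have "v \<le> (1 / 2) / 2" unfolding v_def using u X(2) by (intro frac_le) auto
      then show "v \<le> pi" using pi_gt3 by linarith
    qed
    \<comment> \<open>The part of the exponent that does not vary with x.\<close>
    have lnW: "W = exp ((real k + 1) * B - 1 / 2 - ln X / 2 - real k / 2 * ln (2 * pi))"
      using Xpos by (simp add: W B_def s_def powr_def exp_add[symmetric] exp_diff[symmetric] algebra_simps)
    have kB: "log_gf_constant k * X powr (1 / real k) = real k * B"
      using k0 by (simp add: B_def A_def s_def saddle_coefficient_def)
    have nX: "real n / X = B - 1 / 2 - \<zeta> / (2 * X)"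
      using Xpos unfolding n by (simp add: field_simps)

    define w where "w = (\<lambda>x. of_real \<sigma> * (1 - \<i> * complex_of_real x))"
    define E where "E = (\<lambda>x. of_nat n * w x + log_gf k (w x)
       - (of_real (ln W) + of_real Y * saddle_phase k (of_real x)
          + (of_nat k / of_nat (2 * (k + 1)) * saddle_profile k (of_real x) + (saddle_log (of_real x) + \<i> * of_real x) / 2)))"
    have E: "norm (E x) \<le> C1 / X" if x: "x \<in> {-u..u}" for x
    proof -
      define z where "z = complex_of_real x"
      define R where "R = log_gf k (w x) - (of_real (real k * B) * exp (- saddle_log z / of_nat k)
          + (saddle_log z - of_real (ln X)) / 2 - of_real (real k / 2 * ln (2 * pi)))"
      have R: "norm R \<le> C0 / X"
        using near[OF Xpos, of x] x u unfolding kB R_def w_def \<sigma>_def z_def by auto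
      have nw: "of_nat n * w x = of_real (real n / X) * (1 - \<i> * z)"
        by (simp add: w_def \<sigma>_def z_def)
      have lnW': "ln W = ((real k + 1) * B - 1 / 2) - ln X / 2 - real k / 2 * ln (2 * pi)" by (simp add: lnW)
      have "E x = R - of_real (\<zeta> / (2 * X)) * (1 - \<i> * z)"
      proof -
        have "of_nat n * w x = of_real (B - 1 / 2) * (1 - \<i> * z) - of_real (\<zeta> / (2 * X)) * (1 - \<i> * z)"
          unfolding nw nX by (simp add: algebra_simps)
        moreover have "log_gf k (w x) = R + (of_real (real k * B) * exp (- saddle_log z / of_nat k)
          + (saddle_log z - of_real (ln X)) / 2 - of_real (real k / 2 * ln (2 * pi)))" by (simp add: R_def)
        ultimately have "E x = (of_real (B - 1 / 2) * (1 - \<i> * z) + of_real (real k * B) * exp (- saddle_log z / of_nat k) + saddle_log z / 2)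
           - (of_real ((real k + 1) * B - 1 / 2) + of_real Y * saddle_phase k z
             + (of_nat k / of_nat (2 * (k + 1)) * saddle_profile k z + (saddle_log z + \<i> * z) / 2))
           + (R - of_real (\<zeta> / (2 * X)) * (1 - \<i> * z))"
          unfolding E_def lnW' z_def[symmetric] of_real_diff by (simp add: diff_divide_distrib)
        then show ?thesis unfolding saddle_exponent[OF k0(1) Y] by simp
      qed
      then have "norm (E x) \<le> norm R + norm (of_real (\<zeta> / (2 * X)) * (1 - \<i> * z))" by (simp add: norm_triangle_ineq4)
      also have "norm (of_real (\<zeta> / (2 * X)) * (1 - \<i> * z)) \<le> (\<bar>\<zeta>\<bar> / (2 * X)) * 2"
      proof -
        have x1: "\<bar>x\<bar> \<le> 1" using x u by auto
        have "norm (1 - \<i> * z) \<le> 2" using norm_triangle_ineq4[of 1 "\<i> * z"] x1 by (simp add: norm_mult z_def)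
        then show ?thesis unfolding norm_mult norm_of_real using Xpos by (intro mult_mono) (auto simp: abs_divide)
      qed
      finally show ?thesis using R by (simp add: C1_def add_divide_distrib)
    qed
    have wne: "w x \<noteq> 0" "norm (w x) \<le> 2 / X" if x: "x \<in> {-u..u}" for x
    proof -
      have "Re (w x) = \<sigma>" by (simp add: w_def)
      then show "w x \<noteq> 0" using \<sigma> by auto
      have x1: "\<bar>x\<bar> \<le> 1" using x u by auto
      have "norm (1 - \<i> * complex_of_real x) \<le> 2" using norm_triangle_ineq4[of 1 "\<i> * complex_of_real x"] x1 by (simp add: norm_mult)
      then have "\<sigma> * norm (1 - \<i> * complex_of_real x) \<le> \<sigma> * 2" using \<sigma> by (intro mult_left_mono) auto
      then show "norm (w x) \<le> 2 / X" using \<sigma>(1) unfolding w_def norm_mult norm_of_real by (simp only: abs_of_pos) (simp add: \<sigma>_def)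
    qed
    have fx: "norm (f (\<sigma> * x) - of_real (W / X) * F Y x) \<le> (W / X) * (C3 / X) * (BH * exp (- (Y / 2 * x ^ 2)))" if x: "x \<in> {-u..u}" for x
    proof -
      define z where "z = complex_of_real x"
      \<comment> \<open>The relative error of the integrand: the exponent error E together with the
        replacement of exp w - 1 by w.\<close>
      define \<kappa> where "\<kappa> = exp (E x) * ((exp (w x) - 1) / w x) - 1"
      have cw: "Complex \<sigma> (- (\<sigma> * x)) = w x" by (simp add: w_def complex_eq_iff)
      have expW: "exp (of_real (ln W)) = complex_of_real W" using Wpos by (simp add: exp_of_real)
      have "f (\<sigma> * x) = exp (of_nat n * w x + log_gf k (w x)) * (exp (w x) - 1)"
        unfolding f_def cw exp_add by (simp add: mult_ac)
      also have "of_nat n * w x + log_gf k (w x) = E x + (of_real (ln W) + of_real Y * saddle_phase k z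
          + (of_nat k / of_nat (2 * (k + 1)) * saddle_profile k z + (saddle_log z + \<i> * z) / 2))"
        by (simp add: E_def z_def)
      also have "exp \<dots> * (exp (w x) - 1) = of_real W * exp (of_real Y * saddle_phase k z) *
          (w x * exp (of_nat k / of_nat (2 * (k + 1)) * saddle_profile k z + (saddle_log z + \<i> * z) / 2)) * (\<kappa> + 1)"
        unfolding exp_add[of "E x"] exp_add[of "of_real (ln W) + of_real Y * saddle_phase k z"] exp_add[of "of_real (ln W)"] expW \<kappa>_def
        using wne(1)[OF x] by (simp add: mult_ac)
      also have "w x * exp (of_nat k / of_nat (2 * (k + 1)) * saddle_profile k z + (saddle_log z + \<i> * z) / 2) = of_real (1 / X) * saddle_amplitude k z"
        unfolding w_def saddle_amplitude_def z_def \<sigma>_def by (simp only: mult.assoc)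
      also have "of_real W * exp (of_real Y * saddle_phase k z) * (of_real (1 / X) * saddle_amplitude k z) * (\<kappa> + 1) = of_real (W / X) * F Y x * (\<kappa> + 1)"
        by (simp add: F_def z_def)
      finally have "f (\<sigma> * x) - of_real (W / X) * F Y x = of_real (W / X) * F Y x * \<kappa>"
        by (simp only: distrib_left mult_1_right add_diff_cancel_right')
      then have "norm (f (\<sigma> * x) - of_real (W / X) * F Y x) = (W / X) * norm (F Y x) * norm \<kappa>"
        using Wpos Xpos by (simp add: norm_mult norm_divide)
      also have "norm \<kappa> \<le> C3 / X"
      proof -
        have "C1 / X \<le> 1" "2 / X \<le> 1" using X Xpos by auto
        then have "norm \<kappa> \<le> 12 * norm (E x) + 3 * norm (w x)"
          unfolding \<kappa>_def using E[OF x] wne[OF x] by (intro exp_times_quotient_bound) auto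
        also have "\<dots> \<le> 12 * (C1 / X) + 3 * (2 / X)" using E[OF x] wne(2)[OF x] by linarith
        also have "\<dots> = C3 / X" by (simp add: C3_def add_divide_distrib)
        finally show ?thesis .
      qed
      then have "(W / X) * norm (F Y x) * norm \<kappa> \<le> (W / X) * (BH * exp (- (Y / 2 * x ^ 2))) * (C3 / X)"
        using Fbound[of Y x] Y1 x Wpos Xpos BH by (intro mult_mono) auto
      finally show ?thesis by (simp only: mult_ac)
    qed
    define i2 where "i2 = integral {-v..v} f"
    have "(f has_integral i2) (cbox (-v) v)" unfolding i2_def cbox_interval using fint v by (intro integrable_integral) auto
    from has_integral_affinity'[OF this \<sigma>(1), of 0]
    have i2: "((\<lambda>x. f (\<sigma> * x)) has_integral (i2 /\<^sub>R \<sigma>)) {-u..u}"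
      using Xpos by (simp add: v_def \<sigma>_def)
    have "norm (i2 /\<^sub>R \<sigma> - of_real (W / X) * integral {-u..u} (F Y)) \<le> (W / X) * (C3 / X) * (BH * (sqrt pi / sqrt (Y / 2)))"
    proof -
      have d: "((\<lambda>x. f (\<sigma> * x) - of_real (W / X) * F Y x) has_integral (i2 /\<^sub>R \<sigma> - of_real (W / X) * integral {-u..u} (F Y))) {-u..u}"
        by (intro has_integral_diff i2 has_integral_mult_right integrable_integral Fint)
      have "norm (integral {-u..u} (\<lambda>x. f (\<sigma> * x) - of_real (W / X) * F Y x)) \<le> integral {-u..u} (\<lambda>x. (W / X) * (C3 / X) * (BH * exp (- (Y / 2 * x ^ 2))))"
      proof (rule integral_norm_bound_integral[OF has_integral_integrable[OF d]])
        show "(\<lambda>x. (W / X) * (C3 / X) * (BH * exp (- (Y / 2 * x ^ 2)))) integrable_on {-u..u}"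
          by (intro integrable_continuous_interval continuous_intros)
      qed (rule fx)
      also have "\<dots> = (W / X) * (C3 / X) * (BH * integral {-u..u} (\<lambda>x. exp (- (Y / 2 * x ^ 2))))" by simp
      also have "\<dots> \<le> (W / X) * (C3 / X) * (BH * (sqrt pi / sqrt (Y / 2)))"
        using Wpos Xpos C3 BH Y1 u by (intro mult_left_mono gaussian_integral_le) auto
      finally show ?thesis unfolding integral_unique[OF d] .
    qed
    then have "\<sigma> * norm (i2 /\<^sub>R \<sigma> - of_real (W / X) * integral {-u..u} (F Y)) \<le> \<sigma> * ((W / X) * (C3 / X) * (BH * (sqrt pi / sqrt (Y / 2))))"
      using \<sigma> by (intro mult_left_mono) auto
    also have "\<sigma> * norm (i2 /\<^sub>R \<sigma> - of_real (W / X) * integral {-u..u} (F Y)) = norm (i2 - of_real (W / X ^ 2) * integral {-u..u} (F Y))"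
    proof -
      have "norm (of_real \<sigma> * (i2 /\<^sub>R \<sigma> - of_real (W / X) * integral {-u..u} (F Y))) = \<sigma> * norm (i2 /\<^sub>R \<sigma> - of_real (W / X) * integral {-u..u} (F Y))"
        using \<sigma> by (simp only: norm_mult norm_of_real abs_of_pos)
      moreover have "of_real \<sigma> * (i2 /\<^sub>R \<sigma> - of_real (W / X) * integral {-u..u} (F Y)) = i2 - of_real (W / X ^ 2) * integral {-u..u} (F Y)"
        using \<sigma> Xpos by (simp add: right_diff_distrib scaleR_conv_of_real) (simp add: \<sigma>_def power2_eq_square)
      ultimately show ?thesis by simp
    qed
    also have "\<sigma> * ((W / X) * (C3 / X) * (BH * (sqrt pi / sqrt (Y / 2)))) = W * (C3 * BH * (sqrt pi * sqrt 2)) * (1 / (X ^ 3 * sqrt Y))"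
      using Xpos Y1 by (simp add: \<sigma>_def real_sqrt_divide power3_eq_cube)
    finally have main: "norm (i2 - of_real (W / X ^ 2) * integral {-u..u} (F Y)) \<le> W * (C3 * BH * (sqrt pi * sqrt 2)) * (1 / (X ^ 3 * sqrt Y))" .

    \<comment> \<open>At the real point the exponent is at most ln W + |\<zeta>| + C0, the minor arc
      bound subtracts c s, and |exp w - 1| is at most exp 1 + 1 \<le> 4.\<close>
    define T where "T = 4 * exp (\<bar>\<zeta>\<bar> + C0) * W * exp (- (c * s))"
    have T0: "T \<ge> 0" using Wpos by (simp add: T_def)
    have tail: "norm (f t) \<le> T" if t: "v \<le> \<bar>t\<bar>" "\<bar>t\<bar> \<le> pi" for t
    proof -
      have m: "Re (log_gf k (Complex \<sigma> (- t))) \<le> Re (log_gf k (of_real \<sigma>)) - c * s"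
        using minor[OF X(1), of "- t"] t by (simp add: v_def \<sigma>_def s_def)
      have r0: "norm (log_gf k (of_real \<sigma>) - of_real (real k * B - ln X / 2 - real k / 2 * ln (2 * pi))) \<le> C0 / X"
        using near[OF Xpos, of 0] u2 unfolding kB by (simp add: \<sigma>_def)
      have "Re (log_gf k (of_real \<sigma>)) - (real k * B - ln X / 2 - real k / 2 * ln (2 * pi)) \<le> C0 / X"
        using r0 complex_Re_le_cmod[of "log_gf k (of_real \<sigma>) - of_real (real k * B - ln X / 2 - real k / 2 * ln (2 * pi))"] by simp
      moreover have "C0 / X \<le> C0 / 1" using C0 X(2) by (intro divide_left_mono) auto
      moreover have "- (\<zeta> / (2 * X)) \<le> \<bar>\<zeta>\<bar>"
      proof -
        have "\<bar>\<zeta> / (2 * X)\<bar> \<le> \<bar>\<zeta>\<bar> / 1" unfolding abs_divide using X(2) by (intro divide_left_mono) auto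
        then show ?thesis by linarith
      qed
      ultimately have expo: "real n * \<sigma> + Re (log_gf k (Complex \<sigma> (- t))) \<le> ln W + (\<bar>\<zeta>\<bar> + C0) - c * s"
        using m nX unfolding lnW \<sigma>_def by (simp add: algebra_simps)
      have "norm (f t) = exp (real n * \<sigma>) * norm (exp (Complex \<sigma> (- t)) - 1) * exp (Re (log_gf k (Complex \<sigma> (- t))))"
        by (simp add: f_def norm_mult)
      also have "norm (exp (Complex \<sigma> (- t)) - 1) \<le> 4"
      proof -
        have "norm (exp (Complex \<sigma> (- t)) - 1) \<le> exp \<sigma> + 1" using norm_triangle_ineq4[of "exp (Complex \<sigma> (- t))" 1] by simp
        also have "exp \<sigma> \<le> exp 1" using \<sigma> by simp
        finally show ?thesis using exp_le by simp
      qed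
      also have "exp (real n * \<sigma>) * 4 * exp (Re (log_gf k (Complex \<sigma> (- t)))) = 4 * exp (real n * \<sigma> + Re (log_gf k (Complex \<sigma> (- t))))"
        by (simp add: exp_add)
      also have "\<dots> \<le> 4 * exp (ln W + (\<bar>\<zeta>\<bar> + C0) - c * s)" using expo by simp
      also have "\<dots> = T" using Wpos unfolding T_def by (simp add: exp_add exp_diff exp_minus divide_inverse)
      finally show ?thesis by (simp add: mult_right_mono mult_left_mono)
    qed
    have i1: "norm (integral {-pi..-v} f) \<le> T * pi"
    proof -
      have "(f has_integral integral {-pi..-v} f) {-pi..-v}" using fint v by (intro integrable_integral) auto
      moreover have "norm (f t) \<le> T" if "t \<in> {-pi..-v}" for t using that v by (intro tail) auto
      ultimately have "norm (integral {-pi..-v} f) \<le> T * measure lborel {-pi..-v}"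
        using has_integral_bound_real[OF T0 finite.emptyI] by blast
      also have "\<dots> \<le> T * pi" using v T0 by (intro mult_left_mono) auto
      finally show ?thesis .
    qed
    have i3: "norm (integral {v..pi} f) \<le> T * pi"
    proof -
      have "(f has_integral integral {v..pi} f) {v..pi}" using fint v by (intro integrable_integral) auto
      moreover have "norm (f t) \<le> T" if "t \<in> {v..pi}" for t using that v by (intro tail) auto
      ultimately have "norm (integral {v..pi} f) \<le> T * measure lborel {v..pi}"
        using has_integral_bound_real[OF T0 finite.emptyI] by blast
      also have "\<dots> \<le> T * pi" using v T0 by (intro mult_left_mono) auto
      finally show ?thesis .
    qed
    have "of_real \<Delta> = integral {-pi..pi} f" using fI by (simp add: integral_unique)
    also have "\<dots> = integral {-pi..-v} f + integral {-v..pi} f"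
      using fint v by (intro Henstock_Kurzweil_Integration.integral_combine[symmetric]) auto
    also have "integral {-v..pi} f = i2 + integral {v..pi} f"
      unfolding i2_def using fint v by (intro Henstock_Kurzweil_Integration.integral_combine[symmetric]) auto
    finally have "of_real \<Delta> - of_real (W / X ^ 2) * integral {-u..u} (F Y)
        = (i2 - of_real (W / X ^ 2) * integral {-u..u} (F Y)) + (integral {-pi..-v} f + integral {v..pi} f)" by simp
    also have "norm \<dots> \<le> W * (C3 * BH * (sqrt pi * sqrt 2)) * (1 / (X ^ 3 * sqrt Y)) + (T * pi + T * pi)"
      by (intro norm_triangle_le add_mono main i1 i3)
    also have "T * pi + T * pi = W * (2 * pi * (4 * exp (\<bar>\<zeta>\<bar> + C0))) * exp (- (c * s))" by (simp add: T_def)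
    also have "W * (C3 * BH * (sqrt pi * sqrt 2)) * (1 / (X ^ 3 * sqrt Y)) + W * (2 * pi * (4 * exp (\<bar>\<zeta>\<bar> + C0))) * exp (- (c * s))
       \<le> W * C * (1 / (X ^ 3 * sqrt Y)) + W * C * exp (- (c * s))"
    proof (intro add_mono mult_right_mono mult_left_mono)
      show "C3 * BH * (sqrt pi * sqrt 2) \<le> C" by (simp add: C_def)
      show "2 * pi * (4 * exp (\<bar>\<zeta>\<bar> + C0)) \<le> C" using C3 BH by (simp add: C_def)
    qed (use Wpos Xpos Y1 in auto)
    finally show ?thesis using Y1 unfolding \<Delta>_def s_def by (simp only: distrib_left)
  qed
  then show ?thesis using half c unfolding F_def A_def saddle_amplitude_0 mult_1_right by blast
qed

section \<open>Normalising factors and the final error estimate\<close>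

lemma saddle_prefactor:
  assumes X: "X > 0" and Y: "Y > 0" and k: "k > 0"
    and W: "W = exp ((real k + 1) * (saddle_coefficient k * X powr (1 / real k)) - 1 / 2) * X powr (- 1 / 2) * (2 * pi) powr (- (real k / 2))"
  shows "exp ((real k + 1) / real k ^ 2 * zeta_real ((real k + 1) / real k) * Gamma (1 / real k) * X powr (1 / real k) - 1 / 2)
      / ((2 * pi) powr ((real k + 2) / 2) * X powr (5 / 2) * Y powr (1 / 2)) = W / X ^ 2 / sqrt Y / (2 * pi)"
proof -
  have "(2 * pi) powr ((real k + 2) / 2) = (2 * pi) powr (real k / 2 + 1)" by (simp add: add_divide_distrib)
  also have "\<dots> = (2 * pi) powr (real k / 2) * (2 * pi)" by (subst powr_add) simp
  finally have p: "(2 * pi) powr ((real k + 2) / 2) = (2 * pi) powr (real k / 2) * (2 * pi)" .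
  have "X powr (5 / 2) = X powr (2 + 1 / 2)" by simp
  also have "\<dots> = X ^ 2 * sqrt X" using X by (subst powr_add) (simp add: powr_half_sqrt)
  finally have x: "X powr (5 / 2) = X ^ 2 * sqrt X" .
  have x': "X powr (- 1 / 2) = 1 / sqrt X"
    using X by (simp add: powr_minus powr_half_sqrt inverse_eq_divide)
  have p': "(2 * pi) powr (- (real k / 2)) = 1 / (2 * pi) powr (real k / 2)"
    by (simp only: powr_minus inverse_eq_divide)
  have y: "Y powr (1 / 2) = sqrt Y" using Y by (simp add: powr_half_sqrt)
  have e: "(real k + 1) / real k ^ 2 * zeta_real ((real k + 1) / real k) * Gamma (1 / real k) * X powr (1 / real k)
     = (real k + 1) * (saddle_coefficient k * X powr (1 / real k))"
    by (simp add: saddle_coefficient_def log_gf_constant_def power2_eq_square)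
  show ?thesis unfolding W p x x' p' y e by simp
qed

text \<open>These are the two errors relative to the main size W / (X^2 sqrt Y). With X = s^k and Y
  \<le> A s the first is at most A^k Y^(-k). For the second, X^2 sqrt Y Y^k is at most A^(k+1)
  s^(3k+1), and the exponential series gives (c s)^(3k+1) \<le> (3k+1)! exp (c s).\<close>

lemma saddle_error_bound:
  fixes A c s X Y :: real
  assumes "A > 0" "c > 0" "s > 0" "X = s ^ k" "Y \<ge> 1" "Y \<le> A * s"
  shows "1 / X + X ^ 2 * sqrt Y * exp (- (c * s)) \<le> (A ^ k + A ^ (k + 1) * fact (3 * k + 1) / c ^ (3 * k + 1)) * inverse (Y ^ k)"
proof -
  have X: "X > 0" using assms by simp
  have Yk: "Y ^ k > 0" using assms by simp
  have "Y ^ k \<le> (A * s) ^ k" using assms by (intro power_mono) auto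
  then have "Y ^ k \<le> A ^ k * X" using assms by (simp add: power_mult_distrib)
  then have 1: "1 / X \<le> A ^ k * inverse (Y ^ k)" using X Yk by (simp add: field_simps)
  have "sqrt Y \<le> sqrt (Y ^ 2)" using assms(5) by (intro real_sqrt_le_mono) (simp add: self_le_power)
  then have "sqrt Y \<le> Y" using assms(5) by simp
  then have "sqrt Y * Y ^ k \<le> Y ^ (k + 1)" using Yk by (simp add: mult_right_mono)
  also have "\<dots> \<le> (A * s) ^ (k + 1)" using assms by (intro power_mono) auto
  finally have "X ^ 2 * (sqrt Y * Y ^ k) \<le> X ^ 2 * (A * s) ^ (k + 1)" by (intro mult_left_mono) auto
  also have "\<dots> = A ^ (k + 1) * (s ^ (2 * k) * s ^ (k + 1))"
    unfolding assms(4) power_mult_distrib by (simp add: power_mult[symmetric] mult.commute mult.left_commute)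
  also have "s ^ (2 * k) * s ^ (k + 1) = s ^ (3 * k + 1)" by (simp flip: power_add)
  finally have a: "X ^ 2 * (sqrt Y * Y ^ k) \<le> A ^ (k + 1) * s ^ (3 * k + 1)" .
  have "c ^ (3 * k + 1) * s ^ (3 * k + 1) \<le> fact (3 * k + 1) * exp (c * s)"
    unfolding power_mult_distrib[symmetric] using assms by (intro power_le_fact_exp) auto
  then have "s ^ (3 * k + 1) \<le> fact (3 * k + 1) * exp (c * s) / c ^ (3 * k + 1)"
    using assms(2) by (simp only: pos_le_divide_eq zero_less_power mult.commute)
  then have "A ^ (k + 1) * s ^ (3 * k + 1) \<le> A ^ (k + 1) * (fact (3 * k + 1) * exp (c * s) / c ^ (3 * k + 1))"
    using assms by (intro mult_left_mono) auto
  with a have "X ^ 2 * (sqrt Y * Y ^ k) \<le> A ^ (k + 1) * fact (3 * k + 1) / c ^ (3 * k + 1) * exp (c * s)"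
    by (simp only: times_divide_eq_right times_divide_eq_left mult.assoc)
  then have "X ^ 2 * (sqrt Y * Y ^ k) * (exp (- (c * s)) * inverse (Y ^ k))
     \<le> A ^ (k + 1) * fact (3 * k + 1) / c ^ (3 * k + 1) * exp (c * s) * (exp (- (c * s)) * inverse (Y ^ k))"
    using Yk by (intro mult_right_mono) auto
  moreover have "X ^ 2 * (sqrt Y * Y ^ k) * (exp (- (c * s)) * inverse (Y ^ k)) = X ^ 2 * sqrt Y * exp (- (c * s))"
    using Yk by (simp add: field_simps)
  moreover have "G * exp (c * s) * (exp (- (c * s)) * inverse (Y ^ k)) = G * inverse (Y ^ k)" for G
    by (simp add: exp_minus)
  ultimately have "X ^ 2 * sqrt Y * exp (- (c * s)) \<le> A ^ (k + 1) * fact (3 * k + 1) / c ^ (3 * k + 1) * inverse (Y ^ k)"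
    by (simp only:)
  with 1 show ?thesis unfolding distrib_right by (rule add_mono)
qed

theorem theorem2:
  fixes k :: nat
  assumes "k \<ge> 2"
  shows "\<exists>(d :: nat \<Rightarrow> real) (C :: real). \<forall>\<^sub>F n in sequentially.
           (\<exists>X Y. saddle_parameters k n X Y) \<and>
           (\<forall>X Y. saddle_parameters k n X Y \<longrightarrow>
              (\<exists>E :: real. \<bar>E\<bar> \<le> C * Y powi (- int k) \<and>
                 real (num_power_partitions k (n + 1)) - real (num_power_partitions k n) =
                   exp ((real k + 1) / real k ^ 2 * zeta_real ((real k + 1) / real k)
                          * Gamma (1 / real k) * X powr (1 / real k) - 1 / 2)
                   / ((2 * pi) powr ((real k + 2) / 2) * X powr (5 / 2) * Y powr (1 / 2))
                   * (pi powr (1 / 2) + (\<Sum>j = 1..k - 1. d j * Y powi (- int j)) + E)))"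
proof -
  have k0: "k > 0" using assms by simp
  define A where "A = saddle_coefficient k"
  have A: "A > 0" using log_gf_constant_pos[OF k0] k0 by (simp add: A_def saddle_coefficient_def)
  obtain u c C X0 where c: "0 < c" and half: "half_expansion k (\<lambda>Y. integral {-u..u} (\<lambda>x. exp (of_real Y * saddle_phase k (of_real x)) * saddle_amplitude k (of_real x))) (of_real (sqrt pi))"
    and est: "\<forall>n X Y W. saddle_parameters k n X Y \<and> X \<ge> X0 \<and>
       W = exp ((real k + 1) * (saddle_coefficient k * X powr (1 / real k)) - 1 / 2) * X powr (- 1 / 2) * (2 * pi) powr (- (real k / 2)) \<longrightarrow>
       Y \<ge> 1 \<and> norm (of_real (2 * pi * (real (num_power_partitions k (n + 1)) - real (num_power_partitions k n)))
         - of_real (W / X ^ 2) * integral {-u..u} (\<lambda>x. exp (of_real Y * saddle_phase k (of_real x)) * saddle_amplitude k (of_real x)))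
       \<le> W * C * (1 / (X ^ 3 * sqrt Y) + exp (- (c * X powr (1 / real k))))"
    using difference_integral_estimate[OF assms] by (elim exE conjE) (rule that)
  define J where "J = (\<lambda>Y. integral {-u..u} (\<lambda>x. exp (of_real Y * saddle_phase k (of_real x)) * saddle_amplitude k (complex_of_real x)))"
  obtain d' Cd where d0: "d' 0 = complex_of_real (sqrt pi)" and
    d': "\<forall>Y\<ge>1. norm (J Y - of_real (Y powr (- 1 / 2)) * (\<Sum>j<k. d' j * of_real (Y powr (- real j)))) \<le> Cd * Y powr (- 1 / 2 - real k)"
    using half unfolding half_expansion_def J_def[symmetric] by (elim exE conjE) (rule that)
  \<comment> \<open>The counted difference is real, so real parts of the complex coefficients
    suffice; the one of index 0 is the explicit sqrt pi.\<close>
  define d where "d = (\<lambda>j. Re (d' j))"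
  \<comment> \<open>The first part bounds the error of the integral estimate through
    \<open>saddle_error_bound\<close>, and \<open>Cd\<close> the truncation of the Laplace
    expansion.\<close>
  define K where "K = \<bar>C\<bar> * (A ^ k + A ^ (k + 1) * fact (3 * k + 1) / c ^ (3 * k + 1)) + Cd"
  have main: "\<exists>E :: real. \<bar>E\<bar> \<le> K * Y powi (- int k) \<and>
                 real (num_power_partitions k (n + 1)) - real (num_power_partitions k n) =
                   exp ((real k + 1) / real k ^ 2 * zeta_real ((real k + 1) / real k)
                          * Gamma (1 / real k) * X powr (1 / real k) - 1 / 2)
                   / ((2 * pi) powr ((real k + 2) / 2) * X powr (5 / 2) * Y powr (1 / 2))
                   * (pi powr (1 / 2) + (\<Sum>j = 1..k - 1. d j * Y powi (- int j)) + E)"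
    if sp: "saddle_parameters k n X Y" and XX0: "X \<ge> X0" for n X Y
  proof -
    define W where "W = exp ((real k + 1) * (saddle_coefficient k * X powr (1 / real k)) - 1 / 2) * X powr (- 1 / 2) * (2 * pi) powr (- (real k / 2))"
    define s where "s = X powr (1 / real k)"
    define m where "m = real (num_power_partitions k (n + 1)) - real (num_power_partitions k n)"
    have X: "X > 0" and Y: "Y = (real k + 1) / (2 * real k) * (A * s) - 1 / 4"
      using sp unfolding saddle_parameters_iff[OF k0] A_def s_def by auto
    have Y1: "Y \<ge> 1" and est': "norm (of_real (2 * pi * m) - of_real (W / X ^ 2) * J Y)
       \<le> W * C * (1 / (X ^ 3 * sqrt Y) + exp (- (c * s)))"
      using est[rule_format, of n X Y W] sp XX0 unfolding W_def m_def s_def J_def by auto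
    have s: "s > 0" using X by (simp add: s_def)
    have Xs: "X = s ^ k" using X k0 by (simp add: s_def powr_realpow[symmetric] powr_powr)
    have "(real k + 1) / (2 * real k) \<le> 1" using k0 by simp
    then have "(real k + 1) / (2 * real k) * (A * s) \<le> 1 * (A * s)" using A s by (intro mult_right_mono) auto
    then have YA: "Y \<le> A * s" unfolding Y by simp
    have W: "W > 0" using X by (simp add: W_def)
    \<comment> \<open>This is 2 pi times the prefactor of the statement; dividing by it isolates the
      bracket.\<close>
    define S where "S = W / X ^ 2 / sqrt Y"
    have S: "S > 0" using W X Y1 by (simp add: S_def)
    define P where "P = (\<Sum>j<k. d' j * of_real (Y powr (- real j)))"
    define R where "R = J Y - of_real (Y powr (- 1 / 2)) * P"
    have Yh: "Y powr (- 1 / 2) = 1 / sqrt Y"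
      using Y1 by (simp add: powr_minus powr_half_sqrt inverse_eq_divide)
    have Yp: "Y powr (- real j) = inverse (Y ^ j)" for j using Y1 by (simp add: powr_minus powr_realpow)
    have R: "norm R \<le> Cd * (1 / sqrt Y * inverse (Y ^ k))"
    proof -
      have "Y powr (- 1 / 2 - real k) = 1 / sqrt Y * inverse (Y ^ k)"
        using powr_add[of Y "- 1 / 2" "- real k"] by (simp only: Yh Yp) simp
      then show ?thesis using d'[rule_format, OF Y1] unfolding R_def P_def by simp
    qed
    define Q where "Q = 2 * pi * m / S"
    have "of_real (2 * pi * m) - of_real S * P = (of_real (2 * pi * m) - of_real (W / X ^ 2) * J Y) + of_real (W / X ^ 2) * R"
      unfolding R_def S_def Yh by (simp add: right_diff_distrib)
    then have "norm (of_real (2 * pi * m) - of_real S * P)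
       \<le> norm (of_real (2 * pi * m) - of_real (W / X ^ 2) * J Y) + norm (of_real (W / X ^ 2) * R)"
      by (simp only: norm_triangle_ineq)
    also have "norm (of_real (W / X ^ 2) * R) = W / X ^ 2 * norm R" using W X by (simp add: norm_mult norm_divide norm_power)
    also have "W / X ^ 2 * norm R \<le> W / X ^ 2 * (Cd * (1 / sqrt Y * inverse (Y ^ k)))"
      using R W X by (intro mult_left_mono) auto
    also have "\<dots> = S * (Cd * inverse (Y ^ k))" by (simp add: S_def)
    also have "norm (of_real (2 * pi * m) - of_real (W / X ^ 2) * J Y) \<le> S * (C * (1 / X + X ^ 2 * sqrt Y * exp (- (c * s))))"
    proof -
      have "S * (C * (1 / X + X ^ 2 * sqrt Y * exp (- (c * s)))) = W * C * (1 / (X ^ 3 * sqrt Y) + exp (- (c * s)))"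
      proof -
        have q: "sqrt Y \<noteq> 0" "X \<noteq> 0" using X Y1 by auto
        then have "W / X ^ 2 / q * (1 / X + X ^ 2 * q * e) = W * (1 / (X ^ 3 * q) + e)" if "q \<noteq> 0" for q e
          using that by (simp add: distrib_left power2_eq_square power3_eq_cube)
        from this[OF q(1), of "exp (- (c * s))"] show ?thesis unfolding S_def by (simp only: mult.left_commute[of _ C] mult.assoc)
      qed
      then show ?thesis using est' by (simp only:)
    qed
    also have "S * (C * (1 / X + X ^ 2 * sqrt Y * exp (- (c * s)))) + S * (Cd * inverse (Y ^ k)) \<le> S * (K * inverse (Y ^ k))"
    proof -
      have nn: "1 / X + X ^ 2 * sqrt Y * exp (- (c * s)) \<ge> 0" using X Y1 by simp
      have "C * (1 / X + X ^ 2 * sqrt Y * exp (- (c * s))) \<le> \<bar>C\<bar> * (1 / X + X ^ 2 * sqrt Y * exp (- (c * s)))"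
        using nn by (intro mult_right_mono) auto
      also have "\<dots> \<le> \<bar>C\<bar> * ((A ^ k + A ^ (k + 1) * fact (3 * k + 1) / c ^ (3 * k + 1)) * inverse (Y ^ k))"
        by (intro mult_left_mono saddle_error_bound A c s Xs Y1 YA) auto
      finally have "C * (1 / X + X ^ 2 * sqrt Y * exp (- (c * s))) + Cd * inverse (Y ^ k) \<le> K * inverse (Y ^ k)"
        by (simp only: K_def distrib_right mult.assoc)
      then show ?thesis unfolding distrib_left[symmetric] using S by (intro mult_left_mono) auto
    qed
    finally have bd: "norm (of_real (2 * pi * m) - of_real S * P) \<le> S * (K * inverse (Y ^ k))" by simp
    have "of_real (2 * pi * m) - of_real S * P = of_real S * (of_real Q - P)"
      using S by (simp add: Q_def right_diff_distrib)
    then have "S * norm (of_real Q - P) \<le> S * (K * inverse (Y ^ k))" using bd S by (simp add: norm_mult)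
    then have QP: "norm (of_real Q - P) \<le> K * inverse (Y ^ k)" using S by simp
    define E where "E = Q - Re P"
    have "\<bar>E\<bar> \<le> K * inverse (Y ^ k)"
      using abs_Re_le_cmod[of "of_real Q - P"] QP by (simp add: E_def)
    then have Eb: "\<bar>E\<bar> \<le> K * Y powi (- int k)" by (simp add: power_int_minus)
    have "Re P = (\<Sum>j<k. d j * Y powi (- int j))"
      unfolding P_def d_def Yp by (simp only: Re_sum times_complex.sel Re_complex_of_real Im_complex_of_real mult_zero_right diff_zero power_int_minus power_int_of_nat)
    also have "{..<k} = insert 0 {1..k - 1}" using k0 by auto
    also have "(\<Sum>j\<in>insert 0 {1..k - 1}. d j * Y powi (- int j)) = d 0 * Y powi (- int 0) + (\<Sum>j = 1..k - 1. d j * Y powi (- int j))"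
      by (rule sum.insert) auto
    also have "d 0 * Y powi (- int 0) = pi powr (1 / 2)" by (simp add: d_def d0 powr_half_sqrt)
    finally have ReP: "Re P = pi powr (1 / 2) + (\<Sum>j = 1..k - 1. d j * Y powi (- int j))" .
    have "m = S / (2 * pi) * Q" using S by (simp add: Q_def)
    also have "Q = pi powr (1 / 2) + (\<Sum>j = 1..k - 1. d j * Y powi (- int j)) + E" unfolding E_def ReP by simp
    finally have "m = S / (2 * pi) * (pi powr (1 / 2) + (\<Sum>j = 1..k - 1. d j * Y powi (- int j)) + E)" .
    then have "m = exp ((real k + 1) / real k ^ 2 * zeta_real ((real k + 1) / real k)
                          * Gamma (1 / real k) * X powr (1 / real k) - 1 / 2)
                   / ((2 * pi) powr ((real k + 2) / 2) * X powr (5 / 2) * Y powr (1 / 2))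
                   * (pi powr (1 / 2) + (\<Sum>j = 1..k - 1. d j * Y powi (- int j)) + E)"
      unfolding S_def using saddle_prefactor[OF X _ k0 W_def, of Y] Y1 by simp
    with Eb show ?thesis unfolding m_def by blast
  qed
  have "\<forall>\<^sub>F n in sequentially. (\<exists>X Y. saddle_parameters k n X Y) \<and> (\<forall>X Y. saddle_parameters k n X Y \<longrightarrow> X \<ge> X0)"
    by (rule eventually_conj[OF saddle_parameters_exist[OF k0] saddle_parameters_large[OF k0]])
  then show ?thesis
    by (intro exI[of _ d] exI[of _ K]) (erule eventually_mono, use main in blast)
qed

end
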